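(* Let $N\ge2$ and let $U\ge N$ be an integer with a prime divisor $U_1\in[N^{1/4},N^{3/4}]$. Let $\mathcal{U}\subset\mathbb{Z}/U\mathbb{Z}$ be a set all of whose subset sums modulo $U_1$ are distinct, i.e. for any two distinct subsets $\mathcal{A}\neq\mathcal{B}$ of $\mathcal{U}$ one has $\sum_{u\in\mathcal{A}}u\not\equiv\sum_{u\in\mathcal{B}}u \pmod{U_1}$. For any complex-valued function $f$ with support inside a nonempty subset $S$ of the primes of $\{N^{1/4},\ldots,N\}$ (that is, primes $p$ with $N^{1/4}\le p\le N$), we have $$\sum_{u\in\mathcal{U}}\biggl|\sum_{p\le N}f(p)\,e\Bigl(\frac{up}{U}\Bigr)\biggr|^2\le 30\,|S|\,\|f\|_2^2\,e^{U/N}\,\log\frac{8N}{|S|\log N}.$$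
   Context: Notation: the letter $p$ denotes a prime; $e(y)=\exp(2i\pi y)$; $\|f\|_2^2=\sum_n|f(n)|^2$; $|S|$ is the cardinality of $S$. Since $U_1$ divides $U$, reduction modulo $U_1$ is well defined on $\mathbb{Z}/U\mathbb{Z}$. *)

theory Defs
  imports "HOL-Number_Theory.Number_Theory" "HOL-Analysis.Analysis"
begin

definition e :: "real \<Rightarrow> complex" where
  "e y = exp (2 * \<i> * of_real pi * of_real y)"

definition l2_norm_sq :: "(nat \<Rightarrow> complex) \<Rightarrow> real" where
  "l2_norm_sq f = (\<Sum>\<^sub>\<infinity>n. (cmod (f n))\<^sup>2)"

text \<open>
  Elements of \<open>\<int>/U\<int>\<close> are given by their representatives in
  \<open>carrier (residue_ring U) = {0..U - 1}\<close>. Sums are taken in the integers and only then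
  reduced modulo \<open>m\<close>; when \<open>m\<close> divides \<open>U\<close> the resulting condition does not depend on
  the choice of representatives.
\<close>

definition distinct_subset_sums_mod :: "int set \<Rightarrow> int \<Rightarrow> bool" where
  "distinct_subset_sums_mod X m \<longleftrightarrow>
     (\<forall>A B. A \<subseteq> X \<longrightarrow> B \<subseteq> X \<longrightarrow> A \<noteq> B \<longrightarrow> \<not> [\<Sum>A = \<Sum>B] (mod m))"

end

theory Submission
  imports Defs "HOL-Computational_Algebra.Squarefree"
begin

text \<open>
  By duality it suffices to bound the mean square over \<open>S\<close> of a real trigonometric polynomial \<open>h\<close>
  with frequencies in \<open>\<U>\<close>, and hence to bound the mean of \<open>exp h\<close> over primes. The function
  \<open>exp h\<close> is dominated by a Riesz product, whose spectrum consists of the sums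
  \<open>v(\<epsilon>) = \<Sum>\<epsilon>\<^sub>u u\<close> with signs \<open>\<epsilon>\<^sub>u \<in> {-1, 0, 1}\<close>, and the primes are dominated by a Selberg weight
  sieving only by primes \<open>r\<close> with \<open>exp (J\<^sub>0\<^sup>2) < r < N\<^bsup>1/4\<^esup>\<close>, localized to \<open>[0, U]\<close> by a Fejer kernel on a
  long cyclic group. Only frequencies \<open>v(\<epsilon>)/U\<close> close to a fraction \<open>a/q\<close> interact with the weight, and they
  do so with relative strength about \<open>1/q\<close>.

  Dissociativity bounds the number of such \<open>\<epsilon>\<close>: since \<open>q\<close> is prime to \<open>U\<^sub>1\<close>, few \<open>\<epsilon>\<close> with small support can
  have \<open>q v(\<epsilon>)\<close> within \<open>q/4\<close> of a multiple of \<open>U\<close>, and \<open>\<Sum> 2\<^bsup>-|\<epsilon>|\<^esup> \<le> q\<close> over all of them. By Cauchy-Schwarz the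
  nonzero frequencies then contribute less than the zero frequency. Leaving out the primes below
  \<open>exp (J\<^sub>0\<^sup>2)\<close> costs a factor \<open>1 + J\<^sub>0\<^sup>2\<close>; choosing \<open>J\<^sub>0\<close> as a power of \<open>8 N / (|S| log N)\<close> makes this cost
  a multiple of the logarithm in the statement. If \<open>\<U>\<close> has at most 40 elements, the trivial bound suffices.
\<close>

section \<open>Elementary prime number estimates\<close>

text \<open>The obstacle is the loss in Cauchy-Schwarz over sign vectors. If sigma denotes the
  squared length of the coefficient vector, the weighted norm of the Riesz coefficients costs a
  factor exp(sigma). The count of vectors near fractions with denominator q gains only 2^J over the
  trivial bound, where J is about sqrt(ln q), while the local factors 9^omega(q) / q summed over q
  grow like a power of ln q. If every prime factor of q exceeds exp(J0^2), the gain wins and the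
  nonzero frequencies total at most exp(sigma) * J0^(-15) relative to the zero frequency. This is
  harmless once exp(sigma) <= J0^15. The final constant is of the form A^2 / sigma with A comparable
  to the logarithm L in the statement, so sigma must be a multiple of L, which is why J0 is a power
  of exp(L).

  The exponent 1/4 arises because |V|^2 involves two sieve moduli and two pairs have to be compared:
  four moduli below z give a common denominator below z^4, and this must not exceed U.\<close>

lemma prod_primes_dvd:
  fixes n :: nat
  assumes "finite A" "\<And>p. p \<in> A \<Longrightarrow> prime p" "\<And>p. p \<in> A \<Longrightarrow> p dvd n"
  shows "\<Prod>A dvd n"
  using assms
proof (induction A rule: finite_induct)
  case (insert p A)
  have "coprime p (\<Prod>A)"
    using insert by (intro prod_coprime_right) (auto intro!: primes_coprime)
  then show ?case
    using insert by (simp add: divides_mult)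
qed simp

lemma prod_primes_inj:
  fixes A B :: "nat set"
  assumes "finite A" "finite B" "\<And>p. p \<in> A \<union> B \<Longrightarrow> prime p" "\<Prod>A = \<Prod>B"
  shows "A = B"
proof -
  have *: "p \<in> B'" if "finite A'" "finite B'" "\<And>p. p \<in> A' \<union> B' \<Longrightarrow> prime p" "\<Prod>A' = \<Prod>B'" "p \<in> A'"
    for A' B' :: "nat set" and p
  proof -
    have "p dvd \<Prod>B'"
      using that by (metis dvd_prodI id_apply prod.cong)
    moreover have "prime p" using that by auto
    ultimately have "\<exists>b\<in>B'. p dvd b"
      using that(2) prime_dvd_prod_iff[of B' p "\<lambda>x. x"] by simp
    then obtain b where b: "b \<in> B'" "p dvd b" by blast
    then have "p = b" using \<open>prime p\<close> that(3)[of b] by (simp add: primes_dvd_imp_eq)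
    with b show ?thesis by simp
  qed
  show ?thesis
  proof (intro equalityI subsetI)
    show "p \<in> B" if "p \<in> A" for p using assms that by (intro *[of A B]) auto
    show "p \<in> A" if "p \<in> B" for p using assms that by (intro *[of B A]) auto
  qed
qed

text \<open>Erdos's argument: for n = 2 m + 1, the primes in (m + 1, 2 m + 1] all divide (2 m + 1
  choose m), which is at most 4^m because it occurs twice in a row of sum 2^(2 m + 1). An even n > 2
  adds no prime to those up to n - 1.\<close>

lemma primorial_le: "\<Prod>{p. prime p \<and> p \<le> (n::nat)} \<le> 4 ^ n"
proof (induction n rule: less_induct)
  case (less n)
  consider "n \<le> 2" | "n > 2" "even n" | "n > 2" "odd n" by linarith
  then show ?case
  proof cases
    case 1
    then have "n = 0 \<or> n = 1 \<or> n = 2" by auto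
    moreover have "{p. prime p \<and> p \<le> (0::nat)} = {}" "{p. prime p \<and> p \<le> (1::nat)} = {}"
      by (auto dest: prime_ge_2_nat)
    moreover have "{p. prime p \<and> p \<le> (2::nat)} = {2}"
      using two_is_prime_nat by (auto intro!: order.antisym dest: prime_ge_2_nat)
    ultimately show ?thesis by (elim disjE) (simp_all only:, simp_all)
  next
    case 2
    then have "\<not> prime n" using prime_odd_nat by blast
    then have "p \<le> n - 1" if "prime p" "p \<le> n" for p
      using that by (cases "p = n") auto
    then have "{p. prime p \<and> p \<le> n} = {p. prime p \<and> p \<le> n - 1}" by auto
    then have "\<Prod>{p. prime p \<and> p \<le> n} \<le> 4 ^ (n - 1)"
      using less.IH[of "n - 1"] 2 by simp
    also have "\<dots> \<le> 4 ^ n" by (simp add: power_increasing)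
    finally show ?thesis .
  next
    case 3
    then obtain m where m: "n = 2 * m + 1" by (auto elim: oddE)
    have "m \<ge> 1" using m 3 by simp
    let ?Q = "{p. prime p \<and> m + 1 < p \<and> p \<le> 2 * m + 1}"
    have eq: "{p. prime p \<and> p \<le> n} = {p. prime p \<and> p \<le> m + 1} \<union> ?Q"
      using m by auto
    have fin: "finite ?Q" "finite {p. prime p \<and> p \<le> m + 1}" by auto
    have "p dvd (2 * m + 1) choose m" if p: "p \<in> ?Q" for p
    proof -
      have "fact m * fact (m + 1) * ((2 * m + 1) choose m) = (fact (2 * m + 1) :: nat)"
        using binomial_fact_lemma[of m "2 * m + 1"] by (simp add: add.commute)
      moreover have "p dvd fact (2 * m + 1)"
        using p by (simp add: prime_dvd_fact_iff del: fact_Suc)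
      moreover have "\<not> p dvd fact m" "\<not> p dvd fact (m + 1)"
        using p by (auto simp: prime_dvd_fact_iff simp del: fact_Suc)
      ultimately show ?thesis
        using p by (metis (no_types, lifting) mem_Collect_eq prime_dvd_mult_nat)
    qed
    then have "\<Prod>?Q dvd (2 * m + 1) choose m"
      using fin by (intro prod_primes_dvd) auto
    then have Q: "\<Prod>?Q \<le> (2 * m + 1) choose m"
      by (intro dvd_imp_le) (auto simp: zero_less_binomial_iff)
    have "2 * ((2 * m + 1) choose m) = (\<Sum>k\<in>{m, m + 1}. (2 * m + 1) choose k)"
      using binomial_symmetric[of m "2 * m + 1"] by simp
    also have "\<dots> \<le> (\<Sum>k\<le>2 * m + 1. (2 * m + 1) choose k)"
      by (rule sum_mono2) auto
    also have "\<dots> = 2 ^ (2 * m + 1)" by (rule choose_row_sum)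
    finally have "(2 * m + 1) choose m \<le> 4 ^ m" by (simp add: power_mult)
    with Q have Q': "\<Prod>?Q \<le> 4 ^ m" by linarith
    have "\<Prod>{p. prime p \<and> p \<le> n} = \<Prod>{p. prime p \<and> p \<le> m + 1} * \<Prod>?Q"
      unfolding eq by (rule prod.union_disjoint) (use fin in auto)
    also have "\<dots> \<le> 4 ^ (m + 1) * 4 ^ m"
      using less.IH[of "m + 1"] Q' m \<open>m \<ge> 1\<close> by (intro mult_mono) auto
    also have "\<dots> = 4 ^ n" unfolding m by (simp flip: power_add add: mult_2)
    finally show ?thesis .
  qed
qed

lemma sum_ln_primes_le: "(\<Sum>p | prime p \<and> p \<le> n. ln (real p)) \<le> real n * ln 4"
proof -
  have "(\<Sum>p | prime p \<and> p \<le> n. ln (real p)) = ln (real (\<Prod>{p. prime p \<and> p \<le> n}))"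
    by (subst of_nat_prod, subst ln_prod) (auto simp: prime_gt_0_nat)
  also have "\<dots> \<le> ln (real (4 ^ n))"
    using primorial_le[of n] prime_gt_0_nat
    by (subst ln_le_cancel_iff) (auto intro!: prod_pos simp del: of_nat_power of_nat_prod simp: of_nat_le_iff)
  also have "\<dots> = real n * ln 4" by (simp add: ln_realpow)
  finally show ?thesis .
qed

lemma card_multiples: "card {k\<in>{1..n}. p dvd k} = n div p" if "p > 0" for p n :: nat
proof -
  have "{k\<in>{1..n}. p dvd k} = (\<lambda>i. p * i) ` {1..n div p}"
  proof (intro equalityI subsetI)
    fix k assume k: "k \<in> {k\<in>{1..n}. p dvd k}"
    then obtain i where i: "k = p * i" by auto
    then have "i \<ge> 1" "i \<le> n div p" using k that
      by (auto simp: less_eq_div_iff_mult_less_eq mult.commute Suc_le_eq intro: Nat.gr0I)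
    then show "k \<in> (\<lambda>i. p * i) ` {1..n div p}" using i by auto
  next
    fix k assume "k \<in> (\<lambda>i. p * i) ` {1..n div p}"
    then obtain i where i: "k = p * i" "i \<ge> 1" "i \<le> n div p" by (metis (no_types, lifting) atLeastAtMost_iff imageE)
    then show "k \<in> {k\<in>{1..n}. p dvd k}"
      using that by (auto simp: less_eq_div_iff_mult_less_eq mult.commute)
  qed
  then show ?thesis
    using that by (simp add: card_image inj_on_def)
qed

text \<open>The upper half of Mertens' first theorem. By double counting, the sum of ln p * (n div
  p) is at most the sum of ln k over k <= n. Replacing n div p by n / p - 1 costs the sum of ln p,
  which is at most n ln 4.\<close>

lemma sum_ln_over_primes_le:
  assumes "n \<ge> 1"
  shows "(\<Sum>p | prime p \<and> p \<le> n. ln (real p) / real p) \<le> ln (real n) + ln 4"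
proof -
  let ?P = "{p. prime p \<and> p \<le> n}"
  have fin: "finite ?P" by auto
  have "real n * (\<Sum>p\<in>?P. ln (real p) / real p) - (\<Sum>p\<in>?P. ln (real p))
      = (\<Sum>p\<in>?P. ln (real p) * (real n / real p - 1))"
    by (simp add: sum_distrib_left algebra_simps sum_subtractf)
  also have "\<dots> \<le> (\<Sum>p\<in>?P. ln (real p) * real (n div p))"
  proof (rule sum_mono)
    fix p assume p: "p \<in> ?P"
    then have p0: "p > 0" by (auto simp: prime_gt_0_nat)
    have "real n = real p * real (n div p) + real (n mod p)"
      by (metis mult_div_mod_eq of_nat_add of_nat_mult)
    also have "real (n mod p) \<le> real p" using p0 by (simp add: less_imp_le)
    finally have "real n / real p \<le> real (n div p) + 1"
      using p0 by (simp add: field_simps)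
    then show "ln (real p) * (real n / real p - 1) \<le> ln (real p) * real (n div p)"
      using p0 by (intro mult_left_mono) auto
  qed
  also have "\<dots> = (\<Sum>p\<in>?P. \<Sum>k\<in>{k\<in>{1..n}. p dvd k}. ln (real p))"
  proof (intro sum.cong refl)
    fix p assume "p \<in> ?P"
    then have "card {k \<in> {1..n}. p dvd k} = n div p"
      by (intro card_multiples) (auto simp: prime_gt_0_nat)
    then show "ln (real p) * real (n div p) = (\<Sum>k\<in>{k\<in>{1..n}. p dvd k}. ln (real p))"
      by (simp only: sum_constant) (rule mult.commute)
  qed
  also have "\<dots> = (\<Sum>k\<in>{1..n}. \<Sum>p\<in>{p\<in>?P. p dvd k}. ln (real p))"
    by (rule sum.swap_restrict) auto
  also have "\<dots> \<le> (\<Sum>k\<in>{1..n}. ln (real k))"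
  proof (rule sum_mono)
    fix k assume k: "k \<in> {1..n}"
    let ?A = "{p\<in>?P. p dvd k}"
    have "\<Prod>?A dvd k" by (rule prod_primes_dvd) auto
    then have "\<Prod>?A \<le> k" using k by (intro dvd_imp_le) auto
    moreover have "\<Prod>?A > 0" by (rule prod_pos) (auto simp: prime_gt_0_nat)
    ultimately have "ln (real (\<Prod>?A)) \<le> ln (real k)"
      by (subst ln_le_cancel_iff) (use k in \<open>simp_all del: of_nat_prod\<close>)
    moreover have "ln (real (\<Prod>?A)) = (\<Sum>p\<in>?A. ln (real p))"
      by (subst of_nat_prod, subst ln_prod) (auto simp: prime_gt_0_nat)
    ultimately show "(\<Sum>p\<in>?A. ln (real p)) \<le> ln (real k)" by simp
  qed
  also have "\<dots> \<le> (\<Sum>k\<in>{1..n}. ln (real n))"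
    by (rule sum_mono) auto
  finally have "real n * (\<Sum>p\<in>?P. ln (real p) / real p) \<le> real n * (ln (real n) + ln 4)"
    using sum_ln_primes_le[of n] by (simp add: algebra_simps)
  then show ?thesis using assms by simp
qed

text \<open>Chebyshev's bound with a free cut: primes up to N^a are counted trivially, and each
  larger one contributes at least a ln N to the sum of ln p. The cut is 4/5 in the estimate for
  large N and 1/2 in the one valid for all N.\<close>

lemma card_primes_le:
  fixes N a :: real
  assumes "N > 1" "0 < a" and S: "S \<subseteq> {p. prime p \<and> real p \<le> N}"
  shows "real (card S) * ln N \<le> N powr a * ln N + N * ln 4 / a"
proof -
  have finN: "finite {p::nat. real p \<le> N}"
    by (rule finite_subset[of _ "{..nat \<lfloor>N\<rfloor>}"]) (auto simp: le_nat_floor)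
  have fin: "finite S" by (rule finite_subset[OF _ finN]) (use S in auto)
  let ?S1 = "{p\<in>S. real p \<le> N powr a}" and ?S2 = "{p\<in>S. real p > N powr a}"
  have "?S1 \<subseteq> {1..nat \<lfloor>N powr a\<rfloor>}"
    using S by (auto simp: le_nat_floor Suc_le_eq dest!: subsetD prime_gt_0_nat)
  then have "card ?S1 \<le> card {1..nat \<lfloor>N powr a\<rfloor>}" by (intro card_mono) auto
  also have "\<dots> = nat \<lfloor>N powr a\<rfloor>" by simp
  finally have "real (card ?S1) \<le> real (nat \<lfloor>N powr a\<rfloor>)" by (rule of_nat_mono)
  also have "\<dots> \<le> N powr a" by (rule of_nat_floor) simp
  finally have c1: "real (card ?S1) \<le> N powr a" .
  have "real (card ?S2) * (a * ln N) = (\<Sum>p\<in>?S2. a * ln N)" by simp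
  also have "\<dots> \<le> (\<Sum>p\<in>?S2. ln (real p))"
  proof (rule sum_mono)
    fix p assume "p \<in> ?S2"
    then have "N powr a < real p" by auto
    then have "ln (N powr a) \<le> ln (real p)"
      using assms by (intro ln_mono) auto
    then show "a * ln N \<le> ln (real p)" using assms by (simp add: ln_powr)
  qed
  also have "\<dots> \<le> (\<Sum>p | prime p \<and> p \<le> nat \<lfloor>N\<rfloor>. ln (real p))"
    using S by (intro sum_mono2) (auto simp: le_nat_floor Suc_le_eq dest: prime_ge_1_nat)
  also have "\<dots> \<le> real (nat \<lfloor>N\<rfloor>) * ln 4" by (rule sum_ln_primes_le)
  also have "\<dots> \<le> N * ln 4" using assms by (intro mult_right_mono) auto
  finally have c2: "real (card ?S2) * ln N \<le> N * ln 4 / a"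
    using assms by (simp add: field_simps)
  have "card S = card ?S1 + card ?S2"
    by (subst card_Un_disjoint[symmetric]) (use fin in \<open>auto intro!: arg_cong[where f=card]\<close>)
  then have "real (card S) * ln N = real (card ?S1) * ln N + real (card ?S2) * ln N"
    by (simp add: algebra_simps)
  also have "\<dots> \<le> N powr a * ln N + N * ln 4 / a"
    using c1 c2 assms by (intro add_mono mult_right_mono) auto
  finally show ?thesis .
qed

text \<open>Telescoping: t * k^(-1-t) <= (k-1)^(-t) - k^(-t) for k >= 2, which follows from exp(x)
  >= 1 + x.\<close>

lemma sum_powr_le:
  fixes t :: real
  assumes "t > 0"
  shows "(\<Sum>k=1..K. real k powr (- 1 - t)) \<le> 1 + 1 / t"
proof -
  have "t * (\<Sum>k=1..K. real k powr (- 1 - t)) \<le> t + 1 - real K powr (- t)" if "K \<ge> 1"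
    using that
  proof (induction K rule: dec_induct)
    case base
    then show ?case by simp
  next
    case (step K)
    let ?k = "real (Suc K)"
    have k: "?k > 1" "real K > 0" using step by auto
    have eq: "real K powr (-t) = ?k powr (-t) * (1 - 1 / ?k) powr (-t)"
    proof -
      have "?k * (1 - 1 / ?k) = real K" using k by (simp add: right_diff_distrib)
      then show ?thesis
        using k by (subst powr_mult[symmetric]) auto
    qed
    have l: "ln (1 - 1 / ?k) \<le> - (1 / ?k)"
      using k ln_le_minus_one[of "1 - 1 / ?k"] by (simp add: field_simps)
    have "1 + t / ?k \<le> 1 - t * ln (1 - 1 / ?k)"
      using mult_left_mono[OF l, of t] assms by (simp add: field_simps)
    also have "\<dots> \<le> (1 - 1 / ?k) powr (- t)"
      using k exp_ge_add_one_self[of "- t * ln (1 - 1 / ?k)"] by (simp add: powr_def)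
    finally have "?k powr (-t) * (1 + t / ?k) \<le> real K powr (-t)"
      unfolding eq by (intro mult_left_mono) auto
    moreover have "?k powr (- 1 - t) = ?k powr (-t) / ?k"
      using k by (simp add: powr_diff powr_minus field_simps)
    ultimately have "t * ?k powr (- 1 - t) \<le> real K powr (-t) - ?k powr (-t)"
      by (simp add: algebra_simps)
    then show ?case using step by (simp add: algebra_simps)
  qed
  moreover have "0 \<le> real K powr (- t)" by simp
  ultimately have "K \<ge> 1 \<Longrightarrow> t * (\<Sum>k=1..K. real k powr (- 1 - t)) \<le> t + 1"
    by linarith
  then show ?thesis using assms
    by (cases "K \<ge> 1") (auto simp: field_simps)
qed

text \<open>Rankin's trick: compare \<open>1/p\<close> with \<open>p\<^bsup>-1-t\<^esup>\<close> for \<open>t = 1 / ln x\<close> and expand the product into a partial zeta sum.\<close>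

lemma prod_one_plus_inverse_primes_le:
  fixes x :: real
  assumes x: "x \<ge> 4" and P: "\<And>p. p \<in> P \<Longrightarrow> prime p \<and> real p \<le> x"
  shows "(\<Prod>p\<in>P. 1 + 1 / real p) \<le> exp 2 * (1 + ln x)"
proof -
  define t where "t = 1 / ln x"
  have lx: "ln x > 0" using x by simp
  then have t: "t > 0" by (simp add: t_def)
  have Psub: "P \<subseteq> {p. prime p \<and> p \<le> nat \<lfloor>x\<rfloor>}" using P by (auto simp: le_nat_floor)
  have fin: "finite P" by (rule finite_subset[OF Psub]) auto
  have p0: "real p > 0" if "p \<in> P" for p using P[OF that] by (auto simp: prime_gt_0_nat)
  have "(\<Prod>p\<in>P. 1 + 1 / real p) \<le> (\<Prod>p\<in>P. (1 + real p powr (- 1 - t)) * exp (t * (ln (real p) / real p)))"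
  proof (rule prod_mono, safe)
    fix p assume p: "p \<in> P"
    note p0[OF p]
    let ?a = "1 / real p" and ?b = "real p powr (- 1 - t)"
    have b: "?b = ?a * exp (- t * ln (real p))"
    proof -
      have "?b = real p powr (-1) * real p powr (-t)" by (subst powr_add[symmetric]) simp
      also have "real p powr (-1) = ?a" using \<open>real p > 0\<close> by (simp add: powr_minus_divide)
      also have "real p powr (-t) = exp (- t * ln (real p))" using \<open>real p > 0\<close> by (simp add: powr_def)
      finally show ?thesis .
    qed
    have "?a * (1 - t * ln (real p)) \<le> ?b"
      unfolding b using exp_ge_add_one_self[of "- t * ln (real p)"] by (intro mult_left_mono) auto
    then have d: "?a - ?b \<le> t * (ln (real p) / real p)" by (simp add: algebra_simps)
    have b0: "?b \<ge> 0" by simp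
    have ln0: "ln (real p) / real p \<ge> 0"
      using P[OF p] by (intro divide_nonneg_nonneg ln_ge_zero) (auto intro: prime_ge_1_nat[simplified])
    have "1 + ?a \<le> (1 + ?b) * (1 + t * (ln (real p) / real p))"
      using d b0 ln0 t mult_nonneg_nonneg[OF b0 mult_nonneg_nonneg[OF less_imp_le[OF t] ln0]]
      by (simp add: algebra_simps)
    also have "\<dots> \<le> (1 + ?b) * exp (t * (ln (real p) / real p))"
      using b0 exp_ge_add_one_self by (intro mult_left_mono) auto
    finally show "1 + 1 / real p \<le> (1 + ?b) * exp (t * (ln (real p) / real p))" .
  qed auto
  also have "\<dots> = (\<Prod>p\<in>P. 1 + real p powr (- 1 - t)) * exp (t * (\<Sum>p\<in>P. ln (real p) / real p))"
    using fin by (simp add: prod.distrib exp_sum sum_distrib_left)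
  also have "\<dots> \<le> (1 + ln x) * exp 2"
  proof (rule mult_mono)
    let ?K = "\<Prod>P"
    have "(\<Prod>p\<in>P. 1 + real p powr (- 1 - t)) = (\<Sum>A\<in>Pow P. \<Prod>p\<in>A. real p powr (- 1 - t))"
      by (subst add.commute, subst prod_add[OF fin]) simp
    also have "\<dots> = (\<Sum>A\<in>Pow P. real (\<Prod>A) powr (- 1 - t))"
      by (intro sum.cong refl) (simp add: prod_powr_distrib)
    also have "\<dots> = (\<Sum>k\<in>Prod ` Pow P. real k powr (- 1 - t))"
    proof (subst sum.reindex)
      show "inj_on Prod (Pow P)"
      proof (rule inj_onI)
        fix A B assume "A \<in> Pow P" "B \<in> Pow P" "\<Prod>A = \<Prod>B"
        then show "A = B"
          using P fin by (intro prod_primes_inj) (auto intro: finite_subset)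
      qed
    qed simp
    also have "\<dots> \<le> (\<Sum>k=1..?K. real k powr (- 1 - t))"
    proof (rule sum_mono2)
      show "Prod ` Pow P \<subseteq> {1..\<Prod>P}"
      proof
        fix k assume "k \<in> Prod ` Pow P"
        then obtain A where A: "A \<subseteq> P" "k = \<Prod>A" by auto
        have "\<Prod>P > 0" by (rule prod_pos) (use P prime_gt_0_nat in auto)
        then show "k \<in> {1..\<Prod>P}"
          unfolding A(2) using prod_dvd_prod_subset[OF fin A(1), of "\<lambda>x. x"]
          by (metis atLeastAtMost_iff dvd_imp_le dvd_pos_nat Suc_le_eq One_nat_def)
      qed
    qed auto
    also have "\<dots> \<le> 1 + 1 / t" using t by (rule sum_powr_le)
    finally show "(\<Prod>p\<in>P. 1 + real p powr (- 1 - t)) \<le> 1 + ln x" by (simp add: t_def)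
    have "(\<Sum>p\<in>P. ln (real p) / real p) \<le> (\<Sum>p | prime p \<and> p \<le> nat \<lfloor>x\<rfloor>. ln (real p) / real p)"
      using Psub prime_ge_1_nat by (intro sum_mono2) auto
    also have "\<dots> \<le> ln (real (nat \<lfloor>x\<rfloor>)) + ln 4"
      using x by (intro sum_ln_over_primes_le) (simp add: le_nat_floor)
    \<comment> \<open>Here x >= 4 absorbs the ln 4 of Mertens' bound; after multiplication by t = 1
      / ln x the exponent is 2.\<close>
    also have "\<dots> \<le> ln x + ln x"
    proof (rule add_mono)
      have "nat \<lfloor>x\<rfloor> \<ge> 1" using x by (simp add: le_nat_floor)
      then show "ln (real (nat \<lfloor>x\<rfloor>)) \<le> ln x"
        using x by (subst ln_le_cancel_iff) auto
    qed (use x in auto)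
    finally have "t * (\<Sum>p\<in>P. ln (real p) / real p) \<le> t * (2 * ln x)"
      using t by (intro mult_left_mono) auto
    also have "\<dots> = 2" using lx by (simp add: t_def)
    finally show "exp (t * (\<Sum>p\<in>P. ln (real p) / real p)) \<le> exp 2" by simp
  qed (use lx in auto)
  finally show ?thesis by (simp add: mult.commute)
qed

lemma sum_inverse_squares_le: "(\<Sum>m=1..n. 1 / (real m)\<^sup>2) \<le> 2"
proof -
  have "(\<Sum>m=1..n. 1 / (real m)\<^sup>2) \<le> 2 - 1 / real n" if "n \<ge> 1"
    using that
  proof (induction n rule: dec_induct)
    case (step n)
    have "1 / (real (Suc n))\<^sup>2 \<le> 1 / (real n * real (Suc n))"
      using step by (intro divide_left_mono) (auto simp: power2_eq_square)
    also have "\<dots> = 1 / real n - 1 / real (Suc n)" using step by (simp add: field_simps)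
    finally show ?case using step by simp
  qed auto
  then show ?thesis by (cases "n \<ge> 1") (auto intro: order_trans)
qed

text \<open>This bounds the later Selberg sum \<open>H\<close> from below. Every k < z is uniquely a
  product of distinct primes above Y, a product of distinct primes at most Y, and a square. The
  harmonic sum is therefore at most the wanted sum, times an Euler product over the primes up to Y,
  times the sum of inverse squares; the last two factors are at most exp 2 * (1 + ln Y) and
  2.\<close>

lemma ln_le_sum_prod_inverse:
  fixes Y z :: real
  assumes Y: "Y \<ge> 4" and z: "z > 1" and fin: "finite P"
    and P: "\<And>r. prime r \<Longrightarrow> Y < real r \<Longrightarrow> real r < z \<Longrightarrow> r \<in> P"
  shows "ln z \<le> (\<Sum>A\<in>{A\<in>Pow P. real (\<Prod>A) < z}. 1 / real (\<Prod>A)) * (2 * (exp 2 * (1 + ln Y)))"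
proof -
  \<comment> \<open>The largest integer strictly below z: every k <= n then meets the strict
    constraint on the products, and still n + 1 >= z.\<close>
  define n where "n = nat (\<lceil>z\<rceil> - 1)"
  have n: "real n < z" "z \<le> real n + 1"
    using z unfolding n_def by (simp_all) linarith+
  define Q where "Q = {p. prime p \<and> real p \<le> Y}"
  have "Q \<subseteq> {p. p \<le> nat \<lfloor>Y\<rfloor>}" by (auto simp: Q_def le_nat_floor)
  then have finQ: "finite Q" by (rule finite_subset) simp
  let ?A = "{A\<in>Pow P. real (\<Prod>A) < z}"
  let ?D = "?A \<times> (Pow Q \<times> {1..n})"
  define a where "a = (\<lambda>k::nat. {p\<in>prime_factors (squarefree_part k). Y < real p})"
  define b where "b = (\<lambda>k::nat. {p\<in>prime_factors (squarefree_part k). real p \<le> Y})"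
  have dec: "\<Prod>(a k) * \<Prod>(b k) * (square_part k)\<^sup>2 = k" if "k > 0" for k
  proof -
    have sf: "squarefree_part k \<noteq> 0" by (rule squarefree_part_nonzero)
    have "squarefree_part k = (\<Prod>p\<in>prime_factors (squarefree_part k). p ^ multiplicity p (squarefree_part k))"
      using sf by (intro prime_factorization_nat) (metis bot_nat_0.not_eq_extremum)
    also have "\<dots> = (\<Prod>p\<in>prime_factors (squarefree_part k). p)"
    proof (rule prod.cong[OF refl])
      fix p assume p: "p \<in> prime_factors (squarefree_part k)"
      then have "multiplicity p (squarefree_part k) \<ge> 1"
        by (simp add: prime_factors_multiplicity Suc_le_eq)
      moreover have "multiplicity p (squarefree_part k) \<le> Suc 0"
        using that by (intro prime_multiplicity_squarefree_part_le_Suc_0) (use p in auto)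
      ultimately have "multiplicity p (squarefree_part k) = 1" by simp
      then show "p ^ multiplicity p (squarefree_part k) = p" by simp
    qed
    also have "\<dots> = \<Prod>(a k) * \<Prod>(b k)"
      by (subst prod.union_disjoint[symmetric]) (auto simp: a_def b_def intro!: prod.cong)
    finally show ?thesis using squarefree_decompose[of k] by simp
  qed
  have pos: "\<Prod>(a k) > 0" "\<Prod>(b k) > 0" for k
    by (auto simp: a_def b_def intro!: prod_pos prime_gt_0_nat)
  have mem: "(a k, b k, square_part k) \<in> ?D" if k: "k \<in> {1..n}" for k
  proof -
    have d: "\<Prod>(a k) * \<Prod>(b k) * (square_part k)\<^sup>2 = k" using dec k by simp
    then have "\<Prod>(a k) dvd k" "(square_part k)\<^sup>2 dvd k"
      by (metis dvd_triv_left mult.assoc) (metis d dvd_triv_right)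
    then have le: "\<Prod>(a k) \<le> k" "square_part k \<le> k"
      using k by (auto dest!: dvd_imp_le) (metis d dvd_imp_le dvd_triv_right dvd_mult2 power2_eq_square mult.assoc dvd_trans less_eq_Suc_le)
    have ak: "real (\<Prod>(a k)) < z" using le k n by (meson atLeastAtMost_iff le_less_trans of_nat_mono)
    have "p \<in> P" if p: "p \<in> a k" for p
    proof (rule P)
      have "p dvd \<Prod>(a k)" using p by (intro dvd_prodI) (auto simp: a_def)
      then have "p \<le> \<Prod>(a k)" using pos by (intro dvd_imp_le) auto
      then show "real p < z" using ak by (meson le_less_trans of_nat_mono)
    qed (use p in \<open>auto simp: a_def\<close>)
    moreover have "b k \<subseteq> Q" by (auto simp: b_def Q_def)
    moreover have "square_part k \<noteq> 0" using k by simp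
    then have "square_part k \<ge> 1" by linarith
    ultimately show ?thesis using ak le k by auto
  qed
  have "ln z \<le> ln (real n + 1)" using z n by (intro ln_mono) auto
  also have "\<dots> \<le> harm n" by (rule ln_le_harm)
  also have "\<dots> = (\<Sum>k=1..n. 1 / real k)" by (simp add: harm_def inverse_eq_divide)
  also have "\<dots> = (\<Sum>k=1..n. 1 / real (\<Prod>(a k)) * (1 / real (\<Prod>(b k)) * (1 / (real (square_part k))\<^sup>2)))"
  proof (rule sum.cong[OF refl])
    fix k assume "k \<in> {1..n}"
    then have "real k = real (\<Prod>(a k)) * real (\<Prod>(b k)) * (real (square_part k))\<^sup>2"
      using dec[of k] by (metis atLeastAtMost_iff less_eq_Suc_le One_nat_def of_nat_mult of_nat_power)
    then show "1 / real k = 1 / real (\<Prod>(a k)) * (1 / real (\<Prod>(b k)) * (1 / (real (square_part k))\<^sup>2))"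
      by simp
  qed
  also have "\<dots> = (\<Sum>(A, B, m)\<in>(\<lambda>k. (a k, b k, square_part k)) ` {1..n}. 1 / real (\<Prod>A) * (1 / real (\<Prod>B) * (1 / (real m)\<^sup>2)))"
  proof (subst sum.reindex)
    show "inj_on (\<lambda>k. (a k, b k, square_part k)) {1..n}"
      by (rule inj_onI) (metis (no_types, lifting) Pair_inject atLeastAtMost_iff dec less_eq_Suc_le One_nat_def)
  qed simp
  also have "\<dots> \<le> (\<Sum>(A, B, m)\<in>?D. 1 / real (\<Prod>A) * (1 / real (\<Prod>B) * (1 / (real m)\<^sup>2)))"
    using fin finQ by (intro sum_mono2 image_subsetI mem) (auto simp: prod_nonneg)
  also have "\<dots> = (\<Sum>A\<in>?A. 1 / real (\<Prod>A)) * ((\<Sum>B\<in>Pow Q. 1 / real (\<Prod>B)) * (\<Sum>m=1..n. 1 / (real m)\<^sup>2))"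
    unfolding sum_product sum.cartesian_product' by (simp add: sum.cartesian_product' sum_distrib_left)
  also have "(\<Sum>B\<in>Pow Q. 1 / real (\<Prod>B)) = (\<Prod>p\<in>Q. 1 + 1 / real p)"
    by (subst add.commute, subst prod_add[OF finQ]) (simp add: prod_dividef)
  also have "(\<Sum>A\<in>?A. 1 / real (\<Prod>A)) * ((\<Prod>p\<in>Q. 1 + 1 / real p) * (\<Sum>m=1..n. 1 / (real m)\<^sup>2))
      \<le> (\<Sum>A\<in>?A. 1 / real (\<Prod>A)) * ((exp 2 * (1 + ln Y)) * 2)"
    using Y sum_inverse_squares_le[of n]
    by (intro mult_left_mono mult_mono prod_one_plus_inverse_primes_le sum_nonneg)
       (auto simp: Q_def intro!: prod_nonneg divide_nonneg_nonneg mult_nonneg_nonneg)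
  finally show ?thesis by (simp add: mult_ac)
qed

section \<open>Sign vectors over a dissociated set\<close>

lemma e_add: "e (x + y) = e x * e y"
  by (simp add: e_def ring_distribs exp_add)

lemma e_0 [simp]: "e 0 = 1"
  by (simp add: e_def)

lemma norm_e [simp]: "cmod (e x) = 1"
  by (simp add: e_def)

lemma cnj_e: "cnj (e x) = e (- x)"
  by (simp add: e_def exp_cnj)

lemma e_eq_1_iff: "e x = 1 \<longleftrightarrow> x \<in> \<int>"
proof -
  have "e x = 1 \<longleftrightarrow> (\<exists>n::int. 2 * pi * x = of_int (2 * n) * pi)"
    by (simp add: e_def exp_eq_1)
  also have "\<dots> \<longleftrightarrow> (\<exists>n::int. x = of_int n)"
    by (intro ex_cong1) (auto simp: field_simps)
  also have "\<dots> \<longleftrightarrow> x \<in> \<int>" by (auto elim: Ints_cases)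
  finally show ?thesis .
qed

lemma e_of_nat_mult: "e (real n * x) = e x ^ n"
  by (induction n) (simp_all add: ring_distribs e_add)

lemma e_sum: "finite A \<Longrightarrow> e (\<Sum>a\<in>A. f a) = (\<Prod>a\<in>A. e (f a))"
  by (induction A rule: finite_induct) (simp_all add: e_add)

lemma sum_e:
  assumes "real M * x \<in> \<int>"
  shows "(\<Sum>n<M. e (real n * x)) = (if x \<in> \<int> then of_nat M else 0)"
proof (cases "x \<in> \<int>")
  case True
  then have "e x = 1" by (simp add: e_eq_1_iff)
  then show ?thesis using True by (simp add: e_of_nat_mult)
next
  case False
  then have ne: "e x \<noteq> 1" by (simp add: e_eq_1_iff)
  have "(\<Sum>n<M. e (real n * x)) = (e x ^ M - 1) / (e x - 1)"
    using ne by (simp add: e_of_nat_mult geometric_sum)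
  also have "e x ^ M = 1" using assms by (simp add: e_eq_1_iff flip: e_of_nat_mult)
  finally show ?thesis using False by simp
qed

section \<open>Counting sign vectors whose frequency is close to a fraction\<close>

locale dissociated =
  fixes X :: "int set" and m U :: int
  assumes finite_X: "finite X"
    and dist: "distinct_subset_sums_mod X m"
    and m_dvd_U: "m dvd U"
begin

definition signs :: "(int \<Rightarrow> int) set" where
  "signs = (\<Pi>\<^sub>E u\<in>X. {-1, 0, 1})"

definition vsum :: "(int \<Rightarrow> int) \<Rightarrow> int" where
  "vsum \<epsilon> = (\<Sum>u\<in>X. \<epsilon> u * u)"

definition supp :: "(int \<Rightarrow> int) \<Rightarrow> int set" where
  "supp \<epsilon> = {u\<in>X. \<epsilon> u \<noteq> 0}"

text \<open>For x = 0 this says that \<open>vsum \<epsilon> / U\<close> lies within 1 / (4 U) of a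
  fraction with denominator q. The shift x is there for the induction in
  \<open>card_near_level_le\<close>, where deleting a coordinate moves the target.\<close>

definition near :: "int \<Rightarrow> int \<Rightarrow> (int \<Rightarrow> int) \<Rightarrow> bool" where
  "near q x \<epsilon> \<longleftrightarrow> (\<exists>t. 4 * \<bar>t\<bar> \<le> q \<and> U dvd q * vsum \<epsilon> - x - t)"

lemma finite_signs [simp]: "finite signs"
  by (auto simp: signs_def finite_X intro!: finite_PiE)

lemma finite_supp [simp]: "finite (supp \<epsilon>)"
  by (auto simp: supp_def finite_X)

lemma signs_cases: "\<epsilon> \<in> signs \<Longrightarrow> u \<in> X \<Longrightarrow> \<epsilon> u = -1 \<or> \<epsilon> u = 0 \<or> \<epsilon> u = 1"
  by (auto simp: signs_def dest: PiE_mem)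

lemma signs_eqI: "\<epsilon> \<in> signs \<Longrightarrow> \<delta> \<in> signs \<Longrightarrow> (\<And>u. u \<in> X \<Longrightarrow> \<epsilon> u = \<delta> u) \<Longrightarrow> \<epsilon> = \<delta>"
  unfolding signs_def by (rule PiE_ext)

lemma subset_sums_eq:
  assumes "A \<subseteq> X" "B \<subseteq> X" "m dvd \<Sum>A - \<Sum>B"
  shows "A = B"
  using dist assms unfolding distinct_subset_sums_mod_def by (auto simp: cong_iff_dvd_diff)

lemma vsum_eq_diff:
  assumes "\<epsilon> \<in> signs"
  shows "vsum \<epsilon> = \<Sum>{u\<in>X. \<epsilon> u = 1} - \<Sum>{u\<in>X. \<epsilon> u = -1}"
proof -
  have "vsum \<epsilon> = (\<Sum>u\<in>X. (if \<epsilon> u = 1 then u else 0) - (if \<epsilon> u = -1 then u else 0))"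
    unfolding vsum_def
    by (rule sum.cong) (use signs_cases[OF assms] in auto)
  then show ?thesis by (simp add: sum_subtractf sum.If_cases finite_X Int_def)
qed

text \<open>The positions of 1 and of -1 form two subsets with equal sums modulo m, so they
  coincide; being disjoint, they are empty.\<close>

lemma vsum_zero:
  assumes "\<epsilon> \<in> signs" "m dvd vsum \<epsilon>" "u \<in> X"
  shows "\<epsilon> u = 0"
proof -
  have "{u\<in>X. \<epsilon> u = 1} = {u\<in>X. \<epsilon> u = -1}"
    using assms vsum_eq_diff by (intro subset_sums_eq) auto
  then show ?thesis using signs_cases[OF assms(1,3)] assms(3) by fastforce
qed

text \<open>
  Each \<open>\<epsilon>\<close> is the difference of the indicators of \<open>2\<^bsup>|X| - |supp \<epsilon>|\<^esup>\<close> pairs of subsets \<open>(A, B)\<close>; for given \<open>A\<close> and \<open>t\<close>,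
  dissociativity leaves at most one \<open>B\<close>.
\<close>

lemma sum_near_le:
  assumes q: "q \<ge> 2" "coprime q m"
  shows "(\<Sum>\<epsilon>\<in>{\<epsilon>\<in>signs. near q 0 \<epsilon>}. (1/2) ^ card (supp \<epsilon>)) \<le> real_of_int q"
proof -
  let ?N = "{\<epsilon>\<in>signs. near q 0 \<epsilon>}"
  define t where "t = (\<lambda>\<epsilon>. SOME t. 4 * \<bar>t\<bar> \<le> q \<and> U dvd q * vsum \<epsilon> - 0 - t)"
  have t: "4 * \<bar>t \<epsilon>\<bar> \<le> q" "U dvd q * vsum \<epsilon> - t \<epsilon>" if "\<epsilon> \<in> ?N" for \<epsilon>
    using someI_ex[of "\<lambda>t. 4 * \<bar>t\<bar> \<le> q \<and> U dvd q * vsum \<epsilon> - 0 - t"] that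
    unfolding near_def t_def by auto
  define pos neg where "pos = (\<lambda>\<epsilon>. {u\<in>X. \<epsilon> u = (1::int)})" and "neg = (\<lambda>\<epsilon>. {u\<in>X. \<epsilon> u = (-1::int)})"
  let ?D = "SIGMA \<epsilon>:?N. Pow (X - supp \<epsilon>)"
  let ?f = "\<lambda>(\<epsilon>, C). (pos \<epsilon> \<union> C, t \<epsilon>)"
  have inj: "inj_on ?f ?D"
  proof (rule inj_onI, clarify)
    fix \<epsilon> C \<epsilon>' C'
    assume a: "\<epsilon> \<in> signs" "near q 0 \<epsilon>" "C \<subseteq> X - supp \<epsilon>" "\<epsilon>' \<in> signs" "near q 0 \<epsilon>'" "C' \<subseteq> X - supp \<epsilon>'"
      and eq: "pos \<epsilon> \<union> C = pos \<epsilon>' \<union> C'" "t \<epsilon> = t \<epsilon>'"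
    have *: "\<Sum>(pos \<epsilon> \<union> C) - \<Sum>(neg \<epsilon> \<union> C) = vsum \<epsilon>" if "\<epsilon> \<in> signs" "C \<subseteq> X - supp \<epsilon>" for \<epsilon> C
    proof -
      have fin: "finite C" "finite (pos \<epsilon>)" "finite (neg \<epsilon>)"
        using finite_X that by (auto simp: pos_def neg_def intro: finite_subset)
      have "\<Sum>(pos \<epsilon> \<union> C) = \<Sum>(pos \<epsilon>) + \<Sum>C" "\<Sum>(neg \<epsilon> \<union> C) = \<Sum>(neg \<epsilon>) + \<Sum>C"
        using that fin by (auto simp: pos_def neg_def supp_def intro!: sum.union_disjoint)
      then show ?thesis using vsum_eq_diff[OF that(1)] by (simp add: pos_def neg_def)
    qed
    have "U dvd (q * vsum \<epsilon> - t \<epsilon>) - (q * vsum \<epsilon>' - t \<epsilon>')"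
      by (rule dvd_diff) (use t a in simp_all)
    also have "\<dots> = q * (vsum \<epsilon> - vsum \<epsilon>')" using eq by (simp add: algebra_simps)
    finally have "m dvd q * (vsum \<epsilon> - vsum \<epsilon>')" using m_dvd_U dvd_trans by blast
    then have "m dvd vsum \<epsilon> - vsum \<epsilon>'"
      using q by (simp add: coprime_commute coprime_dvd_mult_right_iff)
    also have "vsum \<epsilon> - vsum \<epsilon>' = \<Sum>(neg \<epsilon>' \<union> C') - \<Sum>(neg \<epsilon> \<union> C)"
      using *[of \<epsilon> C] *[of \<epsilon>' C'] a eq by simp
    finally have eqn: "neg \<epsilon>' \<union> C' = neg \<epsilon> \<union> C"
      using a by (intro subset_sums_eq) (auto simp: neg_def)
    have *: "\<epsilon> u = of_bool (u \<in> pos \<epsilon> \<union> C) - of_bool (u \<in> neg \<epsilon> \<union> C)" "u \<in> C \<longleftrightarrow> u \<in> pos \<epsilon> \<union> C \<and> u \<in> neg \<epsilon> \<union> C"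
      if "\<epsilon> \<in> signs" "C \<subseteq> X - supp \<epsilon>" "u \<in> X" for \<epsilon> C u
      using signs_cases[OF that(1,3)] that by (auto simp: pos_def neg_def supp_def)
    have "\<epsilon> = \<epsilon>'"
      using *(1)[of \<epsilon> C] *(1)[of \<epsilon>' C'] a eq eqn by (intro signs_eqI) auto
    moreover have "C = C'"
      using *(2)[of \<epsilon> C] *(2)[of \<epsilon>' C'] a eq eqn by blast
    ultimately show "\<epsilon> = \<epsilon>' \<and> C = C'" by simp
  qed
  have sub: "?f ` ?D \<subseteq> Pow X \<times> {-(q div 4)..q div 4}"
  proof clarify
    fix \<epsilon> C A s assume a: "\<epsilon> \<in> signs" "near q 0 \<epsilon>" "C \<subseteq> X - supp \<epsilon>"
    then have "4 * \<bar>t \<epsilon>\<bar> \<le> q" using t by simp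
    then show "pos \<epsilon> \<union> C \<in> Pow X \<and> t \<epsilon> \<in> {-(q div 4)..q div 4}"
      using a by (auto simp: pos_def)
  qed
  have "card ?D \<le> card (Pow X \<times> {-(q div 4)..q div 4})"
    by (rule card_inj_on_le[OF inj sub]) (use finite_X in auto)
  also have "\<dots> = 2 ^ card X * nat (2 * (q div 4) + 1)"
    by (simp add: card_cartesian_product card_Pow finite_X)
  \<comment> \<open>The window 4 |t| <= q contains at most q integers.\<close>
  also have "\<dots> \<le> 2 ^ card X * nat q"
    using q by (intro mult_left_mono nat_mono) auto
  finally have "real (card ?D) \<le> real (2 ^ card X * nat q)" by (rule of_nat_mono)
  moreover have "card ?D = (\<Sum>\<epsilon>\<in>?N. 2 ^ card (X - supp \<epsilon>))"
    using finite_X by (subst card_SigmaI) (auto simp: card_Pow)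
  moreover have "real (2 ^ card (X - supp \<epsilon>)) = 2 ^ card X * (1/2) ^ card (supp \<epsilon>)" for \<epsilon>
  proof -
    have s: "supp \<epsilon> \<subseteq> X" by (auto simp: supp_def)
    then have "card (supp \<epsilon>) \<le> card X" by (intro card_mono finite_X)
    moreover have "card (X - supp \<epsilon>) = card X - card (supp \<epsilon>)" using s by (simp add: card_Diff_subset)
    ultimately show ?thesis by (simp add: power_one_over power_diff_conv_inverse field_simps)
  qed
  ultimately have "(\<Sum>\<epsilon>\<in>?N. 2 ^ card X * (1/2) ^ card (supp \<epsilon>)) \<le> real (2 ^ card X * nat q)"
    by (simp only: of_nat_sum)
  also have "real (2 ^ card X * nat q) = 2 ^ card X * real_of_int q" using q by simp
  finally have "2 ^ card X * (\<Sum>\<epsilon>\<in>?N. (1/2) ^ card (supp \<epsilon>)) \<le> 2 ^ card X * real_of_int q"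
    by (simp only: sum_distrib_left)
  then show ?thesis by simp
qed

text \<open>Adding up the members of a subfamily \<open>G\<close> of \<open>F\<close> gives 2^|F|
  sums, whose errors t are confined to a short interval. If two subfamilies have equal size and
  equal total error, the difference of their sums is again a sign vector, because the supports are
  disjoint; q times its \<open>vsum\<close> is divisible by U, so it vanishes by dissociativity and
  the subfamilies agree. Counting the possible sizes and errors gives the bound.\<close>

lemma disjoint_family_bound:
  assumes q: "q \<ge> 1" "coprime q m" and F: "F \<subseteq> signs"
    and near: "\<And>\<epsilon>. \<epsilon> \<in> F \<Longrightarrow> near q x \<epsilon>"
    and nonempty: "\<And>\<epsilon>. \<epsilon> \<in> F \<Longrightarrow> supp \<epsilon> \<noteq> {}"
    and disj: "\<And>\<epsilon> \<delta>. \<epsilon> \<in> F \<Longrightarrow> \<delta> \<in> F \<Longrightarrow> \<epsilon> \<noteq> \<delta> \<Longrightarrow> supp \<epsilon> \<inter> supp \<delta> = {}"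
  shows "2 ^ card F \<le> (int (card F) + 1)\<^sup>2 * q"
proof -
  have fin: "finite F" using F finite_subset by fastforce
  define t where "t = (\<lambda>\<epsilon>. SOME t. 4 * \<bar>t\<bar> \<le> q \<and> U dvd q * vsum \<epsilon> - x - t)"
  have t: "4 * \<bar>t \<epsilon>\<bar> \<le> q" "U dvd q * vsum \<epsilon> - x - t \<epsilon>" if "\<epsilon> \<in> F" for \<epsilon>
    using someI_ex[of "\<lambda>t. 4 * \<bar>t\<bar> \<le> q \<and> U dvd q * vsum \<epsilon> - x - t"] near[OF that]
    unfolding near_def t_def by auto
  \<comment> \<open>Recording the size makes the contribution \<open>card G * x\<close> of the shift
    cancel in the comparison of two subfamilies.\<close>
  let ?f = "\<lambda>G. (card G, sum t G)"
  let ?b = "(int (card F) * q) div 4"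
  have inj: "inj_on ?f (Pow F)"
  proof (rule inj_onI, clarify)
    fix G G' assume G: "G \<subseteq> F" "G' \<subseteq> F" and eq: "card G = card G'" "sum t G = sum t G'"
    have *: "U dvd q * (\<Sum>\<epsilon>\<in>G. vsum \<epsilon>) - int (card G) * x - sum t G" if "G \<subseteq> F" for G
    proof -
      have "U dvd (\<Sum>\<epsilon>\<in>G. q * vsum \<epsilon> - x - t \<epsilon>)" using t that by (intro dvd_sum) auto
      then show ?thesis by (simp add: sum_subtractf sum_distrib_left)
    qed
    define \<delta> where "\<delta> = (\<lambda>u. if u \<in> X then (\<Sum>\<epsilon>\<in>G. \<epsilon> u) - (\<Sum>\<epsilon>\<in>G'. \<epsilon> u) else undefined)"
    have val: "\<delta> u = \<epsilon> u * (of_bool (\<epsilon> \<in> G) - of_bool (\<epsilon> \<in> G'))"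
      if u: "u \<in> X" "\<epsilon> \<in> F" "\<epsilon> u \<noteq> 0" for u \<epsilon>
    proof -
      have z: "\<epsilon>' u = 0" if "\<epsilon>' \<in> F" "\<epsilon>' \<noteq> \<epsilon>" for \<epsilon>'
        using disj[OF that(1) u(2) that(2)] u by (auto simp: supp_def)
      have "(\<Sum>\<epsilon>'\<in>G. \<epsilon>' u) = (\<Sum>\<epsilon>'\<in>G. if \<epsilon>' = \<epsilon> then \<epsilon> u else 0)" if "G \<subseteq> F" for G
        using z that by (intro sum.cong) auto
      then have "(\<Sum>\<epsilon>'\<in>G. \<epsilon>' u) = \<epsilon> u * of_bool (\<epsilon> \<in> G)" if "G \<subseteq> F" for G
        using that fin by (simp add: sum.delta finite_subset[OF that fin])
      then show ?thesis using G u by (simp add: \<delta>_def algebra_simps)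
    qed
    have \<delta>: "\<delta> \<in> signs"
      unfolding signs_def
    proof (rule PiE_I)
      fix u assume u: "u \<in> X"
      show "\<delta> u \<in> {-1, 0, 1}"
      proof (cases "\<exists>\<epsilon>\<in>F. \<epsilon> u \<noteq> 0")
        case True
        then obtain \<epsilon> where \<epsilon>: "\<epsilon> \<in> F" "\<epsilon> u \<noteq> 0" by blast
        then show ?thesis using val[OF u \<epsilon>] signs_cases[of \<epsilon> u] u F by auto
      next
        case False
        then have "(\<Sum>\<epsilon>\<in>G. \<epsilon> u) = 0" "(\<Sum>\<epsilon>\<in>G'. \<epsilon> u) = 0"
          using G by (auto intro!: sum.neutral)
        then show ?thesis using u by (simp add: \<delta>_def)
      qed
    qed (auto simp: \<delta>_def)
    have "vsum \<delta> = (\<Sum>\<epsilon>\<in>G. vsum \<epsilon>) - (\<Sum>\<epsilon>\<in>G'. vsum \<epsilon>)"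
    proof -
      have "vsum \<delta> = (\<Sum>u\<in>X. (\<Sum>\<epsilon>\<in>G. \<epsilon> u * u) - (\<Sum>\<epsilon>\<in>G'. \<epsilon> u * u))"
        unfolding vsum_def by (intro sum.cong) (auto simp: \<delta>_def sum_distrib_right left_diff_distrib)
      also have "\<dots> = (\<Sum>\<epsilon>\<in>G. vsum \<epsilon>) - (\<Sum>\<epsilon>\<in>G'. vsum \<epsilon>)"
        unfolding vsum_def sum_subtractf by (subst (1 3) sum.swap) simp
      finally show ?thesis .
    qed
    moreover have "m dvd (\<Sum>\<epsilon>\<in>G. vsum \<epsilon>) - (\<Sum>\<epsilon>\<in>G'. vsum \<epsilon>)"
    proof -
      have "U dvd (q * (\<Sum>\<epsilon>\<in>G. vsum \<epsilon>) - int (card G) * x - sum t G)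
          - (q * (\<Sum>\<epsilon>\<in>G'. vsum \<epsilon>) - int (card G') * x - sum t G')"
        using *[OF G(1)] *[OF G(2)] by (rule dvd_diff)
      also have "\<dots> = q * ((\<Sum>\<epsilon>\<in>G. vsum \<epsilon>) - (\<Sum>\<epsilon>\<in>G'. vsum \<epsilon>))"
        using eq by (simp add: algebra_simps)
      finally have "m dvd q * ((\<Sum>\<epsilon>\<in>G. vsum \<epsilon>) - (\<Sum>\<epsilon>\<in>G'. vsum \<epsilon>))"
        using m_dvd_U dvd_trans by blast
      then show ?thesis using q by (simp add: coprime_commute coprime_dvd_mult_right_iff)
    qed
    ultimately have zero: "\<delta> u = 0" if "u \<in> X" for u using vsum_zero[OF \<delta>] that by simp
    have "\<epsilon> \<in> G \<longleftrightarrow> \<epsilon> \<in> G'" if \<epsilon>: "\<epsilon> \<in> F" for \<epsilon>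
    proof -
      obtain u where "u \<in> X" "\<epsilon> u \<noteq> 0" using nonempty[OF \<epsilon>] by (auto simp: supp_def)
      then show ?thesis using val[OF _ \<epsilon>, of u] zero[of u] by (auto split: if_splits)
    qed
    then show "G = G'" using G by blast
  qed
  have sub: "?f ` Pow F \<subseteq> {0..card F} \<times> {-?b..?b}"
  proof clarify
    fix G assume G: "G \<subseteq> F"
    have "4 * \<bar>sum t G\<bar> \<le> 4 * (\<Sum>\<epsilon>\<in>G. \<bar>t \<epsilon>\<bar>)" by (simp add: sum_abs)
    also have "\<dots> = (\<Sum>\<epsilon>\<in>G. 4 * \<bar>t \<epsilon>\<bar>)" by (simp add: sum_distrib_left)
    also have "\<dots> \<le> (\<Sum>\<epsilon>\<in>G. q)" using t G by (intro sum_mono) auto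
    also have "\<dots> = int (card G) * q" by simp
    also have "\<dots> \<le> int (card F) * q" using q G fin by (intro mult_right_mono) (auto intro: card_mono)
    finally show "card G \<in> {0..card F} \<and> sum t G \<in> {-?b..?b}"
      using G fin by (auto intro: card_mono)
  qed
  have "card (Pow F) \<le> card ({0..card F} \<times> {-?b..?b})"
    by (rule card_inj_on_le[OF inj sub]) auto
  then have "2 ^ card F \<le> Suc (card F) * nat (2 * ?b + 1)"
    by (simp add: card_cartesian_product card_Pow fin)
  then have "int (2 ^ card F) \<le> int (Suc (card F) * nat (2 * ?b + 1))" by (rule of_nat_mono)
  also have "\<dots> = (int (card F) + 1) * (2 * ?b + 1)"
  proof -
    have "int (card F) * q \<ge> 0" using q by simp
    then have "?b \<ge> 0" by (simp add: pos_imp_zdiv_nonneg_iff)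
    then show ?thesis by (simp add: algebra_simps)
  qed
  also have "\<dots> \<le> (int (card F) + 1) * ((int (card F) + 1) * q)"
  proof (rule mult_left_mono)
    have "4 * ?b \<le> int (card F) * q" "0 \<le> int (card F) * q" using q by auto
    then show "2 * ?b + 1 \<le> (int (card F) + 1) * q" using q by (subst distrib_right) linarith
  qed auto
  finally show ?thesis by (simp add: power2_eq_square)
qed

text \<open>The supports of a maximal disjoint family form a small hitting set; induct on the size of the support.\<close>

lemma card_near_level_le:
  assumes q: "q \<ge> 1" "coprime q m" and R: "\<And>n. 2 ^ n \<le> (int n + 1)\<^sup>2 * q \<Longrightarrow> n \<le> R"
    and "j \<le> J"
  shows "card {\<epsilon>\<in>signs. card (supp \<epsilon>) = j \<and> near q x \<epsilon>} \<le> (2 * R * J) ^ j"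
  using \<open>j \<le> J\<close>
proof (induction j arbitrary: x)
  case 0
  have z: "\<epsilon> u = 0" if "\<epsilon> \<in> signs" "card (supp \<epsilon>) = 0" "u \<in> X" for \<epsilon> u
    using that by (auto simp: supp_def finite_X)
  then have "card {\<epsilon>\<in>signs. card (supp \<epsilon>) = 0 \<and> near q x \<epsilon>} \<le> Suc 0"
  proof (subst card_le_Suc0_iff_eq, simp, intro ballI)
    fix \<epsilon> \<delta> assume a: "\<epsilon> \<in> {\<epsilon>\<in>signs. card (supp \<epsilon>) = 0 \<and> near q x \<epsilon>}" "\<delta> \<in> {\<epsilon>\<in>signs. card (supp \<epsilon>) = 0 \<and> near q x \<epsilon>}"
    then have *: "\<epsilon> \<in> signs" "\<delta> \<in> signs" "card (supp \<epsilon>) = 0" "card (supp \<delta>) = 0" by blast+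
    show "\<epsilon> = \<delta>"
      by (rule signs_eqI[OF *(1,2)]) (simp only: z[OF *(1,3)] z[OF *(2,4)])
  qed
  then show ?case by simp
next
  case (Suc j)
  let ?N = "{\<epsilon>\<in>signs. card (supp \<epsilon>) = Suc j \<and> near q x \<epsilon>}"
  define P where "P = (\<lambda>F. F \<subseteq> ?N \<and> (\<forall>\<epsilon>\<in>F. \<forall>\<delta>\<in>F. \<epsilon> \<noteq> \<delta> \<longrightarrow> supp \<epsilon> \<inter> supp \<delta> = {}))"
  have finN: "finite ?N" by simp
  have "\<exists>F. P F \<and> (\<forall>G. P G \<longrightarrow> card G \<le> card F)"
    by (rule ex_has_greatest_nat[of P "{}" card "Suc (card ?N)"])
       (auto simp: P_def less_Suc_eq_le intro!: card_mono)
  then obtain F where PF: "P F" and max: "\<And>G. P G \<Longrightarrow> card G \<le> card F"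
    by blast
  have F: "F \<subseteq> ?N" "\<And>\<epsilon> \<delta>. \<epsilon> \<in> F \<Longrightarrow> \<delta> \<in> F \<Longrightarrow> \<epsilon> \<noteq> \<delta> \<Longrightarrow> supp \<epsilon> \<inter> supp \<delta> = {}"
    using PF unfolding P_def by blast+
  have finF: "finite F" using F(1) finN by (rule finite_subset)
  have "2 ^ card F \<le> (int (card F) + 1)\<^sup>2 * q"
    using F q by (intro disjoint_family_bound[where x = x]) auto
  then have cF: "card F \<le> R" by (rule R)
  define T where "T = (\<Union>\<epsilon>\<in>F. supp \<epsilon>)"
  have finT: "finite T" using finF by (auto simp: T_def)
  have "card T \<le> (\<Sum>\<epsilon>\<in>F. card (supp \<epsilon>))" unfolding T_def by (rule card_UN_le[OF finF])
  also have "\<dots> = (\<Sum>\<epsilon>\<in>F. Suc j)" using F by (intro sum.cong) auto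
  also have "\<dots> = card F * Suc j" by simp
  also have "\<dots> \<le> R * J" using cF Suc.prems by (intro mult_mono) auto
  finally have cT: "card T \<le> R * J" .
  have TX: "T \<subseteq> X" by (auto simp: T_def supp_def)
  have hit: "supp \<epsilon> \<inter> T \<noteq> {}" if \<epsilon>: "\<epsilon> \<in> ?N" for \<epsilon>
  proof
    assume emp: "supp \<epsilon> \<inter> T = {}"
    have ne: "supp \<epsilon> \<noteq> {}" using \<epsilon> by auto
    then have "\<epsilon> \<notin> F" using emp by (auto simp: T_def)
    moreover have "P (insert \<epsilon> F)" using F \<epsilon> emp unfolding P_def by (auto simp: T_def)
    ultimately show False using max[of "insert \<epsilon> F"] finF by simp
  qed
  let ?M = "\<lambda>u s. {\<epsilon>\<in>?N. \<epsilon> u = s}"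
  have cM: "card (?M u s) \<le> (2 * R * J) ^ j" if u: "u \<in> T" and s: "s \<in> {-1, 1}" for u s
  proof -
    have uX: "u \<in> X" using u TX by auto
    have upd: "supp (\<epsilon>(u := 0)) = supp \<epsilon> - {u}" for \<epsilon> by (auto simp: supp_def)
    have vs: "vsum (\<epsilon>(u := 0)) = vsum \<epsilon> - \<epsilon> u * u" for \<epsilon>
      unfolding vsum_def by (simp add: sum.remove[OF finite_X uX])
    have "inj_on (\<lambda>\<epsilon>. \<epsilon>(u := 0)) (?M u s)"
    proof (rule inj_onI)
      fix \<epsilon> \<delta> assume a: "\<epsilon> \<in> ?M u s" "\<delta> \<in> ?M u s" "\<epsilon>(u := 0) = \<delta>(u := 0)"
      show "\<epsilon> = \<delta>"
      proof
        fix v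
        have "(\<epsilon>(u := 0)) v = (\<delta>(u := 0)) v" by (simp only: a(3))
        moreover have "\<epsilon> u = \<delta> u" using a(1,2) by simp
        ultimately show "\<epsilon> v = \<delta> v" by (cases "v = u") simp_all
      qed
    qed
    \<comment> \<open>Clearing the coordinate u lowers the support by one and moves the target by q
      * s * u; the induction hypothesis holds for every target.\<close>
    moreover have "(\<lambda>\<epsilon>. \<epsilon>(u := 0)) ` ?M u s \<subseteq> {\<epsilon>\<in>signs. card (supp \<epsilon>) = j \<and> near q (x - q * (s * u)) \<epsilon>}"
    proof clarify
      fix \<epsilon> assume a: "\<epsilon> \<in> signs" "card (supp \<epsilon>) = Suc j" "near q x \<epsilon>" "s = \<epsilon> u"
      have "\<epsilon>(u := 0) \<in> signs"
        using a(1) uX unfolding signs_def by (auto simp: PiE_iff extensional_def)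
      moreover have "card (supp (\<epsilon>(u := 0))) = j"
        using a s uX by (subst upd, subst card_Diff_singleton) (auto simp: supp_def)
      moreover have "near q (x - q * (\<epsilon> u * u)) (\<epsilon>(u := 0))"
        using a(3) unfolding near_def vs by (simp add: algebra_simps)
      ultimately show "\<epsilon>(u := 0) \<in> signs \<and> card (supp (\<epsilon>(u := 0))) = j \<and> near q (x - q * (\<epsilon> u * u)) (\<epsilon>(u := 0))"
        by simp
    qed
    ultimately have "card (?M u s) \<le> card {\<epsilon>\<in>signs. card (supp \<epsilon>) = j \<and> near q (x - q * (s * u)) \<epsilon>}"
      by (rule card_inj_on_le) simp
    also have "\<dots> \<le> (2 * R * J) ^ j" using Suc by simp
    finally show ?thesis .
  qed
  have "?N \<subseteq> (\<Union>(u, s)\<in>T \<times> {-1, 1}. ?M u s)"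
  proof
    fix \<epsilon> assume \<epsilon>: "\<epsilon> \<in> ?N"
    then obtain u where u: "u \<in> supp \<epsilon>" "u \<in> T" using hit by blast
    then have "\<epsilon> u = -1 \<or> \<epsilon> u = 1" using \<epsilon> signs_cases[of \<epsilon> u] by (auto simp: supp_def)
    then show "\<epsilon> \<in> (\<Union>(u, s)\<in>T \<times> {-1, 1}. ?M u s)" using \<epsilon> u by auto
  qed
  then have "card ?N \<le> card (\<Union>(u, s)\<in>T \<times> {-1, 1}. ?M u s)"
    by (rule card_mono[rotated]) (use finT in auto)
  also have "\<dots> \<le> (\<Sum>p\<in>T \<times> {-1, 1}. card (case p of (u, s) \<Rightarrow> ?M u s))"
    using finT by (intro card_UN_le) auto
  also have "\<dots> \<le> (\<Sum>p\<in>T \<times> {-1, 1::int}. (2 * R * J) ^ j)"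
    using cM by (intro sum_mono) (auto split: prod.splits)
  also have "\<dots> = 2 * card T * (2 * R * J) ^ j" by (simp add: card_cartesian_product)
  also have "\<dots> \<le> (2 * R * J) * (2 * R * J) ^ j" using cT by (intro mult_right_mono) auto
  finally show ?case by simp
qed

end

text \<open>The threshold 600 imposed on \<open>J0\<close> comes from here: 600 < 2^10 settles the
  base case and (1 + 1/600)^60 <= 2 the step. The exponent 60 leaves 33 after the loss of 27 in
  \<open>sum_blocks_le\<close>.\<close>

lemma power_60_le: "n \<ge> 600 \<Longrightarrow> real n ^ 60 \<le> 2 ^ n"
proof (induction n rule: dec_induct)
  case base
  show ?case by simp
next
  case (step n)
  have n: "real n \<ge> 600" using step by simp
  have "real (Suc n) = real n * (1 + 1 / real n)" using n by (simp add: field_simps)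
  then have "real (Suc n) ^ 60 = real n ^ 60 * (1 + 1 / real n) ^ 60" by (simp only: power_mult_distrib)
  also have "(1 + 1 / real n) ^ 60 \<le> (1 + 1 / 600) ^ 60"
    using n by (intro power_mono add_left_mono divide_left_mono) auto
  also have "(1 + 1 / 600 :: real) ^ 60 \<le> 2" by (simp add: power_divide)
  also have "real n ^ 60 * 2 \<le> 2 ^ n * 2" using step by simp
  finally show ?case using n by simp
qed

context dissociated
begin

text \<open>The weight 1/4 is the square of the 1/2 used in Cauchy-Schwarz, and J is the integer
  part of sqrt(ln q). Supports of size at most J are so few, a fixed power of J raised to the J
  against q >= exp(J^2), that each vector may be counted with weight 1. On larger supports one
  factor 1/2 per coordinate yields 2^(-J), and the other is summed by
  \<open>sum_near_le\<close>.\<close>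

lemma sum_near_quarter_le:
  assumes q: "coprime q m" "q \<ge> 2" and J: "J \<ge> 600"
    and lo: "(real J)\<^sup>2 \<le> ln (real_of_int q)" and hi: "ln (real_of_int q) < (real J + 1)\<^sup>2"
  shows "(\<Sum>\<epsilon>\<in>{\<epsilon>\<in>signs. near q 0 \<epsilon>}. (1/4) ^ card (supp \<epsilon>)) \<le> 2 * real_of_int q / 2 ^ J"
proof -
  \<comment> \<open>For n >= 20 one has (n + 1)^4 <= 2^n, so the hypothesis on n squares to 2^n <=
    q^2. With ln 2 >= 2/3 and ln q < (J + 1)^2 this gives n < 3 (J + 1)^2.\<close>
  define R where "R = 3 * (J + 1)\<^sup>2"
  have R: "n \<le> R" if n: "2 ^ n \<le> (int n + 1)\<^sup>2 * q" for n
  proof (cases "n \<ge> 20")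
    case True
    then have p4: "(int n + 1) ^ 4 \<le> 2 ^ n"
    proof (induction n rule: dec_induct)
      case (step n)
      have "(int (Suc n) + 1) ^ 4 * 10 ^ 4 \<le> (11 * (int n + 1)) ^ 4"
        unfolding power_mult_distrib[symmetric] using step by (intro power_mono) auto
      also have "\<dots> = 14641 * (int n + 1) ^ 4" by (subst power_mult_distrib) simp
      also have "\<dots> \<le> 20000 * 2 ^ n"
      proof -
        have "14641 * (int n + 1) ^ 4 \<le> 20000 * (int n + 1) ^ 4" by (intro mult_right_mono) auto
        also have "\<dots> \<le> 20000 * 2 ^ n" using step(3) by (rule mult_left_mono) simp
        finally show ?thesis .
      qed
      finally show ?case by simp
    qed simp
    have "(2 ^ n) * 2 ^ n \<le> ((int n + 1)\<^sup>2 * q) * ((int n + 1)\<^sup>2 * q)"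
      using n q by (intro mult_mono) auto
    also have "\<dots> = (int n + 1) ^ 4 * q\<^sup>2" by (simp add: power2_eq_square power4_eq_xxxx)
    also have "\<dots> \<le> 2 ^ n * q\<^sup>2" using p4 by (intro mult_right_mono) auto
    finally have "2 ^ n \<le> q\<^sup>2" by simp
    then have "real_of_int (2 ^ n) \<le> real_of_int (q\<^sup>2)" by (rule of_int_le_iff[THEN iffD2])
    then have "ln (2 ^ n :: real) \<le> ln (real_of_int q ^ 2)"
      using q by (intro ln_mono) auto
    then have "real n * ln 2 \<le> 2 * ln (real_of_int q)" using q by (simp add: ln_realpow)
    also have "\<dots> < 2 * (real J + 1)\<^sup>2" using hi by simp
    finally have "real n * (2/3) < 2 * (real J + 1)\<^sup>2"
      using ln2_ge_two_thirds by (smt (verit) mult_left_mono of_nat_0_le_iff)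
    then have "real n < real R" by (simp add: R_def add.commute)
    then show ?thesis by simp
  next
    case False
    have "(600 + 1)\<^sup>2 \<le> (J + 1)\<^sup>2" using J by (intro power_mono) auto
    then show ?thesis using False by (simp add: R_def)
  qed
  let ?N = "{\<epsilon>\<in>signs. near q 0 \<epsilon>}"
  let ?N1 = "{\<epsilon>\<in>?N. card (supp \<epsilon>) \<le> J}" and ?N2 = "{\<epsilon>\<in>?N. \<not> card (supp \<epsilon>) \<le> J}"
  have q0: "real_of_int q > 0" using q by simp
  have "(\<Sum>\<epsilon>\<in>?N1. (1/4) ^ card (supp \<epsilon>)) \<le> (\<Sum>\<epsilon>\<in>?N1. 1 :: real)"
    by (intro sum_mono) (auto simp: power_le_one)
  also have "\<dots> = real (card ?N1)" by simp
  finally have N1: "(\<Sum>\<epsilon>\<in>?N1. (1/4) ^ card (supp \<epsilon>)) \<le> real (card ?N1)" .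
  have "?N1 = (\<Union>j\<in>{..J}. {\<epsilon>\<in>signs. card (supp \<epsilon>) = j \<and> near q 0 \<epsilon>})" by auto
  then have "real (card ?N1) = real (card (\<Union>j\<in>{..J}. {\<epsilon>\<in>signs. card (supp \<epsilon>) = j \<and> near q 0 \<epsilon>}))" by simp
  also have "\<dots> \<le> (\<Sum>j\<le>J. real (card {\<epsilon>\<in>signs. card (supp \<epsilon>) = j \<and> near q 0 \<epsilon>}))"
    unfolding of_nat_sum[symmetric] by (intro of_nat_mono card_UN_le) auto
  also have "\<dots> \<le> (\<Sum>j\<le>J. real ((2 * R * J) ^ J))"
  proof (intro sum_mono of_nat_mono)
    fix j assume j: "j \<in> {..J}"
    have "card {\<epsilon>\<in>signs. card (supp \<epsilon>) = j \<and> near q 0 \<epsilon>} \<le> (2 * R * J) ^ j"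
      using q R j by (intro card_near_level_le) auto
    also have "\<dots> \<le> (2 * R * J) ^ J"
      using j J by (intro power_increasing) (auto simp: R_def)
    finally show "card {\<epsilon>\<in>signs. card (supp \<epsilon>) = j \<and> near q 0 \<epsilon>} \<le> (2 * R * J) ^ J" .
  qed
  also have "\<dots> = (real J + 1) * (6 * (real J + 1)\<^sup>2 * real J) ^ J" by (simp add: R_def add.commute)
  also have "\<dots> \<le> (real J + 1) ^ J * (6 * (real J + 1)\<^sup>2 * real J) ^ J"
    using J by (intro mult_right_mono self_le_power) auto
  also have "\<dots> = ((real J + 1) * (6 * (real J + 1)\<^sup>2 * real J)) ^ J" by (simp only: power_mult_distrib)
  also have "\<dots> \<le> (exp (real J) / 2) ^ J"
  proof (rule power_mono)
    have r: "real J \<ge> 600" using J by simp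
    have "(real J + 1) * (6 * (real J + 1)\<^sup>2 * real J) \<le> (2 * real J) * (6 * (2 * real J)\<^sup>2 * real J)"
      using r by (intro mult_mono power_mono) auto
    also have "\<dots> = 48 * real J ^ 4" by (simp add: power2_eq_square power4_eq_xxxx)
    also have "\<dots> \<le> (real J / 2) * real J ^ 4" using r by (intro mult_right_mono) auto
    also have "\<dots> = real J ^ 5 / 2" by (simp add: eval_nat_numeral)
    also have "\<dots> \<le> real J ^ 60 / 2" using r by (intro divide_right_mono power_increasing) auto
    also have "\<dots> \<le> 2 ^ J / 2" using power_60_le[OF J] by simp
    also have "\<dots> \<le> exp 1 ^ J / 2"
      using exp_ge_add_one_self[of 1] by (intro divide_right_mono power_mono) auto
    finally show "(real J + 1) * (6 * (real J + 1)\<^sup>2 * real J) \<le> exp (real J) / 2"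
      by (simp flip: exp_of_nat_mult)
  qed simp
  also have "\<dots> = exp ((real J)\<^sup>2) / 2 ^ J"
    by (simp add: power_divide power2_eq_square flip: exp_of_nat_mult)
  also have "\<dots> \<le> real_of_int q / 2 ^ J"
    using lo q0 by (intro divide_right_mono) (auto simp: ln_ge_iff)
  finally have 1: "(\<Sum>\<epsilon>\<in>?N1. (1/4) ^ card (supp \<epsilon>)) \<le> real_of_int q / 2 ^ J" using N1 by linarith
  have "(\<Sum>\<epsilon>\<in>?N2. (1/4) ^ card (supp \<epsilon>)) \<le> (\<Sum>\<epsilon>\<in>?N2. (1/2) ^ J * (1/2) ^ card (supp \<epsilon>) :: real)"
  proof (rule sum_mono)
    fix \<epsilon> assume "\<epsilon> \<in> ?N2"
    then have "(1/2 :: real) ^ card (supp \<epsilon>) \<le> (1/2) ^ J" by (intro power_decreasing) auto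
    then have "(1/2) ^ card (supp \<epsilon>) * (1/2) ^ card (supp \<epsilon>) \<le> (1/2) ^ J * (1/2 :: real) ^ card (supp \<epsilon>)"
      by (rule mult_right_mono) simp
    then show "(1/4) ^ card (supp \<epsilon>) \<le> (1/2) ^ J * (1/2 :: real) ^ card (supp \<epsilon>)"
      by (simp flip: power_mult_distrib)
  qed
  also have "\<dots> \<le> (\<Sum>\<epsilon>\<in>?N. (1/2) ^ J * (1/2) ^ card (supp \<epsilon>))"
    by (rule sum_mono2) auto
  also have "\<dots> = (1/2) ^ J * (\<Sum>\<epsilon>\<in>?N. (1/2) ^ card (supp \<epsilon>))" by (simp add: sum_distrib_left)
  also have "\<dots> \<le> (1/2) ^ J * real_of_int q"
    using sum_near_le[OF q(2,1)] by (intro mult_left_mono) auto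
  finally have 2: "(\<Sum>\<epsilon>\<in>?N2. (1/4) ^ card (supp \<epsilon>)) \<le> real_of_int q / 2 ^ J"
    by (simp add: power_one_over field_simps)
  have "(\<Sum>\<epsilon>\<in>?N. (1/4) ^ card (supp \<epsilon>)) = (\<Sum>\<epsilon>\<in>?N1. (1/4) ^ card (supp \<epsilon>)) + (\<Sum>\<epsilon>\<in>?N2. (1/4) ^ card (supp \<epsilon>) :: real)"
    by (subst sum.union_disjoint[symmetric]) (auto intro!: sum.cong)
  then show ?thesis using 1 2 by simp
qed

end

section \<open>The Selberg weight\<close>

locale selberg_weight =
  fixes P :: "nat set" and z :: real
  assumes finite_P: "finite P" and prime_P: "\<And>r. r \<in> P \<Longrightarrow> prime r" and z_gt_1: "z > 1"
begin

definition H :: real where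
  "H = (\<Sum>A\<in>{A\<in>Pow P. real (\<Prod>A) < z}. 1 / real (\<Prod>A))"

text \<open>
  The functions \<open>\<gamma>\<close> encode, by the Chinese remainder theorem, the fractions \<open>a/q\<close> in lowest terms modulo 1, with \<open>q\<close> the
  product of the support of \<open>\<gamma>\<close>. The weight \<open>V\<close> is not normalized: it equals \<open>H\<close> at integers prime to \<open>P\<close>.
\<close>

definition Gam :: "(nat \<Rightarrow> int) set" where
  "Gam = {\<gamma> \<in> \<Pi>\<^sub>E r\<in>P. {0..<int r}. real (\<Prod>{r\<in>P. \<gamma> r \<noteq> 0}) < z}"

definition freq :: "(nat \<Rightarrow> int) \<Rightarrow> real" where
  "freq \<gamma> = (\<Sum>r\<in>P. of_int (\<gamma> r) / real r)"

text \<open>For a fraction with denominator q this is mu(q) / q, where the usual Selberg weight has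
  mu(q) / phi(q). Thus \<open>V\<close> is a combination of Ramanujan sums, and \<open>H\<close> is
  a sum of 1/d over squarefree d.\<close>

definition wt :: "(nat \<Rightarrow> int) \<Rightarrow> real" where
  "wt \<gamma> = (\<Prod>r\<in>P. if \<gamma> r = 0 then 1 else - 1 / real r)"

definition V :: "nat \<Rightarrow> complex" where
  "V n = (\<Sum>\<gamma>\<in>Gam. of_real (wt \<gamma>) * e (real n * freq \<gamma>))"

lemma pos_P: "r \<in> P \<Longrightarrow> r > 0"
  using prime_P prime_gt_0_nat by blast

lemma prod_P_pos: "A \<subseteq> P \<Longrightarrow> \<Prod>A > 0"
  using pos_P by (intro prod_pos) auto

lemma finite_Gam [simp]: "finite Gam"
  by (rule finite_subset[of _ "\<Pi>\<^sub>E r\<in>P. {0..<int r}"]) (auto simp: Gam_def finite_P intro!: finite_PiE)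

lemma H_ge_1: "H \<ge> 1"
proof -
  have "(\<Sum>A\<in>{{}}. 1 / real (\<Prod>A)) \<le> H"
    unfolding H_def using z_gt_1 finite_P by (intro sum_mono2) (auto simp: prod_nonneg)
  then show ?thesis by simp
qed

text \<open>Once the set \<open>E\<close> of nonzero coordinates outside \<open>A\<close> is fixed,
  the constraint by z depends on \<open>E\<close> alone and the sum factorizes over primes.
  Coordinates in \<open>A\<close> stay free: \<open>A\<close> is empty when \<open>V\<close> is
  evaluated, and it is the set where two vectors differ when pairs are bounded.\<close>

lemma sum_by_support:
  fixes \<phi> :: "nat \<Rightarrow> int \<Rightarrow> 'a :: comm_ring_1"
  assumes "A \<subseteq> P"
  shows "(\<Sum>\<gamma>\<in>{\<gamma> \<in> \<Pi>\<^sub>E r\<in>P. {0..<int r}. real (\<Prod>{r\<in>P - A. \<gamma> r \<noteq> 0}) < z}. \<Prod>r\<in>P. \<phi> r (\<gamma> r))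
    = (\<Sum>E\<in>{E\<in>Pow (P - A). real (\<Prod>E) < z}.
        \<Prod>r\<in>P. \<Sum>g\<in>(if r \<in> A then {0..<int r} else if r \<in> E then {1..<int r} else {0}). \<phi> r g)"
proof -
  define B where "B = (\<lambda>E r. if r \<in> A then {0..<int r} else if r \<in> E then {1..<int r} else {0})"
  let ?G = "{\<gamma> \<in> \<Pi>\<^sub>E r\<in>P. {0..<int r}. real (\<Prod>{r\<in>P - A. \<gamma> r \<noteq> 0}) < z}"
  let ?\<E> = "{E\<in>Pow (P - A). real (\<Prod>E) < z}"
  have supp: "{r\<in>P - A. \<gamma> r \<noteq> 0} = E" if "\<gamma> \<in> PiE P (B E)" "E \<subseteq> P - A" for \<gamma> E
    using that by (force simp: B_def PiE_iff split: if_splits)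
  have "?G = (\<Union>E\<in>?\<E>. PiE P (B E))"
  proof (intro equalityI subsetI)
    fix \<gamma> assume \<gamma>: "\<gamma> \<in> ?G"
    have "\<gamma> \<in> PiE P (B {r\<in>P - A. \<gamma> r \<noteq> 0})"
      using \<gamma> by (auto simp: B_def PiE_iff)
    moreover have "{r\<in>P - A. \<gamma> r \<noteq> 0} \<in> ?\<E>" using \<gamma> by auto
    ultimately show "\<gamma> \<in> (\<Union>E\<in>?\<E>. PiE P (B E))" by (rule UN_I[rotated])
  next
    fix \<gamma> assume "\<gamma> \<in> (\<Union>E\<in>?\<E>. PiE P (B E))"
    then obtain E where E: "E \<in> ?\<E>" "\<gamma> \<in> PiE P (B E)" by blast
    have "B E r \<subseteq> {0..<int r}" if "r \<in> P" for r using pos_P[OF that] by (auto simp: B_def)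
    then have "\<gamma> \<in> (\<Pi>\<^sub>E r\<in>P. {0..<int r})" using E(2) unfolding PiE_iff by blast
    then show "\<gamma> \<in> ?G" using E supp[OF E(2)] by simp
  qed
  then have "(\<Sum>\<gamma>\<in>?G. \<Prod>r\<in>P. \<phi> r (\<gamma> r)) = (\<Sum>E\<in>?\<E>. \<Sum>\<gamma>\<in>PiE P (B E). \<Prod>r\<in>P. \<phi> r (\<gamma> r))"
  proof (simp only:, subst sum.UNION_disjoint)
    show "\<forall>E\<in>?\<E>. finite (PiE P (B E))"
      using finite_P by (auto simp: B_def intro!: finite_PiE)
    show "\<forall>E\<in>?\<E>. \<forall>F\<in>?\<E>. E \<noteq> F \<longrightarrow> PiE P (B E) \<inter> PiE P (B F) = {}"
    proof (intro ballI impI equals0I)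
      fix E F \<gamma> assume EF: "E \<in> ?\<E>" "F \<in> ?\<E>" "E \<noteq> F" "\<gamma> \<in> PiE P (B E) \<inter> PiE P (B F)"
      then have "{r\<in>P - A. \<gamma> r \<noteq> 0} = E" "{r\<in>P - A. \<gamma> r \<noteq> 0} = F"
        using supp[of \<gamma> E] supp[of \<gamma> F] by simp_all
      then show False using EF(3) by simp
    qed
  qed (use finite_P in auto)
  also have "\<dots> = (\<Sum>E\<in>?\<E>. \<Prod>r\<in>P. \<Sum>g\<in>B E r. \<phi> r g)"
    using finite_P by (intro sum.cong refl prod_sum_PiE[symmetric]) (auto simp: B_def)
  finally show ?thesis by (simp only: B_def)
qed

text \<open>For r not dividing n the nontrivial characters modulo r sum to -1, which cancels the
  sign in \<open>wt\<close> and leaves 1/r.\<close>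

lemma V_coprime:
  assumes "\<And>r. r \<in> P \<Longrightarrow> \<not> r dvd n"
  shows "V n = of_real H"
proof -
  define \<phi> where "\<phi> = (\<lambda>r g. of_real (if g = 0 then 1 else - 1 / real r) * e (real n * (of_int g / real r)))"
  have "V n = (\<Sum>\<gamma>\<in>{\<gamma> \<in> \<Pi>\<^sub>E r\<in>P. {0..<int r}. real (\<Prod>{r\<in>P - {}. \<gamma> r \<noteq> 0}) < z}. \<Prod>r\<in>P. \<phi> r (\<gamma> r))"
    unfolding V_def Gam_def
    by (intro sum.cong) (simp_all add: \<phi>_def wt_def freq_def sum_distrib_left e_sum finite_P prod.distrib of_real_prod)
  also have "\<dots> = (\<Sum>E\<in>{E\<in>Pow (P - {}). real (\<Prod>E) < z}.
        \<Prod>r\<in>P. \<Sum>g\<in>(if r \<in> {} then {0..<int r} else if r \<in> E then {1..<int r} else {0}). \<phi> r g)"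
    by (rule sum_by_support) simp
  also have "\<dots> = (\<Sum>E\<in>{E\<in>Pow P. real (\<Prod>E) < z}. of_real (1 / real (\<Prod>E)))"
  proof (rule sum.cong)
    fix E assume E: "E \<in> {E\<in>Pow P. real (\<Prod>E) < z}"
    have *: "(\<Sum>g\<in>{1..<int r}. \<phi> r g) = of_real (1 / real r)" if r: "r \<in> P" for r
    proof -
      have r0: "r > 0" using pos_P r by simp
      have nint: "real n / real r \<notin> \<int>"
      proof
        assume "real n / real r \<in> \<int>"
        then obtain k where "real n / real r = of_int k" by (elim Ints_cases)
        then have "real n = of_int (k * int r)" using r0 by (simp add: field_simps)
        then have "int n = k * int r" by linarith
        then have "int r dvd int n" by simp
        then show False using assms[OF r] by simp
      qed
      have "(\<Sum>k<r. e (real k * (real n / real r))) = 0"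
        using nint r0 by (subst sum_e) auto
      also have "(\<Sum>k<r. e (real k * (real n / real r))) = (\<Sum>g\<in>{0..<int r}. e (real n * (of_int g / real r)))"
        by (rule sum.reindex_bij_witness[of _ nat int]) (auto simp: mult.commute)
      also have "{0..<int r} = insert 0 {1..<int r}" using r0 by auto
      finally have s: "(\<Sum>g\<in>{1..<int r}. e (real n * (of_int g / real r))) = - 1"
        by (simp add: add_eq_0_iff)
      have "(\<Sum>g\<in>{1..<int r}. \<phi> r g) = of_real (- 1 / real r) * (\<Sum>g\<in>{1..<int r}. e (real n * (of_int g / real r)))"
        unfolding \<phi>_def sum_distrib_left by (rule sum.cong) auto
      then show ?thesis unfolding s by simp
    qed
    have "(\<Prod>r\<in>P. \<Sum>g\<in>(if r \<in> {} then {0..<int r} else if r \<in> E then {1..<int r} else {0}). \<phi> r g)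
        = (\<Prod>r\<in>P. if r \<in> E then of_real (1 / real r) else 1)"
      by (rule prod.cong) (use * in \<open>auto simp: \<phi>_def\<close>)
    also have "\<dots> = (\<Prod>r\<in>E. of_real (1 / real r))"
      using E finite_P by (subst prod.inter_restrict[symmetric]) (auto intro!: prod.cong)
    also have "\<dots> = of_real (1 / real (\<Prod>E))" by (simp add: prod_dividef)
    finally show "(\<Prod>r\<in>P. \<Sum>g\<in>(if r \<in> {} then {0..<int r} else if r \<in> E then {1..<int r} else {0}). \<phi> r g)
        = of_real (1 / real (\<Prod>E))" .
  qed simp
  finally show ?thesis by (simp add: H_def)
qed

text \<open>Along \<open>T\<close> the second vector is the first one shifted by a constant modulo
  each r, so the sum runs over one vector and factorizes. Where the shift vanishes, the local factor
  is 1 or at most 1/r, as in \<open>H\<close>; where it does not, it is at most 3/r. Hence the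
  relative loss 3^omega(q) / q for a shift of denominator q.\<close>

lemma pair_sum_le:
  assumes T: "T \<subseteq> Gam \<times> Gam" "(\<delta>, \<delta>') \<in> T"
    and cong: "\<And>\<gamma> \<gamma>' r. (\<gamma>, \<gamma>') \<in> T \<Longrightarrow> r \<in> P \<Longrightarrow> [\<gamma> r - \<gamma>' r = \<delta> r - \<delta>' r] (mod int r)"
  shows "(\<Sum>(\<gamma>, \<gamma>')\<in>T. \<bar>wt \<gamma>\<bar> * \<bar>wt \<gamma>'\<bar>) \<le> H * (\<Prod>r\<in>{r\<in>P. \<delta> r \<noteq> \<delta>' r}. 3 / real r)"
proof -
  define A where "A = {r\<in>P. \<delta> r \<noteq> \<delta>' r}"
  define \<omega> where "\<omega> = (\<lambda>r g. if g = (0::int) then 1 else 1 / real r)"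
  define c where "c = (\<lambda>r. \<delta> r - \<delta>' r)"
  define \<phi> where "\<phi> = (\<lambda>r g. \<omega> r g * \<omega> r ((g - c r) mod int r))"
  have A: "A \<subseteq> P" by (auto simp: A_def)
  have rng: "\<gamma> r \<in> {0..<int r}" if "\<gamma> \<in> Gam" "r \<in> P" for \<gamma> r
    using that by (auto simp: Gam_def PiE_iff)
  have \<delta>: "\<delta> \<in> Gam" "\<delta>' \<in> Gam" using T by auto
  have absw: "\<bar>wt \<gamma>\<bar> = (\<Prod>r\<in>P. \<omega> r (\<gamma> r))" for \<gamma>
    unfolding wt_def abs_prod \<omega>_def by (rule prod.cong) auto
  have det: "\<gamma>' r = (\<gamma> r - c r) mod int r" if "(\<gamma>, \<gamma>') \<in> T" "r \<in> P" for \<gamma> \<gamma>' r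
  proof -
    have "[\<gamma>' r = \<gamma> r - c r] (mod int r)"
      using cong[OF that] by (simp add: c_def cong_iff_dvd_diff dvd_diff_commute algebra_simps)
    then have "\<gamma>' r mod int r = (\<gamma> r - c r) mod int r" unfolding Cong.cong_def .
    moreover have "\<gamma>' r \<in> {0..<int r}" using that T rng by auto
    ultimately show ?thesis by simp
  qed
  have inj: "inj_on fst T"
  proof (rule inj_onI)
    fix p p' assume "p \<in> T" "p' \<in> T" "fst p = fst p'"
    moreover obtain \<gamma> \<gamma>1 where p: "p = (\<gamma>, \<gamma>1)" by (cases p)
    moreover obtain \<gamma>' \<gamma>2 where p': "p' = (\<gamma>', \<gamma>2)" by (cases p')
    ultimately have a: "(\<gamma>, \<gamma>1) \<in> T" "(\<gamma>, \<gamma>2) \<in> T" and eq: "\<gamma> = \<gamma>'" by simp_all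
    have "\<gamma>1 \<in> (\<Pi>\<^sub>E r\<in>P. {0..<int r})" "\<gamma>2 \<in> (\<Pi>\<^sub>E r\<in>P. {0..<int r})"
      using a T by (auto simp: Gam_def)
    then have "\<gamma>1 = \<gamma>2" by (rule PiE_ext) (simp only: det[OF a(1)] det[OF a(2)])
    then show "p = p'" by (simp add: p p' eq)
  qed
  let ?G = "{\<gamma> \<in> \<Pi>\<^sub>E r\<in>P. {0..<int r}. real (\<Prod>{r\<in>P - A. \<gamma> r \<noteq> 0}) < z}"
  have sub: "fst ` T \<subseteq> ?G"
  proof (rule image_subsetI)
    fix p assume p: "p \<in> T"
    define \<gamma> where "\<gamma> = fst p"
    have "p \<in> Gam \<times> Gam" using T(1) p by (rule subsetD)
    then have g: "\<gamma> \<in> Gam" by (simp add: \<gamma>_def mem_Times_iff)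
    have "\<Prod>{r\<in>P - A. \<gamma> r \<noteq> 0} dvd \<Prod>{r\<in>P. \<gamma> r \<noteq> 0}"
      using finite_P by (intro prod_dvd_prod_subset) auto
    then have "\<Prod>{r\<in>P - A. \<gamma> r \<noteq> 0} \<le> \<Prod>{r\<in>P. \<gamma> r \<noteq> 0}"
      by (intro dvd_imp_le prod_P_pos) auto
    then have "real (\<Prod>{r\<in>P - A. \<gamma> r \<noteq> 0}) \<le> real (\<Prod>{r\<in>P. \<gamma> r \<noteq> 0})" by (rule of_nat_mono)
    then show "fst p \<in> ?G"
      using g unfolding \<gamma>_def[symmetric] by (simp add: Gam_def)
  qed
  have \<phi>0: "\<phi> r g \<ge> 0" for r g by (auto simp: \<phi>_def \<omega>_def)
  have finG: "finite ?G"
    by (rule finite_subset[of _ "\<Pi>\<^sub>E r\<in>P. {0..<int r}"]) (auto simp: finite_P intro!: finite_PiE)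
  have "(\<Sum>(\<gamma>, \<gamma>')\<in>T. \<bar>wt \<gamma>\<bar> * \<bar>wt \<gamma>'\<bar>) = (\<Sum>p\<in>T. \<Prod>r\<in>P. \<phi> r (fst p r))"
  proof (rule sum.cong[OF refl])
    fix p assume "p \<in> T"
    moreover obtain \<gamma> \<gamma>' where p: "p = (\<gamma>, \<gamma>')" by (cases p)
    ultimately have "(\<gamma>, \<gamma>') \<in> T" by simp
    then have "(\<Prod>r\<in>P. \<omega> r (\<gamma>' r)) = (\<Prod>r\<in>P. \<omega> r ((\<gamma> r - c r) mod int r))"
      by (intro prod.cong refl) (simp add: det)
    then show "(case p of (\<gamma>, \<gamma>') \<Rightarrow> \<bar>wt \<gamma>\<bar> * \<bar>wt \<gamma>'\<bar>) = (\<Prod>r\<in>P. \<phi> r (fst p r))"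
      by (simp add: p absw \<phi>_def prod.distrib)
  qed
  also have "\<dots> = (\<Sum>\<gamma>\<in>fst ` T. \<Prod>r\<in>P. \<phi> r (\<gamma> r))"
    by (subst sum.reindex[OF inj]) simp
  also have "\<dots> \<le> (\<Sum>\<gamma>\<in>?G. \<Prod>r\<in>P. \<phi> r (\<gamma> r))"
    by (rule sum_mono2[OF finG sub]) (auto intro!: prod_nonneg \<phi>0)
  also have "\<dots> = (\<Sum>E\<in>{E\<in>Pow (P - A). real (\<Prod>E) < z}.
        \<Prod>r\<in>P. \<Sum>g\<in>(if r \<in> A then {0..<int r} else if r \<in> E then {1..<int r} else {0}). \<phi> r g)"
    by (rule sum_by_support[OF A])
  also have "\<dots> \<le> (\<Sum>E\<in>{E\<in>Pow (P - A). real (\<Prod>E) < z}. 1 / real (\<Prod>E) * (\<Prod>r\<in>A. 3 / real r))"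
  proof (rule sum_mono)
    fix E assume E: "E \<in> {E\<in>Pow (P - A). real (\<Prod>E) < z}"
    \<comment> \<open>With a nonzero shift both values cannot be 0 at once: g = 0 and g = c r modulo
      r contribute 1/r each, and the remaining residues, fewer than r, contribute 1/r^2
      each.\<close>
    have inA: "(\<Sum>g\<in>{0..<int r}. \<phi> r g) \<le> 3 / real r" if r: "r \<in> A" for r
    proof -
      have r0: "r > 0" using r A pos_P by auto
      have nd: "\<not> int r dvd c r"
      proof
        assume "int r dvd c r"
        then have "[\<delta> r = \<delta>' r] (mod int r)" by (simp add: c_def cong_iff_dvd_diff)
        then have "\<delta> r = \<delta>' r" using rng[OF \<delta>(1), of r] rng[OF \<delta>(2), of r] r A
          by (simp add: Cong.cong_def subset_iff)
        then show False using r by (simp add: A_def)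
      qed
      then have "\<phi> r g \<le> (if g = 0 then 1 / real r else 0) + (if g = c r mod int r then 1 / real r else 0) + 1 / (real r)\<^sup>2"
        if "g \<in> {0..<int r}" for g
      proof -
        consider "g = 0" | "g \<noteq> 0" "(g - c r) mod int r = 0" | "g \<noteq> 0" "(g - c r) mod int r \<noteq> 0" by blast
        then show ?thesis
        proof cases
          case 1
          have "(g - c r) mod int r \<noteq> 0"
            using nd 1 by (simp add: mod_eq_0_iff_dvd)
          then have "\<phi> r g = 1 / real r" using 1 by (simp add: \<phi>_def \<omega>_def)
          then show ?thesis using 1 by simp
        next
          case 2
          then have "g mod int r = c r mod int r" by (simp add: mod_eq_dvd_iff mod_eq_0_iff_dvd)
          then have "g = c r mod int r" using that by simp
          moreover have "\<phi> r g = 1 / real r" using 2 by (simp add: \<phi>_def \<omega>_def)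
          ultimately show ?thesis using 2 by simp
        next
          case 3
          then have "\<phi> r g = 1 / (real r)\<^sup>2" by (simp add: \<phi>_def \<omega>_def power2_eq_square)
          then show ?thesis by simp
        qed
      qed
      then have "(\<Sum>g\<in>{0..<int r}. \<phi> r g) \<le> (\<Sum>g\<in>{0..<int r}. (if g = 0 then 1 / real r else 0)
          + (if g = c r mod int r then 1 / real r else 0) + 1 / (real r)\<^sup>2)"
        by (rule sum_mono)
      also have "\<dots> = 3 / real r"
        using r0 by (simp add: sum.distrib power2_eq_square)
      finally show ?thesis .
    qed
    have inE: "(\<Sum>g\<in>{1..<int r}. \<phi> r g) \<le> 1 / real r" "\<phi> r 0 = 1" if r: "r \<in> P - A" for r
    proof -
      have r0: "r > 0" using r pos_P by auto
      have "c r = 0" using r by (auto simp: c_def A_def)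
      then show "\<phi> r 0 = 1" by (simp add: \<phi>_def \<omega>_def)
      have "(\<Sum>g\<in>{1..<int r}. \<phi> r g) = (\<Sum>g\<in>{1..<int r}. 1 / (real r)\<^sup>2)"
        using \<open>c r = 0\<close> by (intro sum.cong) (auto simp: \<phi>_def \<omega>_def power2_eq_square)
      also have "\<dots> = (real r - 1) / (real r)\<^sup>2" using r0 by (simp add: of_nat_diff)
      also have "\<dots> \<le> real r / (real r)\<^sup>2" by (rule divide_right_mono) auto
      finally show "(\<Sum>g\<in>{1..<int r}. \<phi> r g) \<le> 1 / real r" using r0 by (simp add: power2_eq_square)
    qed
    have "(\<Prod>r\<in>P. \<Sum>g\<in>(if r \<in> A then {0..<int r} else if r \<in> E then {1..<int r} else {0}). \<phi> r g)
        \<le> (\<Prod>r\<in>P. (if r \<in> E then 1 / real r else 1) * (if r \<in> A then 3 / real r else 1))"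
      using E by (intro prod_mono) (auto intro!: sum_nonneg \<phi>0 inA inE simp: inE(2))
    also have "\<dots> = (\<Prod>r\<in>E. 1 / real r) * (\<Prod>r\<in>A. 3 / real r)"
    proof -
      have "P \<inter> E = E" "P \<inter> A = A" using E A by auto
      then show ?thesis
        using finite_P by (simp add: prod.distrib prod.inter_restrict[symmetric] Int_commute flip: prod.inter_restrict)
    qed
    finally show "(\<Prod>r\<in>P. \<Sum>g\<in>(if r \<in> A then {0..<int r} else if r \<in> E then {1..<int r} else {0}). \<phi> r g)
        \<le> 1 / real (\<Prod>E) * (\<Prod>r\<in>A. 3 / real r)"
      by (simp add: prod_dividef)
  qed
  also have "\<dots> \<le> (\<Sum>E\<in>{E\<in>Pow P. real (\<Prod>E) < z}. 1 / real (\<Prod>E) * (\<Prod>r\<in>A. 3 / real r))"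
    using finite_P by (intro sum_mono2) (auto intro!: mult_nonneg_nonneg prod_nonneg divide_nonneg_nonneg)
  also have "\<dots> = H * (\<Prod>r\<in>A. 3 / real r)" by (simp add: H_def sum_distrib_right)
  finally show ?thesis by (simp add: A_def)
qed

text \<open>Uniqueness of partial fractions: after multiplication by the product of
  \<open>P\<close>, every term except that of r is divisible by r, and its cofactor is prime to
  r.\<close>

lemma dvd_of_sum_fractions:
  assumes k: "(\<Sum>r\<in>P. real_of_int (t r) / real r) = of_int k" and r: "r \<in> P"
  shows "int r dvd t r"
proof -
  have Pr: "real (\<Prod>P) = real s * real (\<Prod>(P - {s}))" if "s \<in> P" for s
    using that finite_P by (subst prod.remove[of P s]) auto
  have "real (\<Prod>P) * (\<Sum>s\<in>P. real_of_int (t s) / real s) = (\<Sum>s\<in>P. real_of_int (t s) * real (\<Prod>(P - {s})))"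
    unfolding sum_distrib_left
    by (rule sum.cong) (use Pr pos_P in \<open>auto simp del: of_nat_prod\<close>)
  then have "real_of_int (int (\<Prod>P) * k) = real_of_int (\<Sum>s\<in>P. t s * int (\<Prod>(P - {s})))"
    unfolding k by (simp del: of_nat_prod)
  then have "int (\<Prod>P) * k = (\<Sum>s\<in>P. t s * int (\<Prod>(P - {s})))" by linarith
  also have "\<dots> = t r * int (\<Prod>(P - {r})) + (\<Sum>s\<in>P - {r}. t s * int (\<Prod>(P - {s})))"
    by (rule sum.remove[OF finite_P r])
  finally have eq: "t r * int (\<Prod>(P - {r})) = int (\<Prod>P) * k - (\<Sum>s\<in>P - {r}. t s * int (\<Prod>(P - {s})))"
    by simp
  have "int r dvd int (\<Prod>P) * k - (\<Sum>s\<in>P - {r}. t s * int (\<Prod>(P - {s})))"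
  proof (intro dvd_diff dvd_sum)
    have "r dvd \<Prod>P" using finite_P r by (intro dvd_prodI)
    then show "int r dvd int (\<Prod>P) * k" by (intro dvd_mult2) (simp del: of_nat_prod)
    fix s assume "s \<in> P - {r}"
    then have "r dvd \<Prod>(P - {s})" using finite_P r by (intro dvd_prodI) auto
    then show "int r dvd t s * int (\<Prod>(P - {s}))" by (intro dvd_mult) (simp del: of_nat_prod)
  qed
  then have "int r dvd t r * int (\<Prod>(P - {r}))" by (simp only: eq)
  moreover have "coprime r (\<Prod>(P - {r}))"
    using r prime_P by (intro prod_coprime_right) (auto intro!: primes_coprime)
  then have "coprime (int r) (int (\<Prod>(P - {r})))" by (simp del: of_nat_prod)
  ultimately show ?thesis by (simp add: coprime_dvd_mult_left_iff del: of_nat_prod)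
qed

lemma prod_times_fractions_Ints:
  assumes "A \<subseteq> P" and "\<And>r. r \<in> P - A \<Longrightarrow> t r = 0"
  shows "real (\<Prod>A) * (\<Sum>r\<in>P. real_of_int (t r) / real r) \<in> \<int>"
proof -
  have "real (\<Prod>A) * (real_of_int (t r) / real r) \<in> \<int>" if r: "r \<in> P" for r
  proof (cases "r \<in> A")
    case True
    have "finite A" using assms finite_P finite_subset by blast
    then have "real (\<Prod>A) = real r * real (\<Prod>(A - {r}))"
      using True by (subst prod.remove[of A r]) auto
    then have "real (\<Prod>A) * (real_of_int (t r) / real r) = of_int (int (\<Prod>(A - {r})) * t r)"
      using pos_P[OF r] by (simp del: of_nat_prod)
    then show ?thesis by (metis Ints_of_int)
  qed (use assms r in auto)
  then show ?thesis by (simp only: sum_distrib_left Ints_sum)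
qed

text \<open>Pairs occur because |V|^2 has the frequencies
  \<open>freq \<gamma> - freq \<gamma>'\<close>. The window 1 / (4 U) is the width of the spectrum
  of the squared localizing kernel.\<close>

definition close_pairs :: "nat \<Rightarrow> real \<Rightarrow> ((nat \<Rightarrow> int) \<times> (nat \<Rightarrow> int)) set" where
  "close_pairs U \<theta> = {(\<gamma>, \<gamma>') \<in> Gam \<times> Gam. \<exists>k::int. \<bar>\<theta> + freq \<gamma> - freq \<gamma>' - of_int k\<bar> < 1 / (4 * real U)}"

text \<open>The frequency differences of two close pairs differ by less than 1 / (2 U) modulo 1, and
  this discrepancy is a fraction whose denominator divides a product of four supports, hence is at
  most z^4 <= U. So it is an integer, and partial fractions give the congruences. All close pairs
  thus share one shift, as \<open>pair_sum_le\<close> requires.\<close>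

lemma close_pairs_cong:
  assumes U: "z ^ 4 \<le> real U"
    and c: "(\<gamma>, \<gamma>') \<in> close_pairs U \<theta>" "(\<delta>, \<delta>') \<in> close_pairs U \<theta>" and r: "r \<in> P"
  shows "[\<gamma> r - \<gamma>' r = \<delta> r - \<delta>' r] (mod int r)"
proof -
  have "z ^ 4 > 0" using z_gt_1 by simp
  then have U0: "real U > 0" using U by linarith
  define t where "t = (\<lambda>r. (\<gamma> r - \<gamma>' r) - (\<delta> r - \<delta>' r))"
  define s where "s = (\<lambda>\<gamma>::nat \<Rightarrow> int. {r\<in>P. \<gamma> r \<noteq> 0})"
  define A where "A = (s \<gamma> \<union> s \<gamma>') \<union> (s \<delta> \<union> s \<delta>')"
  define y where "y = (\<Sum>r\<in>P. real_of_int (t r) / real r)"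
  have sP: "s \<gamma> \<subseteq> P" for \<gamma> by (auto simp: s_def)
  have sz: "real (\<Prod>(s \<gamma>)) < z" if "\<gamma> \<in> Gam" for \<gamma> using that by (simp add: s_def Gam_def)
  have un: "real (\<Prod>(A \<union> B)) \<le> real (\<Prod>A) * real (\<Prod>B)" if AB: "A \<subseteq> P" "B \<subseteq> P" for A B
  proof -
    have "finite A" "finite B" using AB finite_P finite_subset by blast+
    then have "\<Prod>(A \<union> B) * \<Prod>(A \<inter> B) = \<Prod>A * \<Prod>B" by (rule prod.union_inter)
    moreover have "\<Prod>(A \<inter> B) \<ge> 1" using AB prod_P_pos[of "A \<inter> B"] by (simp add: Suc_le_eq subset_iff)
    then have "\<Prod>(A \<union> B) * 1 \<le> \<Prod>(A \<union> B) * \<Prod>(A \<inter> B)" by (rule mult_left_mono) simp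
    ultimately have "\<Prod>(A \<union> B) \<le> \<Prod>A * \<Prod>B" by simp
    then have "real (\<Prod>(A \<union> B)) \<le> real (\<Prod>A * \<Prod>B)" by (rule of_nat_mono)
    then show ?thesis by (simp only: of_nat_mult)
  qed
  have g: "\<gamma> \<in> Gam" "\<gamma>' \<in> Gam" "\<delta> \<in> Gam" "\<delta>' \<in> Gam" using c by (auto simp: close_pairs_def)
  have "real (\<Prod>A) \<le> real (\<Prod>(s \<gamma> \<union> s \<gamma>')) * real (\<Prod>(s \<delta> \<union> s \<delta>'))"
    unfolding A_def by (rule un) (auto simp: s_def)
  also have "\<dots> \<le> (real (\<Prod>(s \<gamma>)) * real (\<Prod>(s \<gamma>'))) * (real (\<Prod>(s \<delta>)) * real (\<Prod>(s \<delta>')))"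
    by (intro mult_mono un sP mult_nonneg_nonneg of_nat_0_le_iff)
  also have "\<dots> \<le> (z * z) * (z * z)"
    using z_gt_1 by (intro mult_mono less_imp_le[OF sz] g mult_nonneg_nonneg of_nat_0_le_iff) auto
  finally have A: "real (\<Prod>A) \<le> real U" using U by (simp add: power4_eq_xxxx mult.assoc)
  obtain k l :: int where kl: "\<bar>\<theta> + freq \<gamma> - freq \<gamma>' - of_int k\<bar> < 1 / (4 * real U)"
    "\<bar>\<theta> + freq \<delta> - freq \<delta>' - of_int l\<bar> < 1 / (4 * real U)"
    using c by (auto simp: close_pairs_def)
  have y: "y = freq \<gamma> - freq \<gamma>' - (freq \<delta> - freq \<delta>')"
    by (simp add: y_def t_def freq_def diff_divide_distrib sum_subtractf)
  have half: "1 / (4 * real U) = (1 / (2 * real U)) / 2" by simp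
  have "\<bar>y - of_int (k - l)\<bar> < 1 / (2 * real U)"
    using kl unfolding y half by (simp only: of_int_diff) (simp only: abs_less_iff, linarith)
  then have "real (\<Prod>A) * \<bar>y - of_int (k - l)\<bar> \<le> real U * (1 / (2 * real U))"
    using A by (intro mult_mono) auto
  also have "\<dots> < 1" using U0 by simp
  also have "real (\<Prod>A) * \<bar>y - of_int (k - l)\<bar> = \<bar>real (\<Prod>A) * (y - of_int (k - l))\<bar>"
    by (simp only: abs_mult abs_of_nat)
  also have "real (\<Prod>A) * (y - of_int (k - l)) = real (\<Prod>A) * y - of_int (int (\<Prod>A) * (k - l))"
    by (simp only: right_diff_distrib of_int_mult of_int_of_nat_eq of_int_diff)
  finally have small: "\<bar>real (\<Prod>A) * y - of_int (int (\<Prod>A) * (k - l))\<bar> < 1" .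
  have "real (\<Prod>A) * y \<in> \<int>"
    unfolding y_def by (rule prod_times_fractions_Ints) (auto simp: A_def s_def t_def)
  then obtain i where i: "real (\<Prod>A) * y = of_int i" by (elim Ints_cases)
  have "i = int (\<Prod>A) * (k - l)"
    using small unfolding i of_int_diff[symmetric] of_int_abs[symmetric] by linarith
  then have "real (\<Prod>A) * y = real (\<Prod>A) * of_int (k - l)" using i by (simp del: of_nat_prod)
  moreover have "\<Prod>A > 0" by (rule prod_P_pos) (auto simp: A_def s_def)
  ultimately have "y = of_int (k - l)" by (simp del: of_nat_prod)
  then have "int r dvd t r" unfolding y_def using r by (rule dvd_of_sum_fractions)
  then show ?thesis by (simp add: t_def cong_iff_dvd_diff)
qed

text \<open>The frequency difference of the pair has denominator q; multiplying the closeness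
  condition by q * U turns it into a statement about integers.\<close>

lemma close_pairs_near:
  assumes U: "U > 0" and c: "(\<delta>, \<delta>') \<in> close_pairs U (of_int v / real U)"
  defines "q \<equiv> int (\<Prod>{r\<in>P. \<delta> r \<noteq> \<delta>' r})"
  shows "\<exists>t. 4 * \<bar>t\<bar> \<le> q \<and> int U dvd q * v - t"
proof -
  let ?A = "{r\<in>P. \<delta> r \<noteq> \<delta>' r}"
  obtain k :: int where k: "\<bar>of_int v / real U + freq \<delta> - freq \<delta>' - of_int k\<bar> < 1 / (4 * real U)"
    using c by (auto simp: close_pairs_def)
  have "real (\<Prod>?A) * (\<Sum>r\<in>P. real_of_int (\<delta> r - \<delta>' r) / real r) \<in> \<int>"
    by (rule prod_times_fractions_Ints) auto
  then obtain i where i: "real (\<Prod>?A) * (\<Sum>r\<in>P. real_of_int (\<delta> r - \<delta>' r) / real r) = of_int i"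
    by (elim Ints_cases)
  have q: "real_of_int q = real (\<Prod>?A)" by (simp add: q_def del: of_nat_prod)
  have q0: "real_of_int q > 0" unfolding q using prod_P_pos[of ?A] by (simp del: of_nat_prod)
  have i': "real_of_int q * (freq \<delta> - freq \<delta>') = of_int i"
    using i unfolding q by (simp add: freq_def diff_divide_distrib sum_subtractf)
  define t where "t = q * v + int U * (i - q * k)"
  have "real_of_int t = real_of_int q * real U * (of_int v / real U + freq \<delta> - freq \<delta>' - of_int k)"
    using U i' by (simp add: t_def algebra_simps) (simp flip: i' add: algebra_simps)
  then have "\<bar>real_of_int t\<bar> = real_of_int q * real U * \<bar>of_int v / real U + freq \<delta> - freq \<delta>' - of_int k\<bar>"
    using q0 by (simp add: abs_mult)
  also have "\<dots> \<le> real_of_int q * real U * (1 / (4 * real U))"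
    using k q0 by (intro mult_left_mono) auto
  also have "\<dots> = real_of_int q / 4" using U by simp
  finally have "4 * \<bar>t\<bar> \<le> q" by linarith
  moreover have "int U dvd q * v - t" by (simp add: t_def)
  ultimately show ?thesis by blast
qed

end

text \<open>Here 9/r is (3/r)^2 * r, the local factor left by Cauchy-Schwarz. Denominators q are
  grouped by j, the integer part of sqrt(ln q). In a group all primes are at most exp((j + 1)^2), so
  Bernoulli's inequality and the bound on the product of 1 + 1/r give at most (j^3)^9; against
  2^(-j) <= j^(-60) this leaves 2 / j^33. Since all primes exceed exp(J0^2), j starts at
  \<open>J0\<close>.\<close>

lemma sum_blocks_le:
  fixes P :: "nat set"
  assumes fin: "finite P" and P: "\<And>r. r \<in> P \<Longrightarrow> prime r \<and> exp ((real J0)\<^sup>2) < real r" and J0: "J0 \<ge> 600"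
  defines "J \<equiv> \<lambda>A. nat \<lfloor>sqrt (ln (real (\<Prod>A)))\<rfloor>"
  shows "(\<Sum>A\<in>Pow P - {{}}. 2 * (\<Prod>r\<in>A. 9 / real r) / 2 ^ J A) \<le> 1 / real J0 ^ 30"
    and "\<And>A. A \<subseteq> P \<Longrightarrow> A \<noteq> {} \<Longrightarrow> J0 \<le> J A \<and> (real (J A))\<^sup>2 \<le> ln (real (\<Prod>A)) \<and> ln (real (\<Prod>A)) < (real (J A) + 1)\<^sup>2"
proof -
  have pos: "r > 0" if "r \<in> P" for r using P[OF that] prime_gt_0_nat by blast
  have le: "r \<le> \<Prod>A" if "A \<subseteq> P" "r \<in> A" for r A
  proof -
    have "r dvd \<Prod>A" using that fin by (intro dvd_prodI) (auto intro: finite_subset)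
    moreover have "\<Prod>A > 0" using that pos by (intro prod_pos) auto
    ultimately show ?thesis by (rule dvd_imp_le)
  qed
  have lnA: "(real J0)\<^sup>2 \<le> ln (real (\<Prod>A))" if A: "A \<subseteq> P" "A \<noteq> {}" for A
  proof -
    obtain r where r: "r \<in> A" using A by blast
    have "exp ((real J0)\<^sup>2) < real r" using P A r by blast
    also have "\<dots> \<le> real (\<Prod>A)" using le[OF A(1) r] by (rule of_nat_mono)
    finally have "ln (exp ((real J0)\<^sup>2)) \<le> ln (real (\<Prod>A))" by (intro ln_mono) auto
    then show ?thesis by simp
  qed
  show props: "J0 \<le> J A \<and> (real (J A))\<^sup>2 \<le> ln (real (\<Prod>A)) \<and> ln (real (\<Prod>A)) < (real (J A) + 1)\<^sup>2"
    if A: "A \<subseteq> P" "A \<noteq> {}" for A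
  proof -
    define y where "y = ln (real (\<Prod>A))"
    have y: "(real J0)\<^sup>2 \<le> y" using lnA[OF A] by (simp add: y_def)
    then have "real J0 \<le> sqrt y" by (simp add: real_le_rsqrt)
    then have "J0 \<le> nat \<lfloor>sqrt y\<rfloor>" by (rule le_nat_floor)
    moreover have y0: "y \<ge> 0" using y by (meson order_trans zero_le_power2)
    have "real (nat \<lfloor>sqrt y\<rfloor>) \<le> sqrt y" using y0 by (intro of_nat_floor) simp
    then have "(real (nat \<lfloor>sqrt y\<rfloor>))\<^sup>2 \<le> (sqrt y)\<^sup>2" by (intro power_mono) auto
    moreover have "sqrt y < real (nat \<lfloor>sqrt y\<rfloor>) + 1" using y0 by (simp add: of_nat_nat)
    then have "(sqrt y)\<^sup>2 < (real (nat \<lfloor>sqrt y\<rfloor>) + 1)\<^sup>2" using y0 by (intro power_strict_mono) auto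
    ultimately show ?thesis using y0 by (simp add: J_def y_def)
  qed
  let ?S = "Pow P - {{}}"
  let ?f = "\<lambda>A. 2 * (\<Prod>r\<in>A. 9 / real r) / 2 ^ J A"
  have finS: "finite ?S" using fin by simp
  define K where "K = Max (J ` ?S)"
  have JK: "J ` ?S \<subseteq> {J0..K}"
  proof (rule image_subsetI)
    fix A assume A: "A \<in> ?S"
    then have "J0 \<le> J A" using props[of A] by blast
    moreover have "J A \<le> K" unfolding K_def using A finS by (intro Max_ge) auto
    ultimately show "J A \<in> {J0..K}" by simp
  qed
  have "(\<Sum>A\<in>?S. ?f A) = (\<Sum>j\<in>{J0..K}. \<Sum>A\<in>{A\<in>?S. J A = j}. ?f A)"
    by (rule sum.group[OF finS _ JK, symmetric]) simp
  also have "\<dots> \<le> (\<Sum>j\<in>{J0..K}. 2 / real j ^ 33)"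
  proof (rule sum_mono)
    fix j assume j: "j \<in> {J0..K}"
    then have j600: "real j \<ge> 600" "j \<ge> 600" using J0 by auto
    define x where "x = exp ((real j + 1)\<^sup>2)"
    have x4: "x \<ge> 4"
    proof -
      have "(600 + 1)\<^sup>2 \<le> (real j + 1)\<^sup>2" using j600 by (intro power_mono) auto
      then have "3 \<le> (real j + 1)\<^sup>2" by simp
      then show ?thesis using exp_ge_add_one_self[of "(real j + 1)\<^sup>2"] unfolding x_def by linarith
    qed
    let ?Q = "{r\<in>P. real r \<le> x}"
    have sub: "{A\<in>?S. J A = j} \<subseteq> Pow ?Q"
    proof (intro subsetI PowI)
      fix A r assume "A \<in> {A\<in>?S. J A = j}" "r \<in> A"
      then have A: "A \<subseteq> P" "A \<noteq> {}" "j = J A" "r \<in> A" by auto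
      have "ln (real (\<Prod>A)) < (real j + 1)\<^sup>2" using props[OF A(1,2)] A(3) by simp
      moreover have "real (\<Prod>A) > 0" using le[OF A(1,4)] pos A by (simp del: of_nat_prod) (metis bot_nat_0.not_eq_extremum le_zero_eq subsetD)
      ultimately have "real (\<Prod>A) < x" unfolding x_def by (metis exp_less_cancel_iff exp_ln)
      moreover have "real r \<le> real (\<Prod>A)" using le[OF A(1,4)] by (rule of_nat_mono)
      ultimately show "r \<in> ?Q" using A by auto
    qed
    have "(\<Sum>A\<in>{A\<in>?S. J A = j}. ?f A) = (\<Sum>A\<in>{A\<in>?S. J A = j}. (2 / 2 ^ j) * (\<Prod>r\<in>A. 9 / real r))"
      by (rule sum.cong) auto
    also have "\<dots> \<le> (\<Sum>A\<in>Pow ?Q. (2 / 2 ^ j) * (\<Prod>r\<in>A. 9 / real r))"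
      using fin by (intro sum_mono2 sub) (auto intro!: divide_nonneg_nonneg mult_nonneg_nonneg prod_nonneg)
    also have "\<dots> = (2 / 2 ^ j) * (\<Prod>r\<in>?Q. 1 + 9 / real r)"
      using fin by (subst add.commute, subst prod_add) (simp_all add: sum_distrib_left)
    also have "\<dots> \<le> (2 / 2 ^ j) * (\<Prod>r\<in>?Q. (1 + 1 / real r) ^ 9)"
    proof (intro mult_left_mono prod_mono, safe)
      fix r
      have "1 + real 9 * (1 / real r) \<le> (1 + 1 / real r) ^ 9"
        by (rule Bernoulli_inequality) (auto intro: order_trans[of _ 0])
      then show "1 + 9 / real r \<le> (1 + 1 / real r) ^ 9" by simp
    qed auto
    also have "\<dots> = (2 / 2 ^ j) * (\<Prod>r\<in>?Q. 1 + 1 / real r) ^ 9" by (simp only: prod_power_distrib)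
    also have "\<dots> \<le> (2 / 2 ^ j) * (real j ^ 3) ^ 9"
    proof (intro mult_left_mono power_mono)
      have "(\<Prod>r\<in>?Q. 1 + 1 / real r) \<le> exp 2 * (1 + ln x)"
        using P by (intro prod_one_plus_inverse_primes_le x4) auto
      also have "exp (2::real) = exp 1 * exp 1" by (simp flip: exp_add)
      also have "\<dots> \<le> 3 * 3" using exp_le by (intro mult_mono) auto
      also have "1 + ln x = 1 + (real j + 1)\<^sup>2" by (simp add: x_def)
      also have "3 * 3 * (1 + (real j + 1)\<^sup>2) \<le> 3 * 3 * (real j ^ 2 + (2 * real j)\<^sup>2)"
        using j600 by (intro mult_left_mono add_mono power_mono) (auto intro: one_le_power)
      also have "\<dots> = 45 * real j ^ 2" by (simp add: power_mult_distrib)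
      also have "\<dots> \<le> real j * real j ^ 2" using j600 by (intro mult_right_mono) auto
      finally show "(\<Prod>r\<in>?Q. 1 + 1 / real r) \<le> real j ^ 3"
        using x4 by (simp add: power3_eq_cube power2_eq_square mult_right_mono)
    qed (auto intro!: prod_nonneg)
    also have "\<dots> = 2 * real j ^ 27 / 2 ^ j" by (simp flip: power_mult)
    also have "\<dots> \<le> 2 * real j ^ 27 / real j ^ 60"
      using power_60_le[OF j600(2)] j600 by (intro divide_left_mono) auto
    also have "\<dots> = 2 / real j ^ 33"
    proof -
      have "real j ^ 60 = real j ^ 27 * real j ^ 33" by (simp flip: power_add)
      moreover have "2 * a / (a * b) = 2 / b" if "a \<noteq> 0" for a b :: real using that by simp
      moreover have "real j ^ 27 \<noteq> 0" using j600 by simp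
      ultimately show ?thesis by (simp only:)
    qed
    finally show "(\<Sum>A\<in>{A\<in>?S. J A = j}. ?f A) \<le> 2 / real j ^ 33" .
  qed
  also have "\<dots> \<le> (\<Sum>j\<in>{J0..K}. (2 / real J0 ^ 31) * (1 / (real j)\<^sup>2))"
  proof (rule sum_mono)
    fix j assume j: "j \<in> {J0..K}"
    then have "real J0 ^ 31 \<le> real j ^ 31" by (intro power_mono) auto
    then have "real J0 ^ 31 * (real j)\<^sup>2 \<le> real j ^ 31 * (real j)\<^sup>2" by (rule mult_right_mono) simp
    also have "\<dots> = real j ^ 33" by (simp flip: power_add)
    finally have "2 / real j ^ 33 \<le> 2 / (real J0 ^ 31 * (real j)\<^sup>2)"
      using j J0 by (intro divide_left_mono) auto
    then show "2 / real j ^ 33 \<le> (2 / real J0 ^ 31) * (1 / (real j)\<^sup>2)" by simp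
  qed
  also have "\<dots> = (2 / real J0 ^ 31) * (\<Sum>j\<in>{J0..K}. 1 / (real j)\<^sup>2)" by (simp add: sum_distrib_left)
  also have "\<dots> \<le> (2 / real J0 ^ 31) * (\<Sum>j=1..K. 1 / (real j)\<^sup>2)"
    using J0 by (intro mult_left_mono sum_mono2) auto
  also have "\<dots> \<le> (2 / real J0 ^ 31) * 2"
    by (intro mult_left_mono sum_inverse_squares_le) simp
  also have "\<dots> = 4 / real J0 / real J0 ^ 30" by (simp add: power_add[of _ 1 30, simplified])
  also have "\<dots> \<le> 1 / real J0 ^ 30" using J0 by (intro divide_right_mono) auto
  finally show "(\<Sum>A\<in>?S. ?f A) \<le> 1 / real J0 ^ 30" .
qed

section \<open>Localization\<close>

context selberg_weight
begin

text \<open>All frequencies v/U, a/q and j / \<open>modulus U\<close> that occur are multiples of 1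
  / \<open>modulus U\<close>, so summation over a full period is exactly orthogonal. The factor 4
  keeps the phases of \<open>fejer\<close> within a quarter turn for n <= U.\<close>

definition modulus :: "nat \<Rightarrow> nat" where
  "modulus U = 4 * U * \<Prod>P"

text \<open>A normalized Dirichlet kernel; it is its squared modulus that is the Fejer
  kernel.\<close>

definition fejer :: "nat \<Rightarrow> nat \<Rightarrow> complex" where
  "fejer U n = of_real (1 / real (\<Prod>P)) * (\<Sum>j<\<Prod>P. e (real n * (real j / real (modulus U))))"

text \<open>For n <= U every term lies on the first quarter of the unit circle, where Re + Im >= 1.
  This survives averaging, and |w|^2 >= (Re w + Im w)^2 / 2.\<close>

lemma fejer_ge:
  assumes "n \<le> U" "U > 0"
  shows "(cmod (fejer U n))\<^sup>2 \<ge> 1 / 2"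
proof -
  let ?J = "\<Prod>P"
  have J0: "?J > 0" by (rule prod_P_pos) simp
  have M: "real (modulus U) = 4 * real U * real ?J" by (simp add: modulus_def)
  have ph: "0 \<le> y \<and> y \<le> 1/4 \<Longrightarrow> Re (e y) + Im (e y) \<ge> 1" for y
  proof -
    assume y: "0 \<le> y \<and> y \<le> 1/4"
    have "2 * pi * y \<le> 2 * pi * (1/4)" using y by (intro mult_left_mono) auto
    then have s: "sin (2 * pi * y) \<ge> 0" "cos (2 * pi * y) \<ge> 0"
      using y by (auto intro!: sin_ge_zero cos_ge_zero intro: order_trans[of _ 0])
    have "(sin (2 * pi * y))\<^sup>2 + (cos (2 * pi * y))\<^sup>2 = 1" by simp
    then have "(cos (2 * pi * y) + sin (2 * pi * y))\<^sup>2 \<ge> 1\<^sup>2"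
      using mult_nonneg_nonneg[OF s(2,1)] by (simp add: power2_sum)
    then have "cos (2 * pi * y) + sin (2 * pi * y) \<ge> 1"
      by (rule power2_le_imp_le) (use s in auto)
    then show "Re (e y) + Im (e y) \<ge> 1" by (simp add: e_def Re_exp Im_exp)
  qed
  have "real ?J = (\<Sum>j<?J. 1)" by simp
  also have "\<dots> \<le> (\<Sum>j<?J. Re (e (real n * (real j / real (modulus U)))) + Im (e (real n * (real j / real (modulus U)))))"
  proof (rule sum_mono, rule ph)
    fix j assume "j \<in> {..<?J}"
    then have "n * j \<le> U * ?J"
      using assms by (intro mult_mono) auto
    then have "real (n * j) \<le> real (U * ?J)" by (rule of_nat_mono)
    then have "real n * real j \<le> real U * real ?J" by (simp only: of_nat_mult)
    then show "0 \<le> real n * (real j / real (modulus U)) \<and> real n * (real j / real (modulus U)) \<le> 1 / 4"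
      using J0 assms unfolding M by (simp add: field_simps del: of_nat_prod)
  qed
  also have "\<dots> = real ?J * (Re (fejer U n) + Im (fejer U n))"
    using J0 by (simp add: fejer_def sum.distrib distrib_left del: of_nat_prod)
  finally have "1 \<le> Re (fejer U n) + Im (fejer U n)"
    using J0 by (simp del: of_nat_prod)
  then have "1\<^sup>2 \<le> (Re (fejer U n) + Im (fejer U n))\<^sup>2" by (intro power_mono) auto
  also have "\<dots> \<le> 2 * ((Re (fejer U n))\<^sup>2 + (Im (fejer U n))\<^sup>2)"
    using zero_le_power2[of "Re (fejer U n) - Im (fejer U n)"] by (simp add: power2_eq_square algebra_simps)
  finally show ?thesis by (simp add: cmod_power2)
qed

definition close_weight :: "nat \<Rightarrow> real \<Rightarrow> real" where
  "close_weight U \<theta> = (\<Sum>(\<gamma>, \<gamma>')\<in>close_pairs U \<theta>. \<bar>wt \<gamma>\<bar> * \<bar>wt \<gamma>'\<bar>)"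

lemma close_pairs_subset: "close_pairs U \<theta> \<subseteq> Gam \<times> Gam"
  by (auto simp: close_pairs_def)

text \<open>Orthogonality keeps only integral total frequencies. This forces the pair to be close,
  since |j - j'| divided by the modulus is less than 1 / (4 U). For a close pair each j admits at
  most one j'. So at most as many solutions remain as there are values of j, and with weight modulus
  / (number of j)^2 each they total at most 4 U.\<close>

lemma kernel_le:
  assumes U: "U > 0"
  shows "cmod (\<Sum>n<modulus U. e (real n * (of_int v / real U)) * ((V n * cnj (V n)) * (fejer U n * cnj (fejer U n))))
    \<le> 4 * real U * close_weight U (of_int v / real U)"
proof -
  let ?J = "\<Prod>P" and ?M = "modulus U" and ?\<theta> = "of_int v / real U"
  have J0: "?J > 0" by (rule prod_P_pos) simp
  have M: "real ?M = 4 * real U * real ?J" by (simp add: modulus_def)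
  have M0: "real ?M > 0" unfolding M using J0 U by (simp del: of_nat_prod)
  let ?I = "(Gam \<times> Gam) \<times> ({..<?J} \<times> {..<?J})"
  define c where "c = (\<lambda>((\<gamma>, \<gamma>'), (j::nat, j'::nat)). (wt \<gamma> * wt \<gamma>') * (1 / (real ?J)\<^sup>2))"
  define y where "y = (\<lambda>((\<gamma>, \<gamma>'), (j, j')). ?\<theta> + freq \<gamma> - freq \<gamma>' + (real j - real j') / real ?M)"
  have VV: "V n * cnj (V n) = (\<Sum>(\<gamma>, \<gamma>')\<in>Gam \<times> Gam. of_real (wt \<gamma> * wt \<gamma>') * e (real n * (freq \<gamma> - freq \<gamma>')))" for n
    unfolding V_def cnj_sum sum_product sum.cartesian_product
    by (intro sum.cong refl) (auto simp: cnj_e right_diff_distrib e_add[of _ "- _", simplified])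
  have F: "fejer U n = (\<Sum>j<?J. of_real (1 / real ?J) * e (real n * (real j / real ?M)))" for n
    by (simp only: fejer_def sum_distrib_left)
  have FF: "fejer U n * cnj (fejer U n) = (\<Sum>(j, j')\<in>{..<?J} \<times> {..<?J}. of_real (1 / (real ?J)\<^sup>2) * e (real n * ((real j - real j') / real ?M)))" for n
    unfolding F cnj_sum sum_product sum.cartesian_product
    by (intro sum.cong refl) (auto simp: cnj_e right_diff_distrib diff_divide_distrib power2_eq_square e_add[of _ "- _", simplified] simp del: of_nat_prod)
  have prod: "e (real n * ?\<theta>) * ((V n * cnj (V n)) * (fejer U n * cnj (fejer U n))) = (\<Sum>i\<in>?I. of_real (c i) * e (real n * y i))" for n
  proof -
    have *: "(V n * cnj (V n)) * (fejer U n * cnj (fejer U n)) = (\<Sum>(p, q)\<in>?I.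
        (case p of (\<gamma>, \<gamma>') \<Rightarrow> of_real (wt \<gamma> * wt \<gamma>') * e (real n * (freq \<gamma> - freq \<gamma>'))) *
        (case q of (j, j') \<Rightarrow> of_real (1 / (real ?J)\<^sup>2) * e (real n * ((real j - real j') / real ?M))))"
      by (simp only: VV FF sum_product sum.cartesian_product)
    show ?thesis
      unfolding * sum_distrib_left
      by (intro sum.cong refl) (auto simp: c_def y_def distrib_left right_diff_distrib e_add e_add[of _ "- _", simplified] simp del: of_nat_prod)
  qed
  have My: "real ?M * y i \<in> \<int>" if i: "i \<in> ?I" for i
  proof -
    obtain \<gamma> \<gamma>' j j' where i': "i = ((\<gamma>, \<gamma>'), (j, j'))" by (metis surj_pair)
    have f: "real ?J * freq \<gamma> \<in> \<int>" for \<gamma>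
      unfolding freq_def by (rule prod_times_fractions_Ints) auto
    have "real ?M * y i = of_int (4 * int ?J * v) + of_int (4 * int U) * (real ?J * freq \<gamma>)
        - of_int (4 * int U) * (real ?J * freq \<gamma>') + of_int (int j - int j')"
      using U J0 M0 by (simp add: i' y_def M field_simps del: of_nat_prod)
    then show ?thesis using f by (simp only:) (intro Ints_add Ints_diff Ints_mult Ints_of_int f)
  qed
  have inner: "(\<Sum>(j, j')\<in>{..<?J} \<times> {..<?J}. if y (p, (j, j')) \<in> \<int> then real ?M * (1 / (real ?J)\<^sup>2) else 0)
      \<le> (if p \<in> close_pairs U ?\<theta> then 4 * real U else 0)" if p: "p \<in> Gam \<times> Gam" for p
  proof (cases "p \<in> close_pairs U ?\<theta>")
    case True
    have one: "(\<Sum>j'<?J. if y (p, (j, j')) \<in> \<int> then real ?M * (1 / (real ?J)\<^sup>2) else 0) \<le> real ?M * (1 / (real ?J)\<^sup>2)" for j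
    proof -
      have "card {j'\<in>{..<?J}. y (p, (j, j')) \<in> \<int>} \<le> Suc 0"
      proof (subst card_le_Suc0_iff_eq, simp, intro ballI)
        fix a b assume ab: "a \<in> {j'\<in>{..<?J}. y (p, (j, j')) \<in> \<int>}" "b \<in> {j'\<in>{..<?J}. y (p, (j, j')) \<in> \<int>}"
        have "y (p, (j, b)) - y (p, (j, a)) \<in> \<int>" using ab by (intro Ints_diff) auto
        also have "y (p, (j, b)) - y (p, (j, a)) = (real a - real b) / real ?M"
          by (cases p) (simp add: y_def diff_divide_distrib)
        finally obtain k where k: "(real a - real b) / real ?M = of_int k" by (elim Ints_cases)
        have "\<bar>real a - real b\<bar> < real ?J" using ab by (auto simp del: of_nat_prod)
        also have "\<dots> \<le> real ?M" unfolding M using U mult_right_mono[of 1 "4 * real U" "real ?J"] by (simp del: of_nat_prod)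
        finally have "\<bar>(real a - real b) / real ?M\<bar> < 1" using M0 by simp
        then have "k = 0" unfolding k by linarith
        then show "a = b" using k M0 by simp
      qed
      then have "real (card {j'\<in>{..<?J}. y (p, (j, j')) \<in> \<int>}) \<le> 1" by simp
      then have "real (card {j'\<in>{..<?J}. y (p, (j, j')) \<in> \<int>}) * (real ?M * (1 / (real ?J)\<^sup>2)) \<le> 1 * (real ?M * (1 / (real ?J)\<^sup>2))"
        by (rule mult_right_mono) simp
      then show ?thesis by (simp add: sum.inter_filter[symmetric])
    qed
    have "(\<Sum>(j, j')\<in>{..<?J} \<times> {..<?J}. if y (p, (j, j')) \<in> \<int> then real ?M * (1 / (real ?J)\<^sup>2) else 0)
        = (\<Sum>j<?J. \<Sum>j'<?J. if y (p, (j, j')) \<in> \<int> then real ?M * (1 / (real ?J)\<^sup>2) else 0)"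
      by (rule sum.cartesian_product[symmetric])
    also have "\<dots> \<le> (\<Sum>j<?J. real ?M * (1 / (real ?J)\<^sup>2))" by (rule sum_mono) (rule one)
    also have "\<dots> = 4 * real U" using J0 by (simp add: M power2_eq_square del: of_nat_prod)
    finally show ?thesis using True by simp
  next
    case False
    have "y (p, (j, j')) \<notin> \<int>" if j: "j < ?J" "j' < ?J" for j j'
    proof
      assume "y (p, (j, j')) \<in> \<int>"
      then obtain k where k: "y (p, (j, j')) = of_int k" by (elim Ints_cases)
      obtain \<gamma> \<gamma>' where p': "p = (\<gamma>, \<gamma>')" by (cases p)
      have "\<bar>real j' - real j\<bar> < real ?J" using j by (auto simp del: of_nat_prod)
      then have "\<bar>(real j' - real j) / real ?M\<bar> < real ?J / real ?M" using M0 by (simp add: divide_strict_right_mono)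
      also have "\<dots> = 1 / (4 * real U)" using J0 by (simp add: M del: of_nat_prod)
      also have "(real j' - real j) / real ?M = ?\<theta> + freq \<gamma> - freq \<gamma>' - of_int k"
        using k by (simp add: y_def p' diff_divide_distrib)
      finally show False using False p p' by (auto simp: close_pairs_def)
    qed
    then have "(\<Sum>(j, j')\<in>{..<?J} \<times> {..<?J}. if y (p, (j, j')) \<in> \<int> then real ?M * (1 / (real ?J)\<^sup>2) else 0) = 0"
      by (intro sum.neutral) auto
    then show ?thesis using False by simp
  qed
  have "(\<Sum>n<?M. e (real n * ?\<theta>) * ((V n * cnj (V n)) * (fejer U n * cnj (fejer U n))))
      = (\<Sum>i\<in>?I. \<Sum>n<?M. of_real (c i) * e (real n * y i))"
    unfolding prod by (rule sum.swap)
  also have "\<dots> = (\<Sum>i\<in>?I. of_real (c i) * (if y i \<in> \<int> then of_nat ?M else 0))"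
    by (intro sum.cong refl) (simp only: sum_distrib_left[symmetric] sum_e[OF My])
  also have "cmod \<dots> \<le> (\<Sum>i\<in>?I. \<bar>c i\<bar> * (if y i \<in> \<int> then real ?M else 0))"
    by (rule order_trans[OF norm_sum]) (auto intro!: sum_mono simp: norm_mult)
  also have "\<dots> = (\<Sum>p\<in>Gam \<times> Gam. \<Sum>q\<in>{..<?J} \<times> {..<?J}. \<bar>c (p, q)\<bar> * (if y (p, q) \<in> \<int> then real ?M else 0))"
    by (subst sum.cartesian_product) (rule sum.cong, auto)
  also have "\<dots> = (\<Sum>(\<gamma>, \<gamma>')\<in>Gam \<times> Gam. \<bar>wt \<gamma>\<bar> * \<bar>wt \<gamma>'\<bar> *
      (\<Sum>(j, j')\<in>{..<?J} \<times> {..<?J}. if y ((\<gamma>, \<gamma>'), (j, j')) \<in> \<int> then real ?M * (1 / (real ?J)\<^sup>2) else 0))"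
    by (intro sum.cong refl) (auto simp: sum_distrib_left c_def abs_mult intro!: sum.cong)
  also have "\<dots> \<le> (\<Sum>(\<gamma>, \<gamma>')\<in>Gam \<times> Gam. \<bar>wt \<gamma>\<bar> * \<bar>wt \<gamma>'\<bar> *
      (if (\<gamma>, \<gamma>') \<in> close_pairs U ?\<theta> then 4 * real U else 0))"
    using inner by (intro sum_mono) (auto intro!: mult_left_mono simp del: of_nat_prod)
  also have "\<dots> = (\<Sum>p\<in>Gam \<times> Gam. if p \<in> close_pairs U ?\<theta> then (case p of (\<gamma>, \<gamma>') \<Rightarrow> 4 * real U * (\<bar>wt \<gamma>\<bar> * \<bar>wt \<gamma>'\<bar>)) else 0)"
    by (intro sum.cong refl) auto
  also have "\<dots> = (\<Sum>p\<in>close_pairs U ?\<theta>. case p of (\<gamma>, \<gamma>') \<Rightarrow> 4 * real U * (\<bar>wt \<gamma>\<bar> * \<bar>wt \<gamma>'\<bar>))"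
    using close_pairs_subset by (subst sum.inter_restrict[symmetric]) (auto intro!: sum.cong simp: Int_absorb1)
  also have "\<dots> = 4 * real U * close_weight U ?\<theta>"
    unfolding close_weight_def sum_distrib_left by (intro sum.cong refl) auto
  finally show ?thesis .
qed

end

section \<open>Riesz products on primes\<close>

lemma sinh_le_mult_cosh: "sinh x \<le> x * cosh x" if "x \<ge> 0" for x :: real
proof -
  have "0 * cosh 0 - sinh (0::real) \<le> x * cosh x - sinh x"
  proof (rule DERIV_nonneg_imp_nondecreasing[OF that])
    fix y :: real assume "0 \<le> y" "y \<le> x"
    then show "\<exists>d. ((\<lambda>x. x * cosh x - sinh x) has_real_derivative d) (at y) \<and> 0 \<le> d"
      by (intro exI[of _ "y * sinh y"]) (auto intro!: derivative_eq_intros)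
  qed
  then show ?thesis by simp
qed

lemma cosh_le_exp: "cosh x \<le> exp (x\<^sup>2 / 2)" for x :: real
proof -
  have *: "ln (cosh x) \<le> x\<^sup>2 / 2" if "x \<ge> 0" for x :: real
  proof -
    have "0\<^sup>2 / 2 - ln (cosh (0::real)) \<le> x\<^sup>2 / 2 - ln (cosh x)"
    proof (rule DERIV_nonneg_imp_nondecreasing[OF that])
      fix y :: real assume y: "0 \<le> y" "y \<le> x"
      have "sinh y / cosh y \<le> y"
        using sinh_le_mult_cosh[OF y(1)] cosh_real_pos[of y] by (simp add: field_simps)
      then show "\<exists>d. ((\<lambda>x. x\<^sup>2 / 2 - ln (cosh x)) has_real_derivative d) (at y) \<and> 0 \<le> d"
        using cosh_real_pos[of y]
        by (intro exI[of _ "y - sinh y / cosh y"]) (auto intro!: derivative_eq_intros simp: cosh_real_nonzero)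
    qed
    then show ?thesis by simp
  qed
  have "ln (cosh x) \<le> x\<^sup>2 / 2" using *[of "\<bar>x\<bar>"] by simp
  then show ?thesis using cosh_real_pos[of x] by (metis exp_le_cancel_iff exp_ln)
qed

text \<open>The left side is what one element of \<open>X\<close> contributes to the sum of squared
  Riesz coefficients weighted by 4^|supp|.\<close>

lemma cosh_sinh_le: "(cosh x)\<^sup>2 + 2 * (sinh x)\<^sup>2 \<le> (cosh x)\<^sup>2 * exp (2 * x\<^sup>2)" if "x \<ge> 0" for x :: real
proof -
  have "(sinh x)\<^sup>2 \<le> (x * cosh x)\<^sup>2"
    using sinh_le_mult_cosh[OF that] that by (intro power_mono) auto
  then have "(cosh x)\<^sup>2 + 2 * (sinh x)\<^sup>2 \<le> (cosh x)\<^sup>2 * (1 + 2 * x\<^sup>2)"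
    by (simp add: power_mult_distrib algebra_simps)
  also have "\<dots> \<le> (cosh x)\<^sup>2 * exp (2 * x\<^sup>2)"
    using exp_ge_add_one_self by (intro mult_left_mono) auto
  finally show ?thesis .
qed

text \<open>The right side is the chord of exp over [-a, a]. For a = 0 the quotient is 0 by
  convention, and y = 0 gives equality.\<close>

lemma exp_le_cosh_sinh:
  fixes a y :: real
  assumes "\<bar>y\<bar> \<le> a"
  shows "exp y \<le> cosh a + sinh a / a * y"
proof (cases "a = 0")
  case False
  then have a: "a > 0" using assms by linarith
  define t where "t = (y + a) / (2 * a)"
  have t: "0 \<le> t" "t \<le> 1" using assms a by (auto simp: t_def field_simps)
  have "exp ((1 - t) *\<^sub>R (- a) + t *\<^sub>R a) \<le> (1 - t) * exp (- a) + t * exp a"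
    by (rule convex_onD[OF exp_convex t]) auto
  moreover have "(1 - t) *\<^sub>R (- a) + t *\<^sub>R a = y" using a by (simp add: t_def field_simps)
  moreover have "(1 - t) * exp (- a) + t * exp a = cosh a + sinh a / a * y"
    using a by (simp add: t_def cosh_def sinh_def field_simps)
  ultimately show ?thesis by simp
qed (use assms in auto)

section \<open>Exponential moments over a sifted set\<close>

locale sieve_setting = dissociated X m "int U" + selberg_weight P z
  for X :: "int set" and m :: int and U :: nat and P :: "nat set" and z :: real +
  fixes J0 :: nat
  assumes U_pos: "U > 0" and z_le: "z ^ 4 \<le> real U" and J0: "J0 \<ge> 600"
    and P_large: "\<And>r. r \<in> P \<Longrightarrow> exp ((real J0)\<^sup>2) < real r"
    and P_coprime: "\<And>r. r \<in> P \<Longrightarrow> coprime (int r) m"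
begin

abbreviation frac :: "(int \<Rightarrow> int) \<Rightarrow> real" where
  "frac \<epsilon> \<equiv> of_int (vsum \<epsilon>) / real U"

definition zero :: "int \<Rightarrow> int" where
  "zero = restrict (\<lambda>_. 0) X"

text \<open>Fourier coefficients of one factor of \<open>riesz\<close> at the frequencies s * u / U.
  When c u = 0 the quotient 0 / 0 = 0 makes the factor the constant 1.\<close>

definition coeff :: "(int \<Rightarrow> complex) \<Rightarrow> int \<Rightarrow> int \<Rightarrow> complex" where
  "coeff c u s = (if s = 0 then of_real (cosh (cmod (c u)))
     else of_real (sinh (cmod (c u)) / cmod (c u)) * (if s = 1 then c u else cnj (c u)) / 2)"

definition riesz :: "(int \<Rightarrow> complex) \<Rightarrow> nat \<Rightarrow> real" where
  "riesz c n = (\<Prod>u\<in>X. cosh (cmod (c u)) + sinh (cmod (c u)) / cmod (c u) * Re (c u * e (of_int u * real n / real U)))"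

lemma zero_in_signs: "zero \<in> signs"
  by (auto simp: signs_def zero_def)

lemma exp_le_riesz: "exp (Re (\<Sum>u\<in>X. c u * e (of_int u * real n / real U))) \<le> riesz c n"
proof -
  have "exp (Re (\<Sum>u\<in>X. c u * e (of_int u * real n / real U))) = (\<Prod>u\<in>X. exp (Re (c u * e (of_int u * real n / real U))))"
    by (simp add: exp_sum finite_X)
  also have "\<dots> \<le> riesz c n"
    unfolding riesz_def
    by (intro prod_mono conjI exp_le_cosh_sinh order_trans[OF abs_Re_le_cmod]) (auto simp: norm_mult)
  finally show ?thesis .
qed

lemma riesz_expand:
  "of_real (riesz c n) = (\<Sum>\<epsilon>\<in>signs. (\<Prod>u\<in>X. coeff c u (\<epsilon> u)) * e (real n * frac \<epsilon>))"
proof -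
  let ?f = "\<lambda>u s. coeff c u s * e (real n * (of_int (s * u) / real U))"
  have "of_real (cosh (cmod (c u)) + sinh (cmod (c u)) / cmod (c u) * Re (c u * e (of_int u * real n / real U)))
      = (\<Sum>s\<in>{-1, 0, 1}. ?f u s)" for u
  proof -
    let ?w = "c u * e (of_int u * real n / real U)"
    have "complex_of_real (Re ?w) = (?w + cnj ?w) / 2" by (simp only: complex_add_cnj) simp
    moreover have "cnj ?w = cnj (c u) * e (- (of_int u * real n / real U))" by (simp add: cnj_e)
    moreover have "?f u 1 = of_real (sinh (cmod (c u)) / cmod (c u)) * ?w / 2"
      "?f u (-1) = of_real (sinh (cmod (c u)) / cmod (c u)) * (cnj (c u) * e (- (of_int u * real n / real U))) / 2"
      "?f u 0 = of_real (cosh (cmod (c u)))"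
      by (simp_all add: coeff_def mult.commute)
    ultimately show ?thesis
      by (simp only: of_real_add of_real_mult) (simp add: distrib_left add_divide_distrib)
  qed
  then have "of_real (riesz c n) = (\<Prod>u\<in>X. \<Sum>s\<in>{-1, 0, 1}. ?f u s)"
    by (simp add: riesz_def of_real_prod del: of_real_add of_real_mult)
  also have "\<dots> = (\<Sum>\<epsilon>\<in>signs. \<Prod>u\<in>X. ?f u (\<epsilon> u))"
    unfolding signs_def by (rule prod_sum_PiE) (auto simp: finite_X)
  also have "\<dots> = (\<Sum>\<epsilon>\<in>signs. (\<Prod>u\<in>X. coeff c u (\<epsilon> u)) * e (real n * frac \<epsilon>))"
    by (intro sum.cong refl)
       (simp add: prod.distrib finite_X vsum_def sum_divide_distrib sum_distrib_left flip: e_sum)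
  finally show ?thesis .
qed

text \<open>One close pair is selected and \<open>A\<close> is the set of primes in its denominator.
  An empty \<open>A\<close> means q = 1, so the integer error t with 4 |t| <= 1 vanishes, and
  dissociativity forces \<open>\<epsilon>\<close> to be zero. For the zero vector the pair of zero
  vectors is selected, which makes \<open>A\<close> empty.\<close>

lemma close_weight_cases:
  assumes \<epsilon>: "\<epsilon> \<in> signs"
  obtains "close_weight U (frac \<epsilon>) = 0"
  | A where "A \<subseteq> P" "\<epsilon> \<noteq> zero \<Longrightarrow> A \<noteq> {}" "\<epsilon> = zero \<Longrightarrow> A = {}" "near (int (\<Prod>A)) 0 \<epsilon>"
      "close_weight U (frac \<epsilon>) \<le> H * (\<Prod>r\<in>A. 3 / real r)"
proof (cases "close_pairs U (frac \<epsilon>) = {}")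
  case True
  then show ?thesis using that(1) by (simp add: close_weight_def)
next
  case False
  let ?o = "restrict (\<lambda>_. 0) P :: nat \<Rightarrow> int"
  have oG: "?o \<in> Gam" using z_gt_1 pos_P by (auto simp: Gam_def)
  have "\<exists>p\<in>close_pairs U (frac \<epsilon>). \<epsilon> = zero \<longrightarrow> p = (?o, ?o)"
  proof (cases "\<epsilon> = zero")
    case True
    then have "vsum \<epsilon> = 0" by (simp add: vsum_def zero_def)
    then have "(?o, ?o) \<in> close_pairs U (frac \<epsilon>)"
      using oG U_pos by (auto simp: close_pairs_def intro!: exI[of _ 0])
    then show ?thesis by blast
  qed (use False in auto)
  then obtain \<delta> \<delta>' where p: "(\<delta>, \<delta>') \<in> close_pairs U (frac \<epsilon>)" "\<epsilon> = zero \<longrightarrow> (\<delta>, \<delta>') = (?o, ?o)"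
    by (metis surj_pair)
  define A where "A = {r\<in>P. \<delta> r \<noteq> \<delta>' r}"
  have A: "A \<subseteq> P" by (auto simp: A_def)
  have near: "near (int (\<Prod>A)) 0 \<epsilon>"
    using close_pairs_near[OF U_pos p(1)] by (simp add: near_def A_def)
  have ne: "A \<noteq> {}" if "\<epsilon> \<noteq> zero"
  proof
    assume "A = {}"
    then obtain t where t: "4 * \<bar>t\<bar> \<le> 1" "int U dvd vsum \<epsilon> - t"
      using near by (auto simp: near_def)
    then have "t = 0" by linarith
    then have "m dvd vsum \<epsilon>" using t m_dvd_U dvd_trans by auto
    then have "\<epsilon> = zero" using vsum_zero[OF \<epsilon>] by (intro signs_eqI[OF \<epsilon> zero_in_signs]) (auto simp: zero_def)
    then show False using that by simp
  qed
  have "close_weight U (frac \<epsilon>) \<le> H * (\<Prod>r\<in>A. 3 / real r)"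
    unfolding close_weight_def A_def
    by (rule pair_sum_le[OF close_pairs_subset p(1)]) (rule close_pairs_cong[OF z_le _ p(1)])
  moreover have "A = {}" if "\<epsilon> = zero" using p(2) that by (auto simp: A_def)
  ultimately show ?thesis using that(2)[OF A ne _ near] by blast
qed

text \<open>The zero vector gives the main term. For the others, Cauchy-Schwarz with 2^|supp|
  against 2^(-|supp|) separates the coefficients from the arithmetic. In the arithmetic factor, the
  vectors assigned to one denominator q contribute at most (3^omega(q) / q)^2 * 2 q / 2^J, and
  \<open>sum_blocks_le\<close> sums this to at most J0^(-30).\<close>

lemma sum_close_le:
  fixes \<rho> :: "(int \<Rightarrow> int) \<Rightarrow> real"
  assumes \<rho>: "\<And>\<epsilon>. \<rho> \<epsilon> \<ge> 0"
  shows "(\<Sum>\<epsilon>\<in>signs. \<rho> \<epsilon> * close_weight U (frac \<epsilon>))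
    \<le> H * (\<rho> zero + sqrt (\<Sum>\<epsilon>\<in>signs. (\<rho> \<epsilon>)\<^sup>2 * 4 ^ card (supp \<epsilon>)) / real J0 ^ 15)"
proof -
  define Q where "Q = (\<lambda>\<epsilon> A. A \<subseteq> P \<and> A \<noteq> {} \<and> near (int (\<Prod>A)) 0 \<epsilon> \<and>
      close_weight U (frac \<epsilon>) \<le> H * (\<Prod>r\<in>A. 3 / real r))"
  define N where "N = {\<epsilon>\<in>signs. \<exists>A. Q \<epsilon> A}"
  \<comment> \<open>A vector may be near several denominators; it is charged to a single one, so
    that grouping by \<open>A \<epsilon>\<close> partitions \<open>N\<close>.\<close>
  define A where "A = (\<lambda>\<epsilon>. SOME A. Q \<epsilon> A)"
  have A: "Q \<epsilon> (A \<epsilon>)" if "\<epsilon> \<in> N" for \<epsilon>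
    using that someI_ex[of "Q \<epsilon>"] by (auto simp: N_def A_def)
  have H0: "H > 0" using H_ge_1 by linarith
  have finN: "finite N" by (rule finite_subset[of _ signs]) (auto simp: N_def)
  let ?B = "\<lambda>\<epsilon>. \<Prod>r\<in>A \<epsilon>. 3 / real r"
  have bound: "close_weight U (frac \<epsilon>) \<le> (if \<epsilon> = zero then H else 0) + (if \<epsilon> \<in> N then H * ?B \<epsilon> else 0)"
    if \<epsilon>: "\<epsilon> \<in> signs" for \<epsilon>
    using \<epsilon>
  proof (cases rule: close_weight_cases)
    case 1
    then show ?thesis using H0 by (auto intro!: add_nonneg_nonneg mult_nonneg_nonneg prod_nonneg)
  next
    case (2 A')
    show ?thesis
    proof (cases "\<epsilon> = zero")
      case True
      then have "close_weight U (frac \<epsilon>) \<le> H" using 2 by simp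
      then show ?thesis using True H0 by (auto intro!: add_increasing2 mult_nonneg_nonneg prod_nonneg)
    next
      case False
      then have "Q \<epsilon> A'" using 2 by (simp add: Q_def)
      then have "\<epsilon> \<in> N" using \<epsilon> by (auto simp: N_def)
      then show ?thesis using A[of \<epsilon>] False by (simp add: Q_def)
    qed
  qed
  have "(\<Sum>\<epsilon>\<in>signs. \<rho> \<epsilon> * close_weight U (frac \<epsilon>))
      \<le> (\<Sum>\<epsilon>\<in>signs. \<rho> \<epsilon> * ((if \<epsilon> = zero then H else 0) + (if \<epsilon> \<in> N then H * ?B \<epsilon> else 0)))"
    by (intro sum_mono mult_left_mono bound \<rho>)
  also have "\<dots> = (\<Sum>\<epsilon>\<in>signs. (if \<epsilon> = zero then \<rho> \<epsilon> * H else 0)) + (\<Sum>\<epsilon>\<in>signs. (if \<epsilon> \<in> N then \<rho> \<epsilon> * (H * ?B \<epsilon>) else 0))"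
    unfolding sum.distrib[symmetric] by (intro sum.cong refl) (simp add: distrib_left)
  also have "(\<Sum>\<epsilon>\<in>signs. (if \<epsilon> = zero then \<rho> \<epsilon> * H else 0)) = \<rho> zero * H"
    using zero_in_signs by (simp add: sum.delta)
  also have "(\<Sum>\<epsilon>\<in>signs. (if \<epsilon> \<in> N then \<rho> \<epsilon> * (H * ?B \<epsilon>) else 0)) = (\<Sum>\<epsilon>\<in>N. \<rho> \<epsilon> * (H * ?B \<epsilon>))"
    by (subst sum.inter_restrict[symmetric]) (auto intro!: sum.cong simp: N_def)
  also have "\<dots> = H * (\<Sum>\<epsilon>\<in>N. (\<rho> \<epsilon> * 2 ^ card (supp \<epsilon>)) * (?B \<epsilon> * (1/2) ^ card (supp \<epsilon>)))"
    unfolding sum_distrib_left by (intro sum.cong refl) (simp add: power_one_over)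
  also have "(\<Sum>\<epsilon>\<in>N. (\<rho> \<epsilon> * 2 ^ card (supp \<epsilon>)) * (?B \<epsilon> * (1/2) ^ card (supp \<epsilon>)))
      \<le> sqrt ((\<Sum>\<epsilon>\<in>N. (\<rho> \<epsilon> * 2 ^ card (supp \<epsilon>))\<^sup>2) * (\<Sum>\<epsilon>\<in>N. (?B \<epsilon> * (1/2) ^ card (supp \<epsilon>))\<^sup>2))"
    by (rule real_le_rsqrt) (rule Cauchy_Schwarz_ineq_sum)
  also have "\<dots> \<le> sqrt ((\<Sum>\<epsilon>\<in>signs. (\<rho> \<epsilon>)\<^sup>2 * 4 ^ card (supp \<epsilon>)) * (1 / real J0 ^ 30))"
  proof (intro real_sqrt_le_mono mult_mono)
    have "(2 ^ k)\<^sup>2 = (4::real) ^ k" for k by (simp add: power2_eq_square flip: power_mult_distrib)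
    then have "(\<Sum>\<epsilon>\<in>N. (\<rho> \<epsilon> * 2 ^ card (supp \<epsilon>))\<^sup>2) = (\<Sum>\<epsilon>\<in>N. (\<rho> \<epsilon>)\<^sup>2 * 4 ^ card (supp \<epsilon>))"
      by (simp add: power_mult_distrib)
    also have "\<dots> \<le> (\<Sum>\<epsilon>\<in>signs. (\<rho> \<epsilon>)\<^sup>2 * 4 ^ card (supp \<epsilon>))"
      by (rule sum_mono2) (auto simp: N_def)
    finally show "(\<Sum>\<epsilon>\<in>N. (\<rho> \<epsilon> * 2 ^ card (supp \<epsilon>))\<^sup>2) \<le> (\<Sum>\<epsilon>\<in>signs. (\<rho> \<epsilon>)\<^sup>2 * 4 ^ card (supp \<epsilon>))" .
    let ?S = "Pow P - {{}}"
    have AS: "A ` N \<subseteq> ?S" using A by (auto simp: Q_def)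
    have "(\<Sum>\<epsilon>\<in>N. (?B \<epsilon> * (1/2) ^ card (supp \<epsilon>))\<^sup>2) = (\<Sum>B\<in>?S. \<Sum>\<epsilon>\<in>{\<epsilon>\<in>N. A \<epsilon> = B}. (?B \<epsilon> * (1/2) ^ card (supp \<epsilon>))\<^sup>2)"
      by (rule sum.group[OF finN _ AS, symmetric]) (simp add: finite_P)
    also have "\<dots> \<le> (\<Sum>B\<in>?S. 2 * (\<Prod>r\<in>B. 9 / real r) / 2 ^ nat \<lfloor>sqrt (ln (real (\<Prod>B)))\<rfloor>)"
    proof (rule sum_mono)
      fix B assume B: "B \<in> ?S"
      let ?J = "nat \<lfloor>sqrt (ln (real (\<Prod>B)))\<rfloor>"
      have finB: "finite B" using B finite_P finite_subset by auto
      have J: "J0 \<le> ?J" "(real ?J)\<^sup>2 \<le> ln (real (\<Prod>B))" "ln (real (\<Prod>B)) < (real ?J + 1)\<^sup>2"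
        using sum_blocks_le(2)[OF finite_P, of J0 B] prime_P P_large J0 B by auto
      have cop: "coprime (int (\<Prod>B)) m"
        unfolding of_nat_prod using B P_coprime by (intro prod_coprime_left) auto
      have "\<Prod>B \<noteq> 1"
      proof
        assume "\<Prod>B = 1"
        then have "(real ?J)\<^sup>2 \<le> 0" using J(2) by simp
        then show False using J(1) J0 by simp
      qed
      moreover have "\<Prod>B > 0" using B by (intro prod_P_pos) auto
      ultimately have ge2: "int (\<Prod>B) \<ge> 2" by linarith
      have "(\<Sum>\<epsilon>\<in>{\<epsilon>\<in>N. A \<epsilon> = B}. (?B \<epsilon> * (1/2) ^ card (supp \<epsilon>))\<^sup>2)
          = (\<Sum>\<epsilon>\<in>{\<epsilon>\<in>N. A \<epsilon> = B}. (\<Prod>r\<in>B. 3 / real r)\<^sup>2 * (1/4) ^ card (supp \<epsilon>))"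
      proof (intro sum.cong refl)
        fix \<epsilon> assume "\<epsilon> \<in> {\<epsilon>\<in>N. A \<epsilon> = B}"
        moreover have "((1/2) ^ k)\<^sup>2 = (1/4 :: real) ^ k" for k
          by (simp add: power2_eq_square flip: power_mult_distrib)
        ultimately show "(?B \<epsilon> * (1/2) ^ card (supp \<epsilon>))\<^sup>2 = (\<Prod>r\<in>B. 3 / real r)\<^sup>2 * (1/4) ^ card (supp \<epsilon>)"
          by (auto simp only: power_mult_distrib mem_Collect_eq)
      qed
      also have "\<dots> \<le> (\<Sum>\<epsilon>\<in>{\<epsilon>\<in>signs. near (int (\<Prod>B)) 0 \<epsilon>}. (\<Prod>r\<in>B. 3 / real r)\<^sup>2 * (1/4) ^ card (supp \<epsilon>))"
        using A by (intro sum_mono2) (auto simp: N_def Q_def)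
      also have "\<dots> = (\<Prod>r\<in>B. 3 / real r)\<^sup>2 * (\<Sum>\<epsilon>\<in>{\<epsilon>\<in>signs. near (int (\<Prod>B)) 0 \<epsilon>}. (1/4) ^ card (supp \<epsilon>))"
        by (simp only: sum_distrib_left)
      also have "\<dots> \<le> (\<Prod>r\<in>B. 3 / real r)\<^sup>2 * (2 * real_of_int (int (\<Prod>B)) / 2 ^ ?J)"
        using J J0 ge2 cop by (intro mult_left_mono sum_near_quarter_le) (auto simp del: of_nat_prod)
      also have "\<dots> = 2 * ((\<Prod>r\<in>B. 3 / real r)\<^sup>2 * real (\<Prod>B)) / 2 ^ ?J" by (simp del: of_nat_prod)
      also have "(\<Prod>r\<in>B. 3 / real r)\<^sup>2 * real (\<Prod>B) = (\<Prod>r\<in>B. 9 / real r)"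
      proof -
        have "(\<Prod>r\<in>B. 3 / real r)\<^sup>2 * real (\<Prod>B) = (\<Prod>r\<in>B. (3 / real r)\<^sup>2 * real r)"
          by (simp add: prod.distrib prod_power_distrib)
        also have "\<dots> = (\<Prod>r\<in>B. 9 / real r)"
          using B pos_P by (intro prod.cong refl) (auto simp: power2_eq_square)
        finally show ?thesis .
      qed
      finally show "(\<Sum>\<epsilon>\<in>{\<epsilon>\<in>N. A \<epsilon> = B}. (?B \<epsilon> * (1/2) ^ card (supp \<epsilon>))\<^sup>2)
          \<le> 2 * (\<Prod>r\<in>B. 9 / real r) / 2 ^ ?J" .
    qed
    also have "\<dots> \<le> 1 / real J0 ^ 30"
      using prime_P P_large J0 by (intro sum_blocks_le(1) finite_P) auto
    finally show "(\<Sum>\<epsilon>\<in>N. (?B \<epsilon> * (1/2) ^ card (supp \<epsilon>))\<^sup>2) \<le> 1 / real J0 ^ 30" .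
  qed (auto intro!: sum_nonneg)
  also have "\<dots> = sqrt (\<Sum>\<epsilon>\<in>signs. (\<rho> \<epsilon>)\<^sup>2 * 4 ^ card (supp \<epsilon>)) / real J0 ^ 15"
  proof -
    have "sqrt (real J0 ^ 30) = real J0 ^ 15" by (rule real_sqrt_unique) (simp_all flip: power_mult)
    then show ?thesis by (simp add: real_sqrt_mult real_sqrt_divide)
  qed
  finally show ?thesis using H0 by (simp add: distrib_left mult.commute)
qed

text \<open>At the points of \<open>S\<close> the weight |V|^2 |fejer|^2 is at least H^2 / 2.
  Expanding the Riesz product over a full period gives a zero-frequency term of at most 4 U H
  exp(sigma / 2). The assumption \<open>small\<close> lets J0^15 absorb the factor exp(sigma) lost
  in Cauchy-Schwarz, so the other frequencies at most double this bound. Division by H^2 / 2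
  produces 16 U / H.\<close>

lemma sum_exp_le:
  fixes c :: "int \<Rightarrow> complex" and S :: "nat set"
  assumes S: "\<And>p. p \<in> S \<Longrightarrow> p \<le> U \<and> (\<forall>r\<in>P. \<not> r dvd p)"
    and small: "exp (\<Sum>u\<in>X. (cmod (c u))\<^sup>2) \<le> real J0 ^ 15"
  shows "(\<Sum>p\<in>S. exp (Re (\<Sum>u\<in>X. c u * e (of_int u * real p / real U))))
    \<le> 16 * real U / H * exp ((\<Sum>u\<in>X. (cmod (c u))\<^sup>2) / 2)"
proof -
  define \<sigma> where "\<sigma> = (\<Sum>u\<in>X. (cmod (c u))\<^sup>2)"
  define \<rho> where "\<rho> = (\<lambda>\<epsilon>. cmod (\<Prod>u\<in>X. coeff c u (\<epsilon> u)))"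
  let ?h = "\<lambda>n. Re (\<Sum>u\<in>X. c u * e (of_int u * real n / real U))"
  let ?M = "modulus U"
  have H0: "H > 0" using H_ge_1 by linarith
  have J15: "real J0 ^ 15 > 0" using J0 by simp
  have riesz_pos: "riesz c n > 0" for n using exp_le_riesz[of c n] by (meson exp_gt_zero less_le_trans)
  have UM: "U < ?M"
  proof -
    have "\<Prod>P \<ge> 1" using prod_P_pos[of P] by simp
    then have "4 * U * 1 \<le> ?M" unfolding modulus_def by (rule mult_left_mono) simp
    then show ?thesis using U_pos by simp
  qed
  have "(\<Sum>p\<in>S. exp (?h p)) * (H\<^sup>2 / 2) = (\<Sum>p\<in>S. exp (?h p) * (H\<^sup>2 * (1/2)))"
    by (simp add: sum_distrib_right)
  also have "\<dots> \<le> (\<Sum>p\<in>S. riesz c p * ((cmod (V p))\<^sup>2 * (cmod (fejer U p))\<^sup>2))"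
  proof (rule sum_mono)
    fix p assume p: "p \<in> S"
    have "cmod (V p) = H" using V_coprime[of p] S[OF p] H0 by simp
    then show "exp (?h p) * (H\<^sup>2 * (1/2)) \<le> riesz c p * ((cmod (V p))\<^sup>2 * (cmod (fejer U p))\<^sup>2)"
      using fejer_ge[of p U] S[OF p] U_pos exp_le_riesz[of c p] riesz_pos[of p]
      by (intro mult_mono) auto
  qed
  \<comment> \<open>Positivity of the Riesz product allows the sum to be extended from
    \<open>S\<close> to a full period.\<close>
  also have "\<dots> \<le> (\<Sum>p<?M. riesz c p * ((cmod (V p))\<^sup>2 * (cmod (fejer U p))\<^sup>2))"
    using S UM riesz_pos by (intro sum_mono2) (fastforce intro: less_imp_le mult_nonneg_nonneg)+
  also have "\<dots> \<le> cmod (\<Sum>p<?M. of_real (riesz c p) * ((V p * cnj (V p)) * (fejer U p * cnj (fejer U p))))"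
  proof -
    have "complex_of_real (\<Sum>p<?M. riesz c p * ((cmod (V p))\<^sup>2 * (cmod (fejer U p))\<^sup>2))
        = (\<Sum>p<?M. of_real (riesz c p) * ((V p * cnj (V p)) * (fejer U p * cnj (fejer U p))))"
      by (simp add: complex_norm_square[symmetric] del: of_real_power)
    from this[symmetric] show ?thesis by (simp only: norm_of_real abs_ge_self)
  qed
  also have "(\<Sum>p<?M. of_real (riesz c p) * ((V p * cnj (V p)) * (fejer U p * cnj (fejer U p))))
      = (\<Sum>\<epsilon>\<in>signs. (\<Prod>u\<in>X. coeff c u (\<epsilon> u)) *
          (\<Sum>p<?M. e (real p * frac \<epsilon>) * ((V p * cnj (V p)) * (fejer U p * cnj (fejer U p)))))"
    unfolding riesz_expand sum_distrib_right sum_distrib_left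
    by (subst sum.swap) (simp only: mult.assoc)
  also have "cmod \<dots> \<le> (\<Sum>\<epsilon>\<in>signs. \<rho> \<epsilon> * (4 * real U * close_weight U (frac \<epsilon>)))"
    unfolding \<rho>_def
    by (rule order_trans[OF norm_sum], rule sum_mono, simp only: norm_mult,
        intro mult_left_mono kernel_le U_pos norm_ge_zero)
  also have "\<dots> = 4 * real U * (\<Sum>\<epsilon>\<in>signs. \<rho> \<epsilon> * close_weight U (frac \<epsilon>))"
    by (simp add: sum_distrib_left mult_ac)
  also have "\<dots> \<le> 4 * real U * (H * (\<rho> zero + sqrt (\<Sum>\<epsilon>\<in>signs. (\<rho> \<epsilon>)\<^sup>2 * 4 ^ card (supp \<epsilon>)) / real J0 ^ 15))"
    by (intro mult_left_mono sum_close_le) (auto simp: \<rho>_def)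
  also have "\<dots> \<le> 4 * real U * (H * (exp (\<sigma> / 2) + exp (\<sigma> / 2)))"
  proof (intro mult_left_mono add_mono)
    let ?C = "\<Prod>u\<in>X. cosh (cmod (c u))"
    have "\<rho> zero = ?C"
    proof -
      have "(\<Prod>u\<in>X. coeff c u (zero u)) = of_real ?C"
        unfolding of_real_prod by (rule prod.cong) (auto simp: coeff_def zero_def)
      then show ?thesis by (simp add: \<rho>_def del: of_real_prod) (simp add: abs_prod)
    qed
    also have Cle: "?C \<le> (\<Prod>u\<in>X. exp ((cmod (c u))\<^sup>2 / 2))"
      by (intro prod_mono) (auto simp: cosh_le_exp cosh_real_nonneg)
    also have expC: "\<dots> = exp (\<sigma> / 2)" by (simp add: \<sigma>_def exp_sum finite_X sum_divide_distrib)
    finally show "\<rho> zero \<le> exp (\<sigma> / 2)" .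
    have C0: "?C \<ge> 0" by (auto intro!: prod_nonneg simp: cosh_real_nonneg)
    define \<tau> where "\<tau> = (\<lambda>u s. (cmod (coeff c u s))\<^sup>2 * (if s = 0 then 1 else 4))"
    have "(\<Sum>\<epsilon>\<in>signs. (\<rho> \<epsilon>)\<^sup>2 * 4 ^ card (supp \<epsilon>)) = (\<Sum>\<epsilon>\<in>signs. \<Prod>u\<in>X. \<tau> u (\<epsilon> u))"
    proof (rule sum.cong[OF refl])
      fix \<epsilon>
      have "(\<Prod>u\<in>X. if \<epsilon> u = 0 then 1 else 4 :: real) = 4 ^ card (supp \<epsilon>)"
        by (simp add: prod.If_cases finite_X supp_def Int_def Collect_neg_eq[symmetric])
      then show "(\<rho> \<epsilon>)\<^sup>2 * 4 ^ card (supp \<epsilon>) = (\<Prod>u\<in>X. \<tau> u (\<epsilon> u))"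
        by (simp add: \<rho>_def \<tau>_def prod.distrib prod_norm[symmetric] prod_power_distrib)
    qed
    also have "\<dots> = (\<Prod>u\<in>X. \<Sum>s\<in>{-1, 0, 1}. \<tau> u s)"
      unfolding signs_def by (rule prod_sum_PiE[symmetric]) (auto simp: finite_X)
    also have "\<dots> \<le> (\<Prod>u\<in>X. (cosh (cmod (c u)))\<^sup>2 * exp (2 * (cmod (c u))\<^sup>2))"
    proof (intro prod_mono conjI)
      fix u
      have "cmod (coeff c u s) = (if s = 0 then cosh (cmod (c u)) else sinh (cmod (c u)) / 2)" for s
      proof (cases "c u = 0")
        case False
        then show ?thesis
          by (simp add: coeff_def norm_mult norm_divide abs_mult)
      qed (simp add: coeff_def)
      then have "(\<Sum>s\<in>{-1, 0, 1}. \<tau> u s) = (cosh (cmod (c u)))\<^sup>2 + 2 * (sinh (cmod (c u)))\<^sup>2"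
        by (simp add: \<tau>_def power_divide)
      then show "(\<Sum>s\<in>{-1, 0, 1}. \<tau> u s) \<le> (cosh (cmod (c u)))\<^sup>2 * exp (2 * (cmod (c u))\<^sup>2)"
        by (simp add: cosh_sinh_le)
    qed (auto intro!: sum_nonneg simp: \<tau>_def)
    also have "\<dots> = (?C * exp \<sigma>)\<^sup>2"
    proof -
      have "(\<Prod>u\<in>X. exp (2 * (cmod (c u))\<^sup>2)) = (exp \<sigma>)\<^sup>2"
        by (simp add: \<sigma>_def finite_X flip: exp_sum exp_double sum_distrib_left)
      then show ?thesis by (simp add: prod.distrib power_mult_distrib prod_power_distrib)
    qed
    finally have "sqrt (\<Sum>\<epsilon>\<in>signs. (\<rho> \<epsilon>)\<^sup>2 * 4 ^ card (supp \<epsilon>)) \<le> ?C * exp \<sigma>"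
      using C0 by (intro real_le_lsqrt) auto
    also have "\<dots> \<le> exp (\<sigma> / 2) * real J0 ^ 15"
      using Cle expC small C0 by (intro mult_mono) (auto simp: \<sigma>_def)
    finally show "sqrt (\<Sum>\<epsilon>\<in>signs. (\<rho> \<epsilon>)\<^sup>2 * 4 ^ card (supp \<epsilon>)) / real J0 ^ 15 \<le> exp (\<sigma> / 2)"
      using J15 by (simp add: pos_divide_le_eq)
  qed (use H0 in auto)
  finally have "(\<Sum>p\<in>S. exp (?h p)) * (H\<^sup>2 / 2) \<le> (16 * real U / H * exp (\<sigma> / 2)) * (H\<^sup>2 / 2)"
    using H0 by (simp add: power2_eq_square)
  then have "(\<Sum>p\<in>S. exp (?h p)) \<le> 16 * real U / H * exp (\<sigma> / 2)"
    by (rule mult_right_le_imp_le) (use H0 in simp)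
  then show ?thesis unfolding \<sigma>_def .
qed

end

section \<open>The large sieve inequality\<close>

lemma exp_1_bounds: "2.7 \<le> exp (1::real)" "exp (1::real) \<le> 2.72"
proof -
  have "5837465777 / 2147483648 - exp 1 \<le> inverse (2 ^ 32 :: real)"
    using e_approx_32 by (simp only: abs_le_iff) linarith
  moreover have "inverse (2 ^ 32 :: real) \<le> 5837465777 / 2147483648 - 2.7" by simp
  ultimately show "2.7 \<le> exp (1::real)" by linarith
qed (use e_less_272 in simp)

lemma ln_4_le: "ln (4::real) \<le> 25 / 18"
proof -
  have "ln (4::real) = ln (2\<^sup>2)" by simp
  also have "\<dots> = 2 * ln 2" by (simp only: ln_realpow)
  finally show ?thesis using ln2_le_25_over_36 by simp
qed

text \<open>Beyond A, with x = |y| / A > 1, one has x^2 <= exp(2 (x - 1)) <= exp(A (x - 1)) =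
  exp(|y| - A); this is where A >= 2 enters.\<close>

lemma square_le_exp:
  fixes y A :: real
  assumes "A \<ge> 2"
  shows "y\<^sup>2 \<le> A\<^sup>2 * (1 + exp (\<bar>y\<bar> - A))"
proof (cases "\<bar>y\<bar> \<le> A")
  case True
  then have "\<bar>y\<bar>\<^sup>2 \<le> A\<^sup>2" by (intro power_mono) auto
  then show ?thesis by (simp add: distrib_left add_increasing2)
next
  case False
  define x where "x = \<bar>y\<bar> / A"
  have x: "x > 1" "\<bar>y\<bar> = A * x" using False assms by (auto simp: x_def)
  have "x\<^sup>2 \<le> (exp (x - 1))\<^sup>2"
    using exp_ge_add_one_self[of "x - 1"] x by (intro power_mono) auto
  also have "\<dots> = exp (2 * (x - 1))" by (simp flip: exp_double)
  also have "\<dots> \<le> exp (A * (x - 1))" using x assms mult_right_mono[of 2 A "x - 1"] by simp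
  also have "\<dots> = exp (\<bar>y\<bar> - A)" using x by (simp add: right_diff_distrib)
  finally have "A\<^sup>2 * x\<^sup>2 \<le> A\<^sup>2 * (1 + exp (\<bar>y\<bar> - A))"
    by (intro mult_left_mono) auto
  moreover have "A\<^sup>2 * x\<^sup>2 = y\<^sup>2" using x by (metis power2_abs power_mult_distrib)
  ultimately show ?thesis by simp
qed

text \<open>The condition on B makes the exponential part at most exp(-1) times the count of
  \<open>S\<close>, and 1 + exp(-1) <= 7/5.\<close>

lemma sum_square_le_of_exp:
  fixes h :: "'a \<Rightarrow> real"
  assumes A: "A \<ge> 2"
    and 1: "(\<Sum>p\<in>S. exp (h p)) \<le> B" and 2: "(\<Sum>p\<in>S. exp (- h p)) \<le> B"
    and B: "2 * B \<le> exp (A - 1) * real (card S)"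
  shows "(\<Sum>p\<in>S. (h p)\<^sup>2) \<le> 7 / 5 * A\<^sup>2 * real (card S)"
proof -
  have "(\<Sum>p\<in>S. (h p)\<^sup>2) \<le> (\<Sum>p\<in>S. A\<^sup>2 * (1 + exp (- A) * (exp (h p) + exp (- h p))))"
  proof (rule sum_mono)
    fix p
    have "exp \<bar>h p\<bar> \<le> exp (h p) + exp (- h p)" by (simp add: abs_if)
    then have "exp (- A) * exp \<bar>h p\<bar> \<le> exp (- A) * (exp (h p) + exp (- h p))" by (rule mult_left_mono) simp
    moreover have "exp (\<bar>h p\<bar> - A) = exp (- A) * exp \<bar>h p\<bar>" by (simp flip: exp_add)
    ultimately have "A\<^sup>2 * (1 + exp (\<bar>h p\<bar> - A)) \<le> A\<^sup>2 * (1 + exp (- A) * (exp (h p) + exp (- h p)))"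
      by (intro mult_left_mono add_left_mono) auto
    then show "(h p)\<^sup>2 \<le> A\<^sup>2 * (1 + exp (- A) * (exp (h p) + exp (- h p)))"
      using square_le_exp[OF A, of "h p"] by linarith
  qed
  also have "\<dots> = A\<^sup>2 * (real (card S) + exp (- A) * ((\<Sum>p\<in>S. exp (h p)) + (\<Sum>p\<in>S. exp (- h p))))"
    by (simp add: sum_distrib_left[symmetric] sum.distrib)
  also have "\<dots> \<le> A\<^sup>2 * (real (card S) + exp (- A) * (exp (A - 1) * real (card S)))"
    using 1 2 B by (intro mult_left_mono add_left_mono) auto
  also have "exp (- A) * (exp (A - 1) * real (card S)) = exp (-1) * real (card S)"
    by (simp flip: exp_add mult.assoc)
  also have "A\<^sup>2 * (real (card S) + exp (-1) * real (card S)) \<le> A\<^sup>2 * (real (card S) + 2 / 5 * real (card S))"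
  proof (intro mult_left_mono add_left_mono mult_right_mono)
    show "exp (-1) \<le> (2/5 :: real)"
      using exp_1_bounds by (simp add: exp_minus field_simps)
  qed auto
  finally show ?thesis by (simp add: algebra_simps)
qed

text \<open>Take c u to be the conjugate of the inner sum over p. If Q is the left side,
  Cauchy-Schwarz and the hypothesis give Q^2 <= |f|^2 * K * Q, with |f|^2 the sum of squares over
  \<open>S\<close>, and a factor Q cancels.\<close>

lemma bilinear_duality:
  fixes \<psi> :: "'a \<Rightarrow> 'b \<Rightarrow> complex" and f :: "'b \<Rightarrow> complex"
  assumes K: "\<And>c. (\<Sum>p\<in>S. (cmod (\<Sum>u\<in>X. c u * \<psi> u p))\<^sup>2) \<le> K * (\<Sum>u\<in>X. (cmod (c u))\<^sup>2)"
    and K0: "K \<ge> 0"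
  shows "(\<Sum>u\<in>X. (cmod (\<Sum>p\<in>S. f p * \<psi> u p))\<^sup>2) \<le> K * (\<Sum>p\<in>S. (cmod (f p))\<^sup>2)"
proof -
  define T where "T = (\<lambda>u. \<Sum>p\<in>S. f p * \<psi> u p)"
  define Q where "Q = (\<Sum>u\<in>X. (cmod (T u))\<^sup>2)"
  define g where "g = (\<lambda>p. \<Sum>u\<in>X. cnj (T u) * \<psi> u p)"
  have Q0: "Q \<ge> 0" by (auto simp: Q_def intro!: sum_nonneg)
  have "complex_of_real Q = (\<Sum>u\<in>X. cnj (T u) * T u)"
    by (simp add: Q_def complex_norm_square mult.commute del: of_real_power)
  also have "\<dots> = (\<Sum>u\<in>X. \<Sum>p\<in>S. f p * (cnj (T u) * \<psi> u p))"
    by (subst (2) T_def) (simp add: sum_distrib_left mult_ac)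
  also have "\<dots> = (\<Sum>p\<in>S. f p * g p)"
    by (subst sum.swap) (simp add: g_def sum_distrib_left)
  finally have "Q = cmod (\<Sum>p\<in>S. f p * g p)"
    using Q0 by (metis abs_of_nonneg norm_of_real)
  also have "\<dots> \<le> (\<Sum>p\<in>S. cmod (f p) * cmod (g p))"
    by (rule order_trans[OF norm_sum]) (simp add: norm_mult)
  finally have "Q\<^sup>2 \<le> (\<Sum>p\<in>S. cmod (f p) * cmod (g p))\<^sup>2" using Q0 by (intro power_mono) auto
  also have "\<dots> \<le> (\<Sum>p\<in>S. (cmod (f p))\<^sup>2) * (\<Sum>p\<in>S. (cmod (g p))\<^sup>2)" by (rule Cauchy_Schwarz_ineq_sum)
  also have "\<dots> \<le> (\<Sum>p\<in>S. (cmod (f p))\<^sup>2) * (K * Q)"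
    using K[of "\<lambda>u. cnj (T u)"] by (intro mult_left_mono) (auto simp: g_def Q_def intro!: sum_nonneg)
  finally have "Q * Q \<le> (K * (\<Sum>p\<in>S. (cmod (f p))\<^sup>2)) * Q" by (simp add: power2_eq_square mult_ac)
  moreover have "0 \<le> K * (\<Sum>p\<in>S. (cmod (f p))\<^sup>2)" using K0 by (auto intro!: mult_nonneg_nonneg sum_nonneg)
  ultimately have "Q \<le> K * (\<Sum>p\<in>S. (cmod (f p))\<^sup>2)"
    using Q0 by (cases "Q = 0") auto
  then show ?thesis by (simp add: Q_def T_def)
qed

context sieve_setting
begin

text \<open>Both sides are quadratic in c, so c may be rescaled to squared length sigma. A larger
  sigma gains 1 / sigma in the rescaling but raises exp(sigma / 2) and hence A. The multipliers s
  and -i s give real and imaginary parts, whence 2 * 7/5 = 14/5.\<close>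

lemma mean_square_le:
  fixes c :: "int \<Rightarrow> complex" and S :: "nat set" and \<sigma> A :: real
  defines "g \<equiv> \<lambda>p. \<Sum>u\<in>X. c u * e (of_int u * real p / real U)"
  assumes S: "\<And>p. p \<in> S \<Longrightarrow> p \<le> U \<and> (\<forall>r\<in>P. \<not> r dvd p)"
    and \<sigma>: "\<sigma> > 0" "exp \<sigma> \<le> real J0 ^ 15" and A: "A \<ge> 2"
    and A_large: "32 * real U / H * exp (\<sigma> / 2) \<le> exp (A - 1) * real (card S)"
  shows "(\<Sum>p\<in>S. (cmod (g p))\<^sup>2) \<le> 14 / 5 * A\<^sup>2 / \<sigma> * real (card S) * (\<Sum>u\<in>X. (cmod (c u))\<^sup>2)"
proof -
  define \<nu> where "\<nu> = (\<Sum>u\<in>X. (cmod (c u))\<^sup>2)"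
  have \<nu>0: "\<nu> \<ge> 0" by (auto simp: \<nu>_def intro!: sum_nonneg)
  show ?thesis
  proof (cases "\<nu> = 0")
    case True
    then have "c u = 0" if "u \<in> X" for u
      using that finite_X by (auto simp: \<nu>_def sum_nonneg_eq_0_iff)
    then show ?thesis by (simp add: g_def)
  next
    case False
    then have \<nu>: "\<nu> > 0" using \<nu>0 by simp
    have re: "(\<Sum>p\<in>S. (Re (w * g p))\<^sup>2) \<le> 7 / 5 * A\<^sup>2 * real (card S)" if w: "(cmod w)\<^sup>2 = \<sigma> / \<nu>" for w
    proof -
      have *: "(\<Sum>p\<in>S. exp (Re (w' * g p))) \<le> 16 * real U / H * exp (\<sigma> / 2)" if w': "(cmod w')\<^sup>2 = \<sigma> / \<nu>" for w'
      proof -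
        have s: "(\<Sum>u\<in>X. (cmod (w' * c u))\<^sup>2) = \<sigma>"
        proof -
          have "(\<Sum>u\<in>X. (cmod (w' * c u))\<^sup>2) = (cmod w')\<^sup>2 * \<nu>"
            by (simp only: norm_mult power_mult_distrib \<nu>_def sum_distrib_left)
          then show ?thesis using w' \<nu> by simp
        qed
        have "(\<Sum>p\<in>S. exp (Re (\<Sum>u\<in>X. (w' * c u) * e (of_int u * real p / real U))))
            \<le> 16 * real U / H * exp ((\<Sum>u\<in>X. (cmod (w' * c u))\<^sup>2) / 2)"
          by (rule sum_exp_le[OF S]) (use \<sigma> s in auto)
        then show ?thesis unfolding s by (simp only: g_def sum_distrib_left mult.assoc)
      qed
      show ?thesis
      proof (rule sum_square_le_of_exp[OF A *[OF w]])
        show "(\<Sum>p\<in>S. exp (- Re (w * g p))) \<le> 16 * real U / H * exp (\<sigma> / 2)"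
          using *[of "- w"] w by simp
        show "2 * (16 * real U / H * exp (\<sigma> / 2)) \<le> exp (A - 1) * real (card S)"
          using A_large by simp
      qed
    qed
    define s where "s = sqrt (\<sigma> / \<nu>)"
    have s2: "s\<^sup>2 = \<sigma> / \<nu>" using \<sigma> \<nu> by (simp add: s_def)
    have "\<sigma> / \<nu> * (\<Sum>p\<in>S. (cmod (g p))\<^sup>2) = (\<Sum>p\<in>S. (Re (of_real s * g p))\<^sup>2 + (Re ((- \<i> * of_real s) * g p))\<^sup>2)"
      unfolding sum_distrib_left by (intro sum.cong refl) (simp add: cmod_power2 power_mult_distrib s2 distrib_left)
    also have "\<dots> \<le> 7 / 5 * A\<^sup>2 * real (card S) + 7 / 5 * A\<^sup>2 * real (card S)"
      unfolding sum.distrib by (intro add_mono re) (simp_all add: norm_mult s2)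
    finally have "\<sigma> * (\<Sum>p\<in>S. (cmod (g p))\<^sup>2) \<le> 14 / 5 * A\<^sup>2 * real (card S) * \<nu>"
      using \<nu> by (simp add: field_simps)
    then show ?thesis using \<sigma> by (simp add: \<nu>_def[symmetric] field_simps)
  qed
qed

end

section \<open>Trivial bounds, choice of parameters and conclusion\<close>

lemma card_dissociated_le:
  assumes fin: "finite X" and d: "distinct_subset_sums_mod X m" and m: "m > 0"
  shows "2 ^ card X \<le> m"
proof -
  have "inj_on (\<lambda>A. \<Sum>A mod m) (Pow X)"
    using d by (intro inj_onI) (auto simp: distinct_subset_sums_mod_def Cong.cong_def)
  moreover have "(\<lambda>A. \<Sum>A mod m) ` Pow X \<subseteq> {0..<m}" using m by auto
  ultimately have "card (Pow X) \<le> card {0..<m}" by (rule card_inj_on_le) simp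
  then have "2 ^ card X \<le> nat m" by (simp add: card_Pow fin)
  then have "int (2 ^ card X) \<le> int (nat m)" by (rule of_nat_mono)
  then show ?thesis using m by simp
qed

lemma mean_square_le_card_mult:
  fixes X :: "int set" and S :: "nat set"
  shows "(\<Sum>p\<in>S. (cmod (\<Sum>u\<in>X. c u * e (y u p)))\<^sup>2) \<le> real (card S) * real (card X) * (\<Sum>u\<in>X. (cmod (c u))\<^sup>2)"
proof -
  have "(\<Sum>p\<in>S. (cmod (\<Sum>u\<in>X. c u * e (y u p)))\<^sup>2) \<le> (\<Sum>p\<in>S. real (card X) * (\<Sum>u\<in>X. (cmod (c u))\<^sup>2))"
  proof (rule sum_mono)
    fix p
    have "cmod (\<Sum>u\<in>X. c u * e (y u p)) \<le> (\<Sum>u\<in>X. 1 * cmod (c u))"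
      by (rule order_trans[OF norm_sum]) (simp add: norm_mult)
    then have "(cmod (\<Sum>u\<in>X. c u * e (y u p)))\<^sup>2 \<le> (\<Sum>u\<in>X. 1 * cmod (c u))\<^sup>2" by (intro power_mono) auto
    also have "\<dots> \<le> (\<Sum>u\<in>X. 1\<^sup>2) * (\<Sum>u\<in>X. (cmod (c u))\<^sup>2)" by (rule Cauchy_Schwarz_ineq_sum)
    finally show "(cmod (\<Sum>u\<in>X. c u * e (y u p)))\<^sup>2 \<le> real (card X) * (\<Sum>u\<in>X. (cmod (c u))\<^sup>2)" by simp
  qed
  then show ?thesis by (simp add: mult.assoc)
qed

lemma mean_square_primes_le:
  fixes N :: real and U m :: nat and X :: "int set" and S :: "nat set" and c :: "int \<Rightarrow> complex"
  assumes N1: "N > 1" and N: "ln N \<ge> 35" and U: "real U \<ge> N" and m: "prime m" "m dvd U" "N powr (1/4) \<le> real m"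
    and fin: "finite X" and dist: "distinct_subset_sums_mod X (int m)"
    and S: "S \<noteq> {}" "S \<subseteq> {p. prime p \<and> N powr (1/4) \<le> real p \<and> real p \<le> N}"
  defines "L \<equiv> ln (8 * N / (real (card S) * ln N))"
  shows "(\<Sum>p\<in>S. (cmod (\<Sum>u\<in>X. c u * e (of_int u * real p / real U)))\<^sup>2)
    \<le> 30 * real (card S) * exp (real U / N) * L * (\<Sum>u\<in>X. (cmod (c u))\<^sup>2)"
proof -
  have N0: "N > 0" using N1 by simp
  have lnN0: "ln N > 0" using N by simp
  have finS: "finite S"
    by (rule finite_subset[OF _ finite_atMost[of "nat \<lfloor>N\<rfloor>"]]) (use S in \<open>auto simp: le_nat_floor\<close>)
  have S0: "real (card S) > 0" using S finS by (simp add: card_gt_0_iff)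
  define E where "E = 8 * N / (real (card S) * ln N)"
  have E0: "E > 0" using N0 S0 lnN0 by (simp add: E_def)
  have expL: "exp L = E" using E0 by (simp add: L_def E_def)
  \<comment> \<open>For ln N >= 35 the primes up to N^(4/5) cost at most N / 24, so card S * ln N <=
    (1/24 + 125/72) N = 16/9 N, which makes E at least 4.5.\<close>
  have E: "E \<ge> 4.49"
  proof -
    define y where "y = ln N / 5"
    have y: "y \<ge> 7" using N by (simp add: y_def)
    have "(2.7::real) ^ 7 \<le> exp 1 ^ 7" using exp_1_bounds by (intro power_mono) auto
    then have e7: "1046 \<le> exp (7::real)" by (simp flip: exp_of_nat_mult add: power_divide)
    have "120 * y \<le> 1046 * (1 + (y - 7))" using y by simp
    also have "\<dots> \<le> exp 7 * exp (y - 7)" using e7 y exp_ge_add_one_self[of "y - 7"] by (intro mult_mono) auto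
    also have "\<dots> = exp y" by (simp flip: exp_add)
    finally have "ln N * 24 \<le> N powr (1/5)" using N0 by (simp add: y_def powr_def)
    then have "N powr (4/5) * ln N \<le> N powr (4/5) * (N powr (1/5) / 24)" by (intro mult_left_mono) auto
    also have "\<dots> = N / 24" using N0 by (simp flip: powr_add)
    finally have a: "N powr (4/5) * ln N \<le> N / 24" .
    have "real (card S) * ln N \<le> N powr (4/5) * ln N + N * ln 4 / (4/5)"
      using N1 S by (intro card_primes_le) auto
    also have "\<dots> \<le> N / 24 + N * (25 / 18) / (4/5)"
      using a ln_4_le N0 by (intro add_mono divide_right_mono mult_left_mono) auto
    also have "\<dots> \<le> 8 * N / 4.49" using N0 by simp
    finally show ?thesis using S0 lnN0 N0 unfolding E_def by (simp add: field_simps)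
  qed
  have L1: "L \<ge> 1"
  proof -
    have "exp 1 \<le> exp L" using exp_1_bounds E expL by linarith
    then show ?thesis by simp
  qed
  define \<rho> where "\<rho> = real U / N"
  have \<rho>1: "\<rho> \<ge> 1" using U N0 by (simp add: \<rho>_def)
  \<comment> \<open>Since E^4 >= 406, the factor 3/2 brings \<open>J0\<close> above the threshold
    600.\<close>
  define J0 where "J0 = nat \<lceil>3/2 * E ^ 4\<rceil>"
  have E4: "E ^ 4 \<ge> 406"
  proof -
    have "(4.49::real) ^ 4 \<le> E ^ 4" using E by (intro power_mono) auto
    then show ?thesis by (simp add: power_divide)
  qed
  have J0_bounds: "real J0 \<ge> 3/2 * E ^ 4" "real J0 \<le> 3/2 * E ^ 4 + 1"
    unfolding J0_def using E4 by linarith+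
  then have J600: "J0 \<ge> 600" using E4 by linarith
  define Y where "Y = exp ((real J0)\<^sup>2)"
  define z where "z = N powr (1/4)"
  \<comment> \<open>All r in \<open>P\<close> are below N^(1/4), hence different from m and from
    every prime in \<open>S\<close>. If exp(J0^2) >= z the set is empty and H = 1; the argument
    covers this case as well.\<close>
  define P where "P = {r. prime r \<and> Y < real r \<and> real r < z}"
  have Y4: "Y \<ge> 4"
  proof -
    have "(600::real)\<^sup>2 \<le> (real J0)\<^sup>2" using J600 by (intro power_mono) auto
    then have "3 \<le> (real J0)\<^sup>2" by simp
    then show ?thesis using exp_ge_add_one_self[of "(real J0)\<^sup>2"] unfolding Y_def by linarith
  qed
  have z1: "z > 1" using N1 by (simp add: z_def gr_one_powr)
  have z4: "z ^ 4 = N" using N0 by (simp add: z_def powr_power)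
  have "P \<subseteq> {..nat \<lfloor>z\<rfloor>}" by (auto simp: P_def le_nat_floor)
  then have finP: "finite P" by (rule finite_subset) simp
  have U0: "U > 0" using U N0 by (intro Nat.gr0I) simp
  interpret sieve_setting X "int m" U P z J0
  proof
    show "coprime (int r) (int m)" if "r \<in> P" for r
    proof -
      have "r \<noteq> m" using that m by (auto simp: P_def z_def)
      then show ?thesis using that m by (simp add: P_def primes_coprime)
    qed
  qed (use fin dist m finP z1 z4 U U0 J600 in \<open>auto simp: P_def Y_def\<close>)
  have H0: "H > 0" using H_ge_1 by linarith
  have "ln z \<le> H * (2 * (exp 2 * (1 + ln Y)))"
    unfolding H_def by (rule ln_le_sum_prod_inverse[OF Y4 z1 finP]) (auto simp: P_def)
  moreover have "ln z = ln N / 4" using N0 by (simp add: z_def ln_powr)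
  ultimately have H: "ln N \<le> H * (8 * exp 2 * (1 + (real J0)\<^sup>2))" by (simp add: Y_def)
  have SU: "p \<le> U \<and> (\<forall>r\<in>P. \<not> r dvd p)" if p: "p \<in> S" for p
  proof
    have "real p \<le> real U" using p S U by force
    then show "p \<le> U" by simp
    show "\<forall>r\<in>P. \<not> r dvd p"
    proof (intro ballI notI)
      fix r assume r: "r \<in> P" "r dvd p"
      then have "r = p" using p S by (auto simp: P_def primes_dvd_imp_eq)
      then show False using r p S by (auto simp: P_def z_def)
    qed
  qed
  \<comment> \<open>In units of L, the condition \<open>s2\<close> asks A to reach 1 + 8 + 5 + sigma
    / 2: one E from N / (card S * ln N), E^8 from 1 + J0^2, E^5 for the numerical constants, and
    exp(sigma / 2). The quotient (14 + s/2)^2 / s is least at s = 28, and then A is 28 as well. The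
    term ln rho in A accounts for U / N.\<close>
  define \<sigma> where "\<sigma> = 28 * L"
  define A where "A = 28 * L + ln \<rho>"
  have \<sigma>0: "\<sigma> > 0" using L1 by (simp add: \<sigma>_def)
  have A2: "A \<ge> 2" using L1 \<rho>1 ln_ge_zero[of \<rho>] unfolding A_def by linarith
  have expk: "exp (real k * L) = E ^ k" for k by (simp add: exp_of_nat_mult expL)
  have s1: "exp \<sigma> \<le> real J0 ^ 15"
  proof -
    have "exp \<sigma> = E ^ 28" using expk[of 28] by (simp add: \<sigma>_def)
    also have "\<dots> \<le> E ^ 60" using E by (intro power_increasing) auto
    also have "\<dots> = (E ^ 4) ^ 15" by (simp flip: power_mult)
    also have "\<dots> \<le> real J0 ^ 15"
    proof (rule power_mono)
      show "E ^ 4 \<le> real J0" using J0_bounds(1) E4 by linarith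
    qed (use E4 in linarith)
    finally show ?thesis .
  qed
  have s2: "32 * real U / H * exp (\<sigma> / 2) \<le> exp (A - 1) * real (card S)"
  proof -
    have "real U = \<rho> * (E * (real (card S) * ln N) / 8)"
      using N0 S0 lnN0 by (simp add: \<rho>_def E_def)
    also have "\<dots> \<le> \<rho> * (E * (real (card S) * (H * (8 * exp 2 * (1 + (real J0)\<^sup>2)))) / 8)"
      using H \<rho>1 E0 S0 by (intro mult_left_mono divide_right_mono) auto
    also have "\<dots> = H * (\<rho> * E * real (card S) * exp 2 * (1 + (real J0)\<^sup>2))" by simp
    finally have "real U / H \<le> \<rho> * E * real (card S) * exp 2 * (1 + (real J0)\<^sup>2)"
      using H0 by (simp add: pos_divide_le_eq mult.commute)
    also have "\<dots> \<le> \<rho> * E * real (card S) * exp 2 * (57 / 25 * E ^ 8)"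
    proof (intro mult_left_mono)
      have "(real J0)\<^sup>2 \<le> (3/2 * E ^ 4 + 1)\<^sup>2" using J0_bounds by (intro power_mono) auto
      also have "\<dots> = 9/4 * E ^ 8 + 3 * E ^ 4 + 1" by (simp add: power2_sum power_mult_distrib power_divide flip: power_mult)
      also have "\<dots> + 1 \<le> 57 / 25 * E ^ 8"
      proof -
        have "E ^ 8 = E ^ 4 * E ^ 4" by (simp flip: power_add)
        moreover have "406 * E ^ 4 \<le> E ^ 4 * E ^ 4" using E4 by (intro mult_right_mono) auto
        ultimately show ?thesis using E4 by linarith
      qed
      finally show "1 + (real J0)\<^sup>2 \<le> 57 / 25 * E ^ 8" by simp
    qed (use \<rho>1 E0 in auto)
    finally have "real U / H \<le> \<rho> * real (card S) * exp 2 * (57 / 25) * E ^ 9"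
      by (simp add: mult_ac eval_nat_numeral)
    then have "32 * (real U / H) * E ^ 14 \<le> 32 * (\<rho> * real (card S) * exp 2 * (57 / 25) * E ^ 9) * E ^ 14"
      using E0 by (intro mult_left_mono mult_right_mono) auto
    also have "\<dots> = \<rho> * real (card S) * (32 * (57 / 25) * exp 2) * E ^ 23"
      by (simp add: power_add[symmetric] mult_ac)
    \<comment> \<open>The constants amount to 32 * 2.28 * e^3, about 1466, against 4.49^5, about
      1825.\<close>
    also have "\<dots> \<le> \<rho> * real (card S) * (exp (- 1) * E ^ 5) * E ^ 23"
    proof (intro mult_left_mono mult_right_mono)
      have "32 * (57 / 25) * exp 2 * exp 1 = 32 * (57 / 25) * exp (1::real) ^ 3"
        by (simp flip: exp_add exp_of_nat_mult)
      also have "\<dots> \<le> 32 * (57 / 25) * (2.72) ^ 3" using exp_1_bounds by (intro mult_left_mono power_mono) auto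
      also have "\<dots> \<le> (4.49) ^ 5" by (simp add: power_divide)
      also have "\<dots> \<le> E ^ 5" using E by (intro power_mono) auto
      finally show "32 * (57 / 25) * exp 2 \<le> exp (- 1) * E ^ 5"
        by (simp add: exp_minus field_simps)
    qed (use \<rho>1 E0 in auto)
    also have "\<dots> = exp (A - 1) * real (card S)"
    proof -
      have "exp (A - 1) = exp (real 28 * L) * exp (ln \<rho>) * exp (- 1)"
        unfolding exp_add[symmetric] by (simp add: A_def)
      also have "\<dots> = E ^ 28 * \<rho> * exp (- 1)" unfolding expk using \<rho>1 by simp
      also have "E ^ 28 = E ^ 5 * E ^ 23" by (simp flip: power_add)
      finally show ?thesis by (simp add: mult_ac)
    qed
    also have "32 * (real U / H) * E ^ 14 = 32 * real U / H * exp (\<sigma> / 2)"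
      using expk[of 14] by (simp add: \<sigma>_def)
    finally show ?thesis .
  qed
  have "(\<Sum>p\<in>S. (cmod (\<Sum>u\<in>X. c u * e (of_int u * real p / real U)))\<^sup>2)
      \<le> 14 / 5 * A\<^sup>2 / \<sigma> * real (card S) * (\<Sum>u\<in>X. (cmod (c u))\<^sup>2)"
    by (rule mean_square_le[OF SU \<sigma>0 s1 A2 s2])
  \<comment> \<open>From ln rho <= rho - 1 and L >= 1 one gets A^2 / sigma <= 28 L exp(rho - 1).
    Then 14/5 * 28 = 78.4 is below 30 * 2.7 = 81 <= 30 e, and the e restores exp rho.\<close>
  also have "\<dots> \<le> (30 * exp \<rho> * L) * real (card S) * (\<Sum>u\<in>X. (cmod (c u))\<^sup>2)"
  proof (intro mult_right_mono)
    have "ln \<rho> \<le> \<rho> - 1" using \<rho>1 by (intro ln_le_minus_one) auto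
    then have "A \<le> 28 * L * (1 + (\<rho> - 1) / 2)"
      using L1 \<rho>1 mult_right_mono[of 1 L "\<rho> - 1"] unfolding A_def by (simp add: algebra_simps)
    also have "\<dots> \<le> 28 * L * exp ((\<rho> - 1) / 2)" using L1 exp_ge_add_one_self by (intro mult_left_mono) auto
    finally have "A\<^sup>2 \<le> (28 * L * exp ((\<rho> - 1) / 2))\<^sup>2" using A2 by (intro power_mono) auto
    also have "\<dots> = (28 * L) * (28 * L) * exp (\<rho> - 1)"
    proof -
      have "(exp ((\<rho> - 1) / 2))\<^sup>2 = exp (\<rho> - 1)" by (simp flip: exp_double)
      then show ?thesis by (simp add: power_mult_distrib power2_eq_square)
    qed
    finally have "14 / 5 * A\<^sup>2 / \<sigma> \<le> 14 / 5 * ((28 * L) * (28 * L) * exp (\<rho> - 1)) / (28 * L)"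
      using L1 unfolding \<sigma>_def by (intro divide_right_mono mult_left_mono) auto
    also have "\<dots> = 392 / 5 * exp (\<rho> - 1) * L" using L1 by simp
    also have "\<dots> \<le> 30 * exp 1 * exp (\<rho> - 1) * L"
      using exp_1_bounds L1 by (intro mult_right_mono) auto
    also have "\<dots> = 30 * exp \<rho> * L" by (simp flip: exp_add)
    finally show "14 / 5 * A\<^sup>2 / \<sigma> \<le> 30 * exp \<rho> * L" .
  qed (auto intro!: sum_nonneg)
  finally show ?thesis by (simp add: \<rho>_def mult_ac)
qed

theorem corollary1p3:
  fixes N :: real and U U\<^sub>1 :: nat and \<U> :: "int set"
    and S :: "nat set" and f :: "nat \<Rightarrow> complex"
  assumes "N \<ge> 2"
    and "real U \<ge> N"
    and "prime U\<^sub>1" and "U\<^sub>1 dvd U"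
    and "real U\<^sub>1 \<in> {N powr (1/4)..N powr (3/4)}"
    and "\<U> \<subseteq> carrier (residue_ring (int U))"
    and "distinct_subset_sums_mod \<U> (int U\<^sub>1)"
    and "S \<noteq> {}"
    and "S \<subseteq> {p. prime p \<and> N powr (1/4) \<le> real p \<and> real p \<le> N}"
    and "{n. f n \<noteq> 0} \<subseteq> S"
  shows "(\<Sum>u\<in>\<U>. (cmod (\<Sum>p | prime p \<and> real p \<le> N.
              f p * e (of_int u * real p / real U)))\<^sup>2)
         \<le> 30 * real (card S) * l2_norm_sq f * exp (real U / N)
             * ln (8 * N / (real (card S) * ln N))"
proof -
  have N1: "N > 1" and N0: "N > 0" using assms(1) by auto
  have lnN0: "ln N > 0" using N1 by simp
  have finN: "finite {p::nat. real p \<le> N}"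
    by (rule finite_subset[OF _ finite_atMost[of "nat \<lfloor>N\<rfloor>"]]) (auto simp: le_nat_floor)
  have finS: "finite S" by (rule finite_subset[OF _ finN]) (use assms(9) in auto)
  have S0: "real (card S) > 0" using assms(8) finS by (simp add: card_gt_0_iff)
  have finX: "finite \<U>" by (rule finite_subset[OF assms(6)]) (simp add: residue_ring_def)
  define L where "L = ln (8 * N / (real (card S) * ln N))"
  \<comment> \<open>The cut 1/2 gives card S * ln N <= (2 + 25/9) N = 43/9 N for every N in
    question, so the argument of the logarithm is at least 72/43, which exceeds sqrt e.\<close>
  have L: "L \<ge> 1 / 2"
  proof -
    have "ln (N powr (1/2)) \<le> N powr (1/2) - 1" using N0 by (intro ln_le_minus_one) auto
    then have "ln N \<le> 2 * N powr (1/2)" using N0 by (simp add: ln_powr)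
    then have "N powr (1/2) * ln N \<le> N powr (1/2) * (2 * N powr (1/2))" by (intro mult_left_mono) auto
    also have "\<dots> = 2 * N" using N0 by (simp flip: powr_add)
    finally have "N powr (1/2) * ln N \<le> 2 * N" .
    moreover have "real (card S) * ln N \<le> N powr (1/2) * ln N + N * ln 4 / (1/2)"
      using N1 assms(9) by (intro card_primes_le) auto
    moreover have "N * ln 4 / (1/2) \<le> N * (25 / 18) / (1/2)"
      using ln_4_le N0 by (intro divide_right_mono mult_left_mono) auto
    ultimately have "real (card S) * ln N \<le> 43 / 9 * N" by simp
    then have ge: "72 / 43 \<le> 8 * N / (real (card S) * ln N)"
      using S0 lnN0 by (simp add: field_simps)
    have "exp (1/2) \<le> (72 / 43 :: real)"
    proof (rule power2_le_imp_le)
      have "(exp (1/2))\<^sup>2 = exp (1::real)" by (simp flip: exp_double)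
      then show "(exp (1/2))\<^sup>2 \<le> (72 / 43 :: real)\<^sup>2" using exp_1_bounds by (simp add: power_divide)
    qed simp
    then have "exp (1/2) \<le> 8 * N / (real (card S) * ln N)" using ge by linarith
    moreover have "8 * N / (real (card S) * ln N) > 0" using N0 S0 lnN0 by simp
    ultimately show ?thesis unfolding L_def by (simp only: ln_ge_iff)
  qed
  define K where "K = 30 * real (card S) * exp (real U / N) * L"
  have K0: "K \<ge> 0" using L by (simp add: K_def)
  have ms: "(\<Sum>p\<in>S. (cmod (\<Sum>u\<in>\<U>. c u * e (of_int u * real p / real U)))\<^sup>2) \<le> K * (\<Sum>u\<in>\<U>. (cmod (c u))\<^sup>2)" for c
  \<comment> \<open>The trivial bound suffices up to 40 because 30 * 2.7 * 1/2 = 40.5. A larger set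
    forces 2^40 <= \<open>U\<^sub>1\<close> <= N^(3/4), hence ln N >= (160/3) ln 2 > 35, the range
    of \<open>mean_square_primes_le\<close>.\<close>
  proof (cases "card \<U> \<le> 40")
    case True
    have "real (card S) * real (card \<U>) \<le> K"
    proof -
      have "exp 1 \<le> exp (real U / N)" using assms(2) N0 by simp
      then have "2.7 \<le> exp (real U / N)" using exp_1_bounds by linarith
      then have "2.7 * (1/2) \<le> exp (real U / N) * L" using L by (intro mult_mono) auto
      then have "real (card \<U>) \<le> 30 * (exp (real U / N) * L)" using True by simp
      then have "real (card S) * real (card \<U>) \<le> real (card S) * (30 * (exp (real U / N) * L))"
        by (intro mult_left_mono) auto
      then show ?thesis by (simp add: K_def mult_ac)
    qed
    then have "real (card S) * real (card \<U>) * (\<Sum>u\<in>\<U>. (cmod (c u))\<^sup>2) \<le> K * (\<Sum>u\<in>\<U>. (cmod (c u))\<^sup>2)"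
      by (intro mult_right_mono) (auto intro!: sum_nonneg)
    with mean_square_le_card_mult show ?thesis by (rule order_trans)
  next
    case False
    have "(2::int) ^ 40 \<le> 2 ^ card \<U>" using False by (intro power_increasing) auto
    also have "\<dots> \<le> int U\<^sub>1"
      using assms(3) by (intro card_dissociated_le[OF finX assms(7)]) (simp add: prime_gt_0_nat)
    finally have "real_of_int (2 ^ 40) \<le> real_of_int (int U\<^sub>1)" by (simp only: of_int_le_iff)
    then have "(2::real) ^ 40 \<le> N powr (3/4)" using assms(5) by simp
    then have "ln ((2::real) ^ 40) \<le> ln (N powr (3/4))" by (intro ln_mono) auto
    moreover have "ln ((2::real) ^ 40) = real 40 * ln 2" by (rule ln_realpow)
    moreover have "ln (N powr (3/4)) = 3/4 * ln N" using N0 by (simp add: ln_powr)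
    ultimately have "real 40 * ln 2 \<le> 3/4 * ln N" by (simp only:)
    then have "ln N \<ge> 35" using ln2_ge_two_thirds by simp
    then show ?thesis
      unfolding K_def L_def using assms finX N1 by (intro mean_square_primes_le[where m = U\<^sub>1]) auto
  qed
  have restr: "(\<Sum>p | prime p \<and> real p \<le> N. f p * e (of_int u * real p / real U))
      = (\<Sum>p\<in>S. f p * e (of_int u * real p / real U))" for u
    using assms(9,10) by (intro sum.mono_neutral_right) (auto intro: finite_subset[OF _ finN])
  have "l2_norm_sq f = (\<Sum>\<^sub>\<infinity>n\<in>S. (cmod (f n))\<^sup>2)"
    unfolding l2_norm_sq_def using assms(10) by (intro infsum_cong_neutral) auto
  then have l2: "l2_norm_sq f = (\<Sum>p\<in>S. (cmod (f p))\<^sup>2)" using finS by simp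
  have "(\<Sum>u\<in>\<U>. (cmod (\<Sum>p\<in>S. f p * e (of_int u * real p / real U)))\<^sup>2) \<le> K * (\<Sum>p\<in>S. (cmod (f p))\<^sup>2)"
    by (rule bilinear_duality[OF ms K0])
  then show ?thesis unfolding restr l2 by (simp add: K_def L_def mult_ac)
qed

end
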